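(* Let $M$ be a stable metric space. Then $M$ is nearly isometrically embeddable into the class of reflexive Banach spaces.
   Context: A metric space $(X,d_X)$ is stable if for any two bounded sequences $(x_n)_{n=1}^\infty$, $(y_n)_{n=1}^\infty$ in $X$ and any two non-principal ultrafilters $\mathcal U,\mathcal V$ on $\mathbb N$, one has $\lim_{m,\mathcal U}\lim_{n,\mathcal V}d_X(x_m,y_n)=\lim_{n,\mathcal V}\lim_{m,\mathcal U}d_X(x_m,y_n)$. For a map $f\colon X\to Y$ between metric spaces, $\rho_f(t)=\inf\{d_Y(f(x),f(y))\colon d_X(x,y)\ge t\}$ (with $\inf\emptyset=+\infty$) and $\omega_f(t)=\sup\{d_Y(f(x),f(y))\colon d_X(x,y)\le t\}$. $\mathcal P$ is the set of continuous functions $\rho\colon[0,\infty)\to[0,\infty)$ such that $\rho(t)=t$ for all $t\in[0,1]$, $\rho(t)\le t$ for all $t\ge1$, and $\lim_{t\to+\infty}\frac{\rho(t)}{t}=0$. $\Omega$ is the set of continuous functions $\omega\colon[0,\infty)\to[0,\infty)$ such that $\omega(0)=0$, $t\le\omega(t)$ for all $t\in[0,1]$, $\lim_{t\to0}\frac{\omega(t)}{t}=\infty$, and $\omega(t)=t$ for all $t\ge1$. Let $\mathcal C$ be a class of metric spaces. A metric space $(X,d_X)$ nearly isometrically embeds into the class $\mathcal C$ if there exist a family of spaces $(Y_{\rho,\omega})_{(\rho,\omega)\in\mathcal P\times\Omega}$ in $\mathcal C$ and a family of maps $f_{\rho,\omega}\colon X\to Y_{\rho,\omega}$, $(\rho,\omega)\in\mathcal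 P\times\Omega$, such that $\rho(t)\le\rho_{f_{\rho,\omega}}(t)$ and $\omega_{f_{\rho,\omega}}(t)\le\omega(t)$ for all $t$. *)

theory Defs
  imports "HOL-Analysis.Analysis" "HOL-Algebra.Algebraic_Closure_Type"
begin

no_notation Polynomials.var (\<open>X\<index>\<close>)

section \<open>Stable metric spaces\<close>

definition ultrafilter :: "'i filter \<Rightarrow> bool" where
  "ultrafilter F \<longleftrightarrow> F \<noteq> bot \<and> (\<forall>P. eventually P F \<or> eventually (\<lambda>i. \<not> P i) F)"

definition nonprincipal_ultrafilter :: "'i filter \<Rightarrow> bool" where
  "nonprincipal_ultrafilter F \<longleftrightarrow> ultrafilter F \<and> (\<forall>i. F \<noteq> principal {i})"

text \<open>
  All the limits below exist: along an ultrafilter every bounded real function converges,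
  so \<open>Lim\<close> never takes an unspecified value here.
\<close>

definition stable_metric :: "'a metric \<Rightarrow> bool" where
  "stable_metric X \<longleftrightarrow>
     (\<forall>(x :: nat \<Rightarrow> 'a) (y :: nat \<Rightarrow> 'a) (U :: nat filter) (V :: nat filter).
        range x \<subseteq> mspace X \<longrightarrow> range y \<subseteq> mspace X \<longrightarrow>
        Metric_space.mbounded (mspace X) (mdist X) (range x) \<longrightarrow>
        Metric_space.mbounded (mspace X) (mdist X) (range y) \<longrightarrow>
        nonprincipal_ultrafilter U \<longrightarrow> nonprincipal_ultrafilter V \<longrightarrow>
        Lim U (\<lambda>m. Lim V (\<lambda>n. mdist X (x m) (y n))) =
        Lim V (\<lambda>n. Lim U (\<lambda>m. mdist X (x m) (y n))))"


section \<open>Nearly isometric embeddings\<close>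

definition compression_modulus ::
    "'a metric \<Rightarrow> 'b metric \<Rightarrow> ('a \<Rightarrow> 'b) \<Rightarrow> real \<Rightarrow> ereal" where
  "compression_modulus X Y f t =
     Inf {ereal (mdist Y (f x) (f y)) | x y. x \<in> mspace X \<and> y \<in> mspace X \<and> mdist X x y \<ge> t}"

definition expansion_modulus ::
    "'a metric \<Rightarrow> 'b metric \<Rightarrow> ('a \<Rightarrow> 'b) \<Rightarrow> real \<Rightarrow> ereal" where
  "expansion_modulus X Y f t =
     Sup {ereal (mdist Y (f x) (f y)) | x y. x \<in> mspace X \<and> y \<in> mspace X \<and> mdist X x y \<le> t}"

text \<open>
  Functions from \<open>[0,\<infinity>)\<close> to itself are represented by functions on the reals. Their values at
  negative arguments are unconstrained, and are never used.
\<close>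

definition lower_controls :: "(real \<Rightarrow> real) set" where
  "lower_controls = {\<rho>. \<rho> \<in> {0..} \<rightarrow> {0..} \<and> continuous_on {0..} \<rho> \<and>
     (\<forall>t\<in>{0..1}. \<rho> t = t) \<and> (\<forall>t\<ge>1. \<rho> t \<le> t) \<and>
     ((\<lambda>t. \<rho> t / t) \<longlongrightarrow> 0) at_top}"

definition upper_controls :: "(real \<Rightarrow> real) set" where
  "upper_controls = {\<omega>. \<omega> \<in> {0..} \<rightarrow> {0..} \<and> continuous_on {0..} \<omega> \<and>
     \<omega> 0 = 0 \<and> (\<forall>t\<in>{0..1}. t \<le> \<omega> t) \<and>
     filterlim (\<lambda>t. \<omega> t / t) at_top (at_right 0) \<and> (\<forall>t\<ge>1. \<omega> t = t)}"

definition nearly_isometrically_embeds :: "'a metric \<Rightarrow> 'b metric set \<Rightarrow> bool" where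
  "nearly_isometrically_embeds X C \<longleftrightarrow>
     (\<exists>(Y :: (real \<Rightarrow> real) \<Rightarrow> (real \<Rightarrow> real) \<Rightarrow> 'b metric)
       (f :: (real \<Rightarrow> real) \<Rightarrow> (real \<Rightarrow> real) \<Rightarrow> 'a \<Rightarrow> 'b).
       \<forall>\<rho>\<in>lower_controls. \<forall>\<omega>\<in>upper_controls.
         Y \<rho> \<omega> \<in> C \<and> f \<rho> \<omega> \<in> mspace X \<rightarrow> mspace (Y \<rho> \<omega>) \<and>
         (\<forall>t\<ge>0. ereal (\<rho> t) \<le> compression_modulus X (Y \<rho> \<omega>) (f \<rho> \<omega>) t \<and>
                 expansion_modulus X (Y \<rho> \<omega>) (f \<rho> \<omega>) t \<le> ereal (\<omega> t)))"


section \<open>Reflexive Banach spaces\<close>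

text \<open>
  The existence of a target space has to be a statement inside the logic, so Banach spaces are
  carried by sets rather than by types. They extend the module records of the algebra library
  over \<open>ring_of_type_algebra :: real ring\<close>, the field of real numbers. The ring multiplication
  and unit that these records inherit are irrelevant.
\<close>

record 'b normed_module = "(real, 'b) module" +
  vnorm :: "'b \<Rightarrow> real"

locale real_normed_space = vs: Module.module "ring_of_type_algebra :: real ring" V
  for V :: "('b, 'm) normed_module_scheme" (structure) +
  assumes vnorm_zero_imp: "\<lbrakk>x \<in> carrier V; vnorm V x = 0\<rbrakk> \<Longrightarrow> x = \<zero>"
    and vnorm_smult: "x \<in> carrier V \<Longrightarrow> vnorm V (a \<odot> x) = \<bar>a\<bar> * vnorm V x"
    and vnorm_triangle:
      "\<lbrakk>x \<in> carrier V; y \<in> carrier V\<rbrakk> \<Longrightarrow> vnorm V (x \<oplus> y) \<le> vnorm V x + vnorm V y"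

text \<open>The library requires a metric to be symmetric and nonnegative off the carrier as well.\<close>

definition norm_metric :: "('b, 'm) normed_module_scheme \<Rightarrow> 'b metric" where
  "norm_metric V = metric (carrier V,
     \<lambda>x y. if x \<in> carrier V \<and> y \<in> carrier V then vnorm V (x \<ominus>\<^bsub>V\<^esub> y) else 0)"

definition banach_space :: "('b, 'm) normed_module_scheme \<Rightarrow> bool" where
  "banach_space V \<longleftrightarrow> real_normed_space V \<and> mcomplete_of (norm_metric V)"

text \<open>
  Functionals are made \<^const>\<open>extensional\<close>, so that two of them are equal
  iff they agree on the space.
\<close>

definition dual_space ::
    "('b, 'm) normed_module_scheme \<Rightarrow> ('b \<Rightarrow> real) normed_module" where
  "dual_space V =
     \<lparr> carrier = {\<phi> \<in> extensional (carrier V).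
         (\<forall>x\<in>carrier V. \<forall>y\<in>carrier V. \<phi> (x \<oplus>\<^bsub>V\<^esub> y) = \<phi> x + \<phi> y) \<and>
         (\<forall>a. \<forall>x\<in>carrier V. \<phi> (a \<odot>\<^bsub>V\<^esub> x) = a * \<phi> x) \<and>
         (\<exists>B. \<forall>x\<in>carrier V. \<bar>\<phi> x\<bar> \<le> B * vnorm V x)},
       monoid.mult = undefined,
       one = undefined,
       zero = (\<lambda>x\<in>carrier V. 0),
       add = (\<lambda>\<phi> \<psi>. \<lambda>x\<in>carrier V. \<phi> x + \<psi> x),
       smult = (\<lambda>a \<phi>. \<lambda>x\<in>carrier V. a * \<phi> x),
       vnorm = (\<lambda>\<phi>. Sup {\<bar>\<phi> x\<bar> | x. x \<in> carrier V \<and> vnorm V x \<le> 1}) \<rparr>"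

definition canonical_embedding ::
    "('b, 'm) normed_module_scheme \<Rightarrow> 'b \<Rightarrow> ('b \<Rightarrow> real) \<Rightarrow> real" where
  "canonical_embedding V x = (\<lambda>\<phi>\<in>carrier (dual_space V). \<phi> x)"

definition reflexive_space :: "('b, 'm) normed_module_scheme \<Rightarrow> bool" where
  "reflexive_space V \<longleftrightarrow>
     canonical_embedding V ` carrier V = carrier (dual_space (dual_space V))"

definition reflexive_banach_spaces :: "'b metric set" where
  "reflexive_banach_spaces =
     {norm_metric V | V :: 'b normed_module. banach_space V \<and> reflexive_space V}"

text \<open>
  An existential statement cannot range over types, so the points of the target spaces must be
  drawn from one type that is large enough. The following one is, for metric spaces with points
  in \<open>'a\<close>. Given a map \<open>f\<close> into any reflexive Banach space \<open>Y\<close>, the closed linear span of its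
  image is again a reflexive Banach space. Each of its points is determined by its distances to
  the finite rational linear combinations of the points \<open>f a\<close>, and these combinations can be
  indexed by \<open>nat \<times> 'a list\<close> (a code for the coefficients, and the points). Hence the
  span has an isometric copy whose points are elements of the type below.
\<close>

type_synonym 'a target_point = "nat \<times> 'a list \<Rightarrow> real"


section \<open>Basic facts\<close>

context real_normed_space
begin

lemma vnorm_zero: "vnorm V \<zero> = 0"
proof -
  have "vnorm V ((0::real) \<odot> \<zero>) = 0"
    by (subst vnorm_smult) auto
  moreover have "(0::real) \<odot> \<zero> = \<zero>"
    by (intro vs.smult_r_null) (simp add: ring_of_type_algebra_def)
  ultimately show ?thesis by simp
qed

lemma vnorm_minus:
  assumes "x \<in> carrier V"
  shows "vnorm V (\<ominus> x) = vnorm V x"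
proof -
  have m1: "\<ominus>\<^bsub>ring_of_type_algebra\<^esub> (1::real) = -1"
    by (rule vs.R.minus_equality) (auto simp: ring_of_type_algebra_def)
  have "\<ominus> x = (-1::real) \<odot> x"
    using vs.smult_l_minus[of 1 x] vs.smult_one[of x] assms
    unfolding m1 by (simp add: ring_of_type_algebra_def)
  thus ?thesis using vnorm_smult[of x "-1"] assms by simp
qed

lemma vnorm_nonneg:
  assumes "x \<in> carrier V"
  shows "0 \<le> vnorm V x"
  using vnorm_triangle[of x "\<ominus> x"] assms vnorm_zero vnorm_minus vs.M.r_neg by auto

lemma Metric_space_norm:
  "Metric_space (carrier V)
     (\<lambda>x y. if x \<in> carrier V \<and> y \<in> carrier V then vnorm V (x \<ominus> y) else 0)"
proof
  fix x y
  show "0 \<le> (if x \<in> carrier V \<and> y \<in> carrier V then vnorm V (x \<ominus> y) else 0)"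
    by (simp add: vnorm_nonneg)
  have "vnorm V (x \<ominus> y) = vnorm V (y \<ominus> x)" if "x \<in> carrier V" "y \<in> carrier V"
    using vnorm_minus[of "x \<ominus> y"] that
    by (simp add: vs.M.minus_eq vs.M.minus_add vs.M.a_comm)
  thus "(if x \<in> carrier V \<and> y \<in> carrier V then vnorm V (x \<ominus> y) else 0) =
        (if y \<in> carrier V \<and> x \<in> carrier V then vnorm V (y \<ominus> x) else 0)"
    by simp
next
  fix x y assume xy: "x \<in> carrier V" "y \<in> carrier V"
  have "x \<ominus> y = \<zero> \<longleftrightarrow> x = y"
    using xy by (metis vs.M.a_inv_closed vs.M.minus_eq vs.M.minus_equality vs.M.minus_minus
        vs.M.r_neg)
  thus "(if x \<in> carrier V \<and> y \<in> carrier V then vnorm V (x \<ominus> y) else 0) = 0 \<longleftrightarrow> x = y"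
    using xy vnorm_zero vnorm_zero_imp[of "x \<ominus> y"] by auto
next
  fix x y z assume xyz: "x \<in> carrier V" "y \<in> carrier V" "z \<in> carrier V"
  have "x \<ominus> z = (x \<ominus> y) \<oplus> (y \<ominus> z)"
    using xyz by (simp add: vs.M.minus_eq vs.M.a_assoc vs.M.r_neg1)
  thus "(if x \<in> carrier V \<and> z \<in> carrier V then vnorm V (x \<ominus> z) else 0) \<le>
        (if x \<in> carrier V \<and> y \<in> carrier V then vnorm V (x \<ominus> y) else 0) +
        (if y \<in> carrier V \<and> z \<in> carrier V then vnorm V (y \<ominus> z) else 0)"
    using vnorm_triangle[of "x \<ominus> y" "y \<ominus> z"] xyz by simp
qed

lemma mspace_norm_metric: "mspace (norm_metric V) = carrier V"
  unfolding norm_metric_def by (rule Metric_space.mspace_metric[OF Metric_space_norm])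

lemma mdist_norm_metric:
  "\<lbrakk>x \<in> carrier V; y \<in> carrier V\<rbrakk> \<Longrightarrow> mdist (norm_metric V) x y = vnorm V (x \<ominus> y)"
  unfolding norm_metric_def by (simp add: Metric_space.mdist_metric[OF Metric_space_norm])

end

end

theory Submission
  imports Defs
begin

text \<open>
  Let \<open>\<rho>\<close> and \<open>\<omega>\<close> be the control functions, made monotone. For \<open>p, q \<in> M\<close> let \<open>\<tau>\<^sub>p\<^sub>q\<close> be the tent
  function of height \<open>\<rho> (d p q)\<close> centred at \<open>q\<close> that vanishes at distance \<open>d p q\<close> from \<open>q\<close>, and map \<open>x\<close> to
  the bounded function \<open>(p, q) \<mapsto> \<tau>\<^sub>p\<^sub>q x - \<tau>\<^sub>p\<^sub>q z\<close>. The quotients \<open>(\<tau>\<^sub>p\<^sub>q x - \<tau>\<^sub>p\<^sub>q y) / \<omega> (d x y)\<close> form a subset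
  \<open>C\<close> of the unit ball \<open>B\<close> of \<open>\<ell>\<^sub>\<infinity>\<close>, and stability, with the growth conditions on \<open>\<rho>\<close> and \<open>\<omega>\<close>, gives
  Grothendieck's double limit criterion, so \<open>C\<close> is relatively weakly compact. Interpolating
  between \<open>C\<close> and \<open>\<ell>\<^sub>\<infinity>\<close> as Davis, Figiel, Johnson and Pelczynski do yields a reflexive space \<open>V\<close>
  whose unit ball lies between \<open>C\<close> and \<open>B\<close>: the first inclusion gives
  \<open>\<parallel>f x - f y\<parallel> \<le> \<omega> (d x y)\<close>, and the second \<open>\<rho> (d x y) \<le> \<parallel>f x - f y\<parallel>\<close>.

  For reflexivity it suffices that the finitely supported functionals are dense in the dual of
  \<open>V\<close>. A functional on \<open>V\<close> is close to the restriction of one on \<open>\<ell>\<^sub>\<infinity>\<close>, and the latter is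
  a uniform limit on \<open>C\<close> of finitely supported ones by the double limit criterion.
\<close>

section \<open>Ultrafilters\<close>

text \<open>Both estimates need the constant 1, and this dictates the weights:
  \<open>a n + b n = sqrt (2 ^ Suc n)\<close> makes the squares of the reciprocals sum to exactly 1,
  and that sum enters in both inclusions between \<open>C\<close>, the unit ball of \<open>V\<close>
  and B. That \<open>b\<close> tends to 0 serves the density of the finitely supported functionals.
  The controls are made monotone because a modulus at t looks at all pairs at distance at least (or
  at most) t, whereas the construction only sees the control at the distance of the given pair.
  Their growth conditions cover the two degenerate regimes: for d p q tending to infinity the tents
  become flat, and for d x y tending to 0 the quotients vanish. In between, the metric may be
  truncated and stability applies. No weak topology appears. Compactness is used only as interchange
  of limits along ultrafilters, where bounded iterated limits always exist. Likewise the gauges are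
  suprema of finitely supported functionals, so an element of the bidual, recovered coordinatewise
  as a function, can be estimated directly.\<close>

lemma ultrafilter_not_bot: "ultrafilter U \<Longrightarrow> U \<noteq> bot"
  and ultrafilter_cases: "ultrafilter U \<Longrightarrow> eventually P U \<or> eventually (\<lambda>i. \<not> P i) U"
  by (auto simp: ultrafilter_def)

text \<open>If the complement of some singleton were not large, the ultrafilter would be principal;
  finite intersections of such complements give the tails. Ordinary sequential limits therefore
  persist along the ultrafilter.\<close>

lemma nonprincipal_ultrafilter_le_sequentially:
  assumes "nonprincipal_ultrafilter U"
  shows "U \<le> sequentially"
proof -
  have U: "ultrafilter U" and np: "\<And>i. U \<noteq> principal {i}"
    using assms by (auto simp: nonprincipal_ultrafilter_def)
  have ne: "eventually (\<lambda>j. j \<noteq> i) U" for i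
  proof (rule ccontr)
    assume "\<not> eventually (\<lambda>j. j \<noteq> i) U"
    then have i: "eventually (\<lambda>j. j = i) U"
      using ultrafilter_cases[OF U, of "\<lambda>j. j = i"] by auto
    have "eventually P U \<longleftrightarrow> P i" for P
    proof
      assume "eventually P U"
      then have "eventually (\<lambda>j. P i) U"
        using i by eventually_elim simp
      then show "P i"
        using ultrafilter_not_bot[OF U] by simp
    next
      assume "P i" then show "eventually P U"
        using i by (auto elim: eventually_mono)
    qed
    then have "U = principal {i}"
      by (intro filter_eq_iff[THEN iffD2]) (simp add: eventually_principal)
    then show False using np by simp
  qed
  have "eventually (\<lambda>j. j \<ge> N) U" for N
  proof -
    have "eventually (\<lambda>j. \<forall>i\<in>{..<N}. j \<noteq> i) U"
      using ne by (intro eventually_ball_finite) auto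
    then show ?thesis by (rule eventually_mono) (metis lessThan_iff not_le)
  qed
  then show ?thesis
    unfolding le_filter_def eventually_sequentially
    by (metis (mono_tags, lifting) eventually_mono)
qed

text \<open>Zorn's lemma yields a minimal proper filter below \<open>F\<close>: an event of the
  infimum of a chain is already an event of one member, so the infimum stays proper. A minimal
  proper filter is an ultrafilter, since restricting it to a set whose complement is not large
  changes nothing.\<close>

lemma ex_ultrafilter_le:
  assumes "F \<noteq> bot"
  shows "\<exists>U. ultrafilter U \<and> U \<le> F"
proof -
  define A where "A = {G. G \<noteq> bot \<and> G \<le> F}"
  have "\<exists>U\<in>A. \<forall>G\<in>A. U \<ge> G \<longrightarrow> G = U"
  proof (rule predicate_Zorn)
    show "partial_order_on A (relation_of (\<ge>) A)"
      by (auto simp: partial_order_on_def preorder_on_def refl_on_def trans_def antisym_def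
          relation_of_def)
    fix K assume K: "K \<in> Chains (relation_of (\<ge>) A)"
    then have KA: "K \<subseteq> A" and ch: "\<And>G H. G \<in> K \<Longrightarrow> H \<in> K \<Longrightarrow> G \<le> H \<or> H \<le> G"
      by (auto simp: Chains_def relation_of_def)
    show "\<exists>u\<in>A. \<forall>a\<in>K. u \<le> a"
    proof (cases "K = {}")
      case True
      then show ?thesis using assms by (auto simp: A_def)
    next
      case False
      have "eventually P (Inf K) \<longleftrightarrow> (\<exists>b\<in>K. eventually P b)" for P
        by (rule eventually_Inf_base[OF False]) (metis ch inf.absorb1 inf.absorb2 order_refl)
      then have "Inf K \<noteq> bot"
        using KA unfolding trivial_limit_def by (fastforce simp: A_def trivial_limit_def)
      moreover have "Inf K \<le> F"
        using False KA by (auto simp: A_def intro: Inf_lower2)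
      ultimately show ?thesis
        by (intro bexI[of _ "Inf K"]) (auto simp: A_def intro: Inf_lower)
    qed
  qed
  then obtain U where U: "U \<in> A" "\<And>G. G \<in> A \<Longrightarrow> G \<le> U \<Longrightarrow> G = U"
    by blast
  have "eventually P U" if "\<not> eventually (\<lambda>i. \<not> P i) U" for P
  proof -
    have "inf U (principal {i. P i}) \<noteq> bot"
      using that by (simp add: trivial_limit_def eventually_inf_principal)
    then have "inf U (principal {i. P i}) = U"
      using U(1) by (intro U(2)) (auto simp: A_def intro: le_infI1)
    then show ?thesis
      by (metis (mono_tags, lifting) eventually_inf_principal eventually_mono mem_Collect_eq
          always_eventually)
  qed
  then show ?thesis
    using U(1) by (auto simp: ultrafilter_def A_def)
qed

lemma ex_nonprincipal_ultrafilter: "\<exists>U :: nat filter. nonprincipal_ultrafilter U"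
proof -
  obtain U :: "nat filter" where U: "ultrafilter U" "U \<le> sequentially"
    using ex_ultrafilter_le[OF sequentially_bot] by auto
  have "U \<noteq> principal {i}" for i
  proof
    assume "U = principal {i}"
    moreover have "eventually (\<lambda>j. j > i) U"
      using U(2) filter_leD eventually_gt_at_top by blast
    ultimately show False by (simp add: eventually_principal)
  qed
  then show ?thesis using U by (auto simp: nonprincipal_ultrafilter_def)
qed

text \<open>Compactness of the interval gives a cluster point of the image filter, and an
  ultrafilter converges to each of its cluster points.\<close>

lemma ultrafilter_tendsto_Lim:
  fixes f :: "'i \<Rightarrow> real"
  assumes U: "ultrafilter U" and "eventually (\<lambda>i. \<bar>f i\<bar> \<le> B) U"
  shows "(f \<longlongrightarrow> Lim U f) U"
proof -
  have "compact {-B..B}" by simp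
  moreover have "eventually (\<lambda>x. x \<in> {-B..B}) (filtermap f U)"
    using assms(2) by (auto simp: eventually_filtermap abs_le_iff elim!: eventually_mono)
  moreover have "filtermap f U \<noteq> bot"
    using ultrafilter_not_bot[OF U] by (simp add: filtermap_bot_iff)
  ultimately obtain l where l: "inf (nhds l) (filtermap f U) \<noteq> bot"
    unfolding compact_filter by blast
  have "(f \<longlongrightarrow> l) U"
  proof (rule topological_tendstoI)
    fix S assume S: "open S" "l \<in> S"
    show "eventually (\<lambda>i. f i \<in> S) U"
    proof (rule ccontr)
      assume "\<not> ?thesis"
      then have "eventually (\<lambda>i. f i \<notin> S) U"
        using ultrafilter_cases[OF U] by blast
      then have "eventually (\<lambda>x. x \<notin> S) (filtermap f U)"
        by (simp add: eventually_filtermap)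
      moreover have "eventually (\<lambda>x. x \<in> S) (nhds l)"
        using S by (auto simp: eventually_nhds)
      ultimately have "eventually (\<lambda>x. False) (inf (nhds l) (filtermap f U))"
        unfolding eventually_inf by blast
      then show False using l by (simp add: trivial_limit_def)
    qed
  qed
  moreover from this have "Lim U f = l"
    using ultrafilter_not_bot[OF U] by (intro tendsto_Lim) auto
  ultimately show ?thesis by simp
qed

text \<open>This dichotomy drives the case distinctions for stable metrics: along an ultrafilter a
  real quantity has no third kind of behaviour.\<close>

lemma ultrafilter_bounded_or_at_top:
  fixes f :: "'i \<Rightarrow> real"
  assumes "ultrafilter U"
  obtains B where "eventually (\<lambda>i. f i \<le> B) U" | "filterlim f at_top U"
proof (cases "\<exists>B. eventually (\<lambda>i. f i \<le> B) U")
  case False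
  then have "eventually (\<lambda>i. B \<le> f i) U" for B
    using ultrafilter_cases[OF assms, of "\<lambda>i. f i \<le> B"] by (auto elim: eventually_mono)
  then show ?thesis using that(2) by (auto simp: filterlim_at_top)
qed (use that in auto)

lemma Lim_le_const:
  fixes f :: "'i \<Rightarrow> real"
  assumes "U \<noteq> bot" "(f \<longlongrightarrow> Lim U f) U" "eventually (\<lambda>i. f i \<le> a) U"
  shows "Lim U f \<le> a"
  using tendsto_upperbound[OF assms(2,3)] assms(1) by auto

lemma Lim_ge_const:
  fixes f :: "'i \<Rightarrow> real"
  assumes "U \<noteq> bot" "(f \<longlongrightarrow> Lim U f) U" "eventually (\<lambda>i. a \<le> f i) U"
  shows "a \<le> Lim U f"
  using tendsto_lowerbound[OF assms(2,3)] assms(1) by auto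

lemma abs_Lim_le:
  fixes f :: "'i \<Rightarrow> real"
  assumes U: "ultrafilter U" and ev: "eventually (\<lambda>i. \<bar>f i\<bar> \<le> B) U"
  shows "\<bar>Lim U f\<bar> \<le> B"
proof -
  have "eventually (\<lambda>i. f i \<le> B) U" "eventually (\<lambda>i. -B \<le> f i) U"
    using ev by (auto elim!: eventually_mono)
  then show ?thesis
    using Lim_le_const[OF ultrafilter_not_bot[OF U] ultrafilter_tendsto_Lim[OF U ev], of B]
      Lim_ge_const[OF ultrafilter_not_bot[OF U] ultrafilter_tendsto_Lim[OF U ev], of "-B"]
    by (auto simp: abs_le_iff)
qed

section \<open>The double limit property\<close>

text \<open>Grothendieck's interchange condition. For a bounded kernel every limit in it exists,
  because the limits are taken along ultrafilters.\<close>

definition double_limit :: "'a set \<Rightarrow> 'b set \<Rightarrow> ('a \<Rightarrow> 'b \<Rightarrow> real) \<Rightarrow> bool" where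
  "double_limit A B k \<longleftrightarrow>
     (\<forall>(a :: nat \<Rightarrow> 'a) (b :: nat \<Rightarrow> 'b) U V. range a \<subseteq> A \<longrightarrow> range b \<subseteq> B \<longrightarrow>
        nonprincipal_ultrafilter U \<longrightarrow> nonprincipal_ultrafilter V \<longrightarrow>
        Lim U (\<lambda>m. Lim V (\<lambda>n. k (a m) (b n))) = Lim V (\<lambda>n. Lim U (\<lambda>m. k (a m) (b n))))"

lemma double_limit_swap: "double_limit A B k \<Longrightarrow> double_limit B A (\<lambda>b a. k a b)"
  unfolding double_limit_def by metis

text \<open>Along \<open>U\<close> a sequence in \<open>insert v A\<close> is either almost always
  \<open>v\<close>, and both sides reduce to the limit of \<open>k v\<close>, or almost always in
  \<open>A\<close>.\<close>

lemma double_limit_insert: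
  assumes dl: "double_limit A B k" and bd: "\<And>b. b \<in> B \<Longrightarrow> \<bar>k v b\<bar> \<le> K"
  shows "double_limit (insert v A) B k"
  unfolding double_limit_def
proof (intro allI impI)
  fix a :: "nat \<Rightarrow> 'a" and b :: "nat \<Rightarrow> 'b" and U V :: "nat filter"
  assume a: "range a \<subseteq> insert v A" and b: "range b \<subseteq> B"
    and U: "nonprincipal_ultrafilter U" and V: "nonprincipal_ultrafilter V"
  have uU: "ultrafilter U" and uV: "ultrafilter V"
    using U V by (auto simp: nonprincipal_ultrafilter_def)
  note [simp] = ultrafilter_not_bot[OF uU]
  consider "eventually (\<lambda>m. a m = v) U" | "eventually (\<lambda>m. a m \<in> A) U"
  proof -
    have "eventually (\<lambda>m. a m \<in> A) U" if "eventually (\<lambda>m. a m \<noteq> v) U"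
      using that a by (auto elim!: eventually_mono)
    then show ?thesis
      using that ultrafilter_cases[OF uU, of "\<lambda>m. a m = v"] by blast
  qed
  then show "Lim U (\<lambda>m. Lim V (\<lambda>n. k (a m) (b n))) = Lim V (\<lambda>n. Lim U (\<lambda>m. k (a m) (b n)))"
  proof cases
    case 1
    have c: "Lim U (\<lambda>m. f (a m)) = f v" for f :: "'a \<Rightarrow> real"
    proof -
      have "Lim U (\<lambda>m. f (a m)) = Lim U (\<lambda>m. f v)"
        using 1 by (intro Lim_cong) (auto elim: eventually_mono)
      then show ?thesis by (simp add: tendsto_Lim)
    qed
    show ?thesis
      using c[of "\<lambda>x. Lim V (\<lambda>n. k x (b n))"] c[of "\<lambda>x. k x (b n)" for n] by simp
  next
    case 2
    then obtain m0 where "a m0 \<in> A"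
      using eventually_happens[OF 2] by auto
    define a' where "a' m = (if a m \<in> A then a m else a m0)" for m
    have c: "Lim U (\<lambda>m. f (a m)) = Lim U (\<lambda>m. f (a' m))" for f :: "'a \<Rightarrow> real"
      using 2 by (intro Lim_cong) (auto simp: a'_def elim: eventually_mono)
    have "range a' \<subseteq> A" using \<open>a m0 \<in> A\<close> by (auto simp: a'_def)
    then have "Lim U (\<lambda>m. Lim V (\<lambda>n. k (a' m) (b n))) = Lim V (\<lambda>n. Lim U (\<lambda>m. k (a' m) (b n)))"
      using dl b U V unfolding double_limit_def by blast
    then show ?thesis
      using c[of "\<lambda>x. Lim V (\<lambda>n. k x (b n))"] c[of "\<lambda>x. k x (b n)" for n] by simp
  qed
qed

section \<open>Finitely supported functionals\<close>

text \<open>Integration against a finitely supported signed measure of total variation at most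
  \<open>L\<close>. The index set may itself consist of functions, which is how measures on
  \<open>C\<close> are treated later.\<close>

definition fin_functionals :: "'i set \<Rightarrow> real \<Rightarrow> (('i \<Rightarrow> real) \<Rightarrow> real) set" where
  "fin_functionals S L =
     {\<lambda>f. \<Sum>i\<in>F. z i * f i | F z. finite F \<and> F \<subseteq> S \<and> (\<Sum>i\<in>F. \<bar>z i\<bar>) \<le> L}"

lemma fin_functionalsE:
  assumes "\<zeta> \<in> fin_functionals S L"
  obtains F z where "finite F" "F \<subseteq> S" "(\<Sum>i\<in>F. \<bar>z i\<bar>) \<le> L" "\<zeta> = (\<lambda>f. \<Sum>i\<in>F. z i * f i)"
  using assms unfolding fin_functionals_def by blast

lemma fin_functionalsI:
  "finite F \<Longrightarrow> F \<subseteq> S \<Longrightarrow> (\<Sum>i\<in>F. \<bar>z i\<bar>) \<le> L \<Longrightarrow> (\<lambda>f. \<Sum>i\<in>F. z i * f i) \<in> fin_functionals S L"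
  unfolding fin_functionals_def by blast

lemma fin_functionals_nonneg: "\<zeta> \<in> fin_functionals S L \<Longrightarrow> 0 \<le> L"
  by (elim fin_functionalsE) (metis (no_types, lifting) abs_ge_zero order_trans sum_nonneg)

lemma fin_functionals_add: "\<zeta> \<in> fin_functionals S L \<Longrightarrow> \<zeta> (\<lambda>i. f i + g i) = \<zeta> f + \<zeta> g"
  by (elim fin_functionalsE) (simp add: distrib_left sum.distrib)

lemma fin_functionals_mult: "\<zeta> \<in> fin_functionals S L \<Longrightarrow> \<zeta> (\<lambda>i. r * f i) = r * \<zeta> f"
  by (elim fin_functionalsE) (simp add: sum_distrib_left mult_ac)

lemma fin_functionals_sum:
  "\<zeta> \<in> fin_functionals S L \<Longrightarrow> \<zeta> (\<lambda>i. \<Sum>j\<in>J. f j i) = (\<Sum>j\<in>J. \<zeta> (f j))"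
  by (elim fin_functionalsE) (simp add: sum_distrib_left sum.swap[of _ J])

lemma fin_functionals_tendsto:
  assumes "\<zeta> \<in> fin_functionals S L" "\<And>i. i \<in> S \<Longrightarrow> ((\<lambda>m. f m i) \<longlongrightarrow> g i) U"
  shows "((\<lambda>m. \<zeta> (f m)) \<longlongrightarrow> \<zeta> g) U"
  using assms by (elim fin_functionalsE) (auto intro!: tendsto_intros)

lemma fin_functionals_bound:
  assumes "\<zeta> \<in> fin_functionals S L" "0 \<le> B" "\<And>i. i \<in> S \<Longrightarrow> \<bar>f i\<bar> \<le> B"
  shows "\<bar>\<zeta> f\<bar> \<le> L * B"
proof -
  obtain F z where F: "finite F" "F \<subseteq> S" "(\<Sum>i\<in>F. \<bar>z i\<bar>) \<le> L" "\<zeta> = (\<lambda>f. \<Sum>i\<in>F. z i * f i)"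
    using assms(1) by (rule fin_functionalsE)
  have "\<bar>\<zeta> f\<bar> \<le> (\<Sum>i\<in>F. \<bar>z i\<bar> * B)"
    unfolding F(4) using assms F(2)
    by (intro order_trans[OF sum_abs] sum_mono) (auto simp: abs_mult intro!: mult_left_mono)
  also have "\<dots> \<le> L * B"
    using F(3) assms(2) by (simp add: mult_right_mono flip: sum_distrib_right)
  finally show ?thesis .
qed

lemma eval_in_fin_functionals: "i \<in> S \<Longrightarrow> (\<lambda>f. f i) \<in> fin_functionals S 1"
  using fin_functionalsI[of "{i}" S "\<lambda>_. 1" 1] by simp

lemma zero_in_fin_functionals: "0 \<le> L \<Longrightarrow> (\<lambda>f. 0) \<in> fin_functionals S L"
  using fin_functionalsI[of "{}" S _ L] by simp

lemma fin_functionals_scale: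
  "\<zeta> \<in> fin_functionals S L \<Longrightarrow> (\<lambda>f. r * \<zeta> f) \<in> fin_functionals S (\<bar>r\<bar> * L)"
proof (elim fin_functionalsE)
  fix F z assume F: "finite F" "F \<subseteq> S" "(\<Sum>i\<in>F. \<bar>z i\<bar>) \<le> L" "\<zeta> = (\<lambda>f. \<Sum>i\<in>F. z i * f i)"
  have "(\<Sum>i\<in>F. \<bar>r * z i\<bar>) \<le> \<bar>r\<bar> * L"
    using F(3) by (simp add: abs_mult mult_left_mono flip: sum_distrib_left)
  from fin_functionalsI[OF F(1,2) this] show ?thesis
    unfolding F(4) by (simp add: sum_distrib_left mult_ac)
qed

lemma fin_functionals_plus:
  assumes "\<zeta> \<in> fin_functionals S L" "\<eta> \<in> fin_functionals S L'"
  shows "(\<lambda>f. \<zeta> f + \<eta> f) \<in> fin_functionals S (L + L')"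
proof -
  obtain F z where F: "finite F" "F \<subseteq> S" "(\<Sum>i\<in>F. \<bar>z i\<bar>) \<le> L" "\<zeta> = (\<lambda>f. \<Sum>i\<in>F. z i * f i)"
    using assms(1) by (rule fin_functionalsE)
  obtain G y where G: "finite G" "G \<subseteq> S" "(\<Sum>i\<in>G. \<bar>y i\<bar>) \<le> L'" "\<eta> = (\<lambda>f. \<Sum>i\<in>G. y i * f i)"
    using assms(2) by (rule fin_functionalsE)
  define x where "x i = (if i \<in> F then z i else 0) + (if i \<in> G then y i else 0)" for i
  have "(\<Sum>i\<in>F \<union> G. \<bar>x i\<bar>)
      \<le> (\<Sum>i\<in>F \<union> G. (if i \<in> F then \<bar>z i\<bar> else 0) + (if i \<in> G then \<bar>y i\<bar> else 0))"
    by (intro sum_mono) (auto simp: x_def)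
  also have "\<dots> = (\<Sum>i\<in>F. \<bar>z i\<bar>) + (\<Sum>i\<in>G. \<bar>y i\<bar>)"
    using F(1) G(1)
    by (simp add: sum.distrib Un_Int_distrib2 Int_absorb1 Int_absorb2 flip: sum.inter_restrict)
  finally have "(\<Sum>i\<in>F \<union> G. \<bar>x i\<bar>) \<le> L + L'"
    using F(3) G(3) by linarith
  from fin_functionalsI[OF _ _ this] F(1,2) G(1,2)
  have "(\<lambda>f. \<Sum>i\<in>F \<union> G. x i * f i) \<in> fin_functionals S (L + L')"
    by auto
  moreover have "(\<Sum>i\<in>F \<union> G. x i * f i) = \<zeta> f + \<eta> f" for f
  proof -
    have "(\<Sum>i\<in>F \<union> G. x i * f i)
      = (\<Sum>i\<in>F \<union> G. (if i \<in> F then z i * f i else 0) + (if i \<in> G then y i * f i else 0))"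
      by (intro sum.cong) (auto simp: x_def distrib_right)
    also have "\<dots> = \<zeta> f + \<eta> f"
      unfolding F(4) G(4) using F(1) G(1)
      by (simp add: sum.distrib Un_Int_distrib2 Int_absorb1 Int_absorb2 flip: sum.inter_restrict)
    finally show ?thesis .
  qed
  ultimately show ?thesis by simp
qed

lemma fin_functionals_minus:
  assumes "\<zeta> \<in> fin_functionals S L" "\<eta> \<in> fin_functionals S L'"
  shows "(\<lambda>f. \<zeta> f - \<eta> f) \<in> fin_functionals S (L + L')"
  using fin_functionals_plus[OF assms(1) fin_functionals_scale[OF assms(2), of "-1"]] by simp

lemma fin_functionals_sum_in:
  assumes "finite N" "\<And>n. n \<in> N \<Longrightarrow> \<zeta> n \<in> fin_functionals S (L n)"
  shows "(\<lambda>f. \<Sum>n\<in>N. \<zeta> n f) \<in> fin_functionals S (\<Sum>n\<in>N. L n)"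
  using assms by (induction N) (auto simp: zero_in_fin_functionals fin_functionals_plus)

text \<open>
  Passing from points to finitely supported measures is the elementary core of Krein's theorem
  on convex hulls of weakly compact sets. With \<open>M\<close> the limit of the measures
  \<open>\<bar>\<zeta>\<^sub>n\<bar>\<close> and \<open>E m\<close> the set where the kernel at \<open>a m\<close> is far from its limit \<open>g\<close>, a failure gives
  \<open>M (E m) \<ge> \<delta>\<close> for most \<open>m\<close>. As \<open>M\<close> is finite, some subsequence of the sets \<open>E m\<close> has
  the finite intersection property, and points of these intersections violate the double limit
  property of the kernel.
\<close>

lemma double_limit_fin_functionals:
  assumes dl: "double_limit A B k" and bd0: "\<And>a b. a \<in> A \<Longrightarrow> b \<in> B \<Longrightarrow> \<bar>k a b\<bar> \<le> K0"
  shows "double_limit A (fin_functionals B L) (\<lambda>a \<zeta>. \<zeta> (k a))"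
  unfolding double_limit_def
proof (intro allI impI)
  fix a :: "nat \<Rightarrow> 'a" and \<zeta> :: "nat \<Rightarrow> ('b \<Rightarrow> real) \<Rightarrow> real" and U V :: "nat filter"
  assume a: "range a \<subseteq> A" and \<zeta>: "range \<zeta> \<subseteq> fin_functionals B L"
    and U: "nonprincipal_ultrafilter U" and V: "nonprincipal_ultrafilter V"
  have uU: "ultrafilter U" and uV: "ultrafilter V"
    using U V by (auto simp: nonprincipal_ultrafilter_def)
  note [simp] = ultrafilter_not_bot[OF uU] ultrafilter_not_bot[OF uV]
  have aA: "a m \<in> A" for m using a by auto
  have \<zeta>B: "\<zeta> n \<in> fin_functionals B L" for n using \<zeta> by auto
  have "\<forall>n. \<exists>F z. finite F \<and> F \<subseteq> B \<and> (\<Sum>i\<in>F. \<bar>z i\<bar>) \<le> L \<and> \<zeta> n = (\<lambda>f. \<Sum>i\<in>F. z i * f i)"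
    using \<zeta>B by (metis fin_functionalsE)
  then obtain F z where F: "\<And>n. finite (F n)" "\<And>n. F n \<subseteq> B" "\<And>n. (\<Sum>i\<in>F n. \<bar>z n i\<bar>) \<le> L"
      "\<And>n. \<zeta> n = (\<lambda>f. \<Sum>i\<in>F n. z n i * f i)"
    by metis
  have L: "0 \<le> L" using fin_functionals_nonneg[OF \<zeta>B[of 0]] .
  define K where "K = \<bar>K0\<bar> + 1"
  have K: "0 < K" and bd: "\<And>a b. a \<in> A \<Longrightarrow> b \<in> B \<Longrightarrow> \<bar>k a b\<bar> \<le> K"
    using bd0 by (force simp: K_def)+
  define g where "g i = Lim U (\<lambda>m. k (a m) i)" for i
  have g: "((\<lambda>m. k (a m) i) \<longlongrightarrow> g i) U" if "i \<in> B" for i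
    unfolding g_def using bd[OF aA that] by (intro ultrafilter_tendsto_Lim[OF uU, where B = K]) auto
  have gK: "\<bar>g i\<bar> \<le> K" if "i \<in> B" for i
    unfolding g_def using bd[OF aA that] by (intro abs_Lim_le[OF uU, where B = K]) auto
  define h where "h m i = k (a m) i - g i" for m i
  have hK: "\<bar>h m i\<bar> \<le> 2 * K" if "i \<in> B" for m i
    using bd[OF aA that, of m] gK[OF that] by (auto simp: h_def)
  have h0: "((\<lambda>m. h m i) \<longlongrightarrow> 0) U" if "i \<in> B" for i
    using tendsto_diff[OF g[OF that] tendsto_const, of "g i"] by (simp add: h_def)
  have R: "Lim U (\<lambda>m. \<zeta> n (k (a m))) = \<zeta> n g" for n
    by (intro tendsto_Lim fin_functionals_tendsto[OF \<zeta>B] g) auto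
  define s where "s m = Lim V (\<lambda>n. \<zeta> n (k (a m)))" for m
  have s: "((\<lambda>n. \<zeta> n (k (a m))) \<longlongrightarrow> s m) V" for m
    unfolding s_def
    by (intro ultrafilter_tendsto_Lim[OF uV, where B = "L * K"] always_eventually allI
        fin_functionals_bound[OF \<zeta>B]) (use K bd aA in auto)
  define t where "t = Lim V (\<lambda>n. \<zeta> n g)"
  have t: "((\<lambda>n. \<zeta> n g) \<longlongrightarrow> t) V"
    unfolding t_def
    by (intro ultrafilter_tendsto_Lim[OF uV, where B = "L * K"] always_eventually allI
        fin_functionals_bound[OF \<zeta>B]) (use K gK in auto)
  have "(s \<longlongrightarrow> t) U"
  proof (rule ccontr)
    assume "\<not> ?thesis"
    then obtain e where e: "e > 0" "\<not> eventually (\<lambda>m. dist (s m) t < e) U"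
      unfolding tendsto_iff by blast
    then have far: "eventually (\<lambda>m. \<bar>s m - t\<bar> \<ge> e) U"
      using ultrafilter_cases[OF uU, of "\<lambda>m. dist (s m) t < e"] by (simp add: dist_real_def not_less)
    \<comment> \<open>Points where the deviation \<open>h\<close> is below \<open>\<epsilon>\<close>
      contribute at most \<open>L * \<epsilon>\<close>, half of the gap \<open>e\<close>; the
      \<open>+ 1\<close> covers \<open>L = 0\<close>.\<close>
    define \<epsilon> where "\<epsilon> = e / (2 * (L + 1))"
    have \<epsilon>: "\<epsilon> > 0" "L * \<epsilon> \<le> e / 2"
      using e L by (auto simp: \<epsilon>_def field_simps)
    define E where "E m = {i \<in> B. \<epsilon> \<le> \<bar>h m i\<bar>}" for m
    define \<mu> where "\<mu> n G = (\<Sum>i\<in>F n \<inter> G. \<bar>z n i\<bar>)" for n G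
    have \<mu>L: "\<mu> n G \<le> L" for n G
      unfolding \<mu>_def using F(1) by (intro order_trans[OF sum_mono2 F(3)]) auto
    have \<mu>0: "0 \<le> \<mu> n G" for n G by (simp add: \<mu>_def sum_nonneg)
    \<comment> \<open>A finitely additive measure on all subsets, of mass at most \<open>L\<close>;
      no countable additivity is available for it.\<close>
    define M where "M G = Lim V (\<lambda>n. \<mu> n G)" for G
    have M: "((\<lambda>n. \<mu> n G) \<longlongrightarrow> M G) V" for G
      unfolding M_def using \<mu>L \<mu>0
      by (intro ultrafilter_tendsto_Lim[OF uV, where B = L]) (simp add: abs_le_iff)
    have M0: "0 \<le> M G" for G
      using M \<mu>0 by (intro tendsto_lowerbound[OF M]) auto
    have M_le: "M G \<le> L" for G
      using M \<mu>L by (intro tendsto_upperbound[OF M]) auto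
    have M_un: "M (G \<union> H) + M (G \<inter> H) = M G + M H" for G H
    proof -
      have "\<mu> n (G \<union> H) + \<mu> n (G \<inter> H) = \<mu> n G + \<mu> n H" for n
        unfolding \<mu>_def using F(1) sum.union_inter[of "F n \<inter> G" "F n \<inter> H" "\<lambda>i. \<bar>z n i\<bar>"]
        by (simp add: Int_Un_distrib Int_ac)
      then show ?thesis
        using tendsto_add[OF M M, of "G \<union> H" "G \<inter> H"] tendsto_add[OF M M, of G H]
        by (simp add: tendsto_unique[of V])
    qed
    have M_empty: "M {} = 0"
      using tendsto_unique[OF _ M[of "{}"], of 0] by (simp add: \<mu>_def)
    have M_mono: "M G \<le> M H" if "G \<subseteq> H" for G H
      using M_un[of G "H - G"] that M0[of "H - G"] M_empty
      by (simp add: Un_absorb1 Int_Diff)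
    \<comment> \<open>The sum over \<open>F n\<close> is split along \<open>E m\<close>: outside it
      \<open>h\<close> is below \<open>\<epsilon>\<close>, inside it is at most
      \<open>2 * K\<close>.\<close>
    have "\<bar>s m - t\<bar> \<le> L * \<epsilon> + 2 * K * M (E m)" for m
    proof (rule tendsto_le)
      show "((\<lambda>n. L * \<epsilon> + 2 * K * \<mu> n (E m)) \<longlongrightarrow> L * \<epsilon> + 2 * K * M (E m)) V"
        by (intro tendsto_intros M)
      show "((\<lambda>n. \<bar>\<zeta> n (k (a m)) - \<zeta> n g\<bar>) \<longlongrightarrow> \<bar>s m - t\<bar>) V"
        by (intro tendsto_intros s t)
      have "\<bar>\<zeta> n (k (a m)) - \<zeta> n g\<bar> \<le> L * \<epsilon> + 2 * K * \<mu> n (E m)" for n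
      proof -
        have "\<bar>\<zeta> n (k (a m)) - \<zeta> n g\<bar> = \<bar>\<Sum>i\<in>F n. z n i * h m i\<bar>"
          by (simp add: F(4) h_def right_diff_distrib sum_subtractf)
        also have "\<dots> \<le> (\<Sum>i\<in>F n. \<bar>z n i\<bar> * \<epsilon> + 2 * K * (if i \<in> E m then \<bar>z n i\<bar> else 0))"
        proof (intro order_trans[OF sum_abs] sum_mono)
          fix i assume i: "i \<in> F n"
          then have iB: "i \<in> B" using F(2) by auto
          show "\<bar>z n i * h m i\<bar> \<le> \<bar>z n i\<bar> * \<epsilon> + 2 * K * (if i \<in> E m then \<bar>z n i\<bar> else 0)"
          proof (cases "i \<in> E m")
            case True
            have "\<bar>z n i\<bar> * \<bar>h m i\<bar> \<le> \<bar>z n i\<bar> * (2 * K)"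
              using hK[OF iB] by (intro mult_left_mono) auto
            then show ?thesis using True \<epsilon>(1) by (simp add: abs_mult mult_ac add_increasing)
          next
            case False
            then have "\<bar>z n i\<bar> * \<bar>h m i\<bar> \<le> \<bar>z n i\<bar> * \<epsilon>"
              using iB by (intro mult_left_mono) (auto simp: E_def)
            then show ?thesis using False by (simp add: abs_mult)
          qed
        qed
        also have "\<dots> = (\<Sum>i\<in>F n. \<bar>z n i\<bar>) * \<epsilon> + 2 * K * \<mu> n (E m)"
          using F(1) by (simp add: \<mu>_def sum.distrib sum_distrib_right sum.inter_restrict
              flip: sum_distrib_left)
        also have "\<dots> \<le> L * \<epsilon> + 2 * K * \<mu> n (E m)"
          using F(3) \<epsilon>(1) by (simp add: mult_right_mono)
        finally show ?thesis .
      qed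
      then show "eventually (\<lambda>n. \<bar>\<zeta> n (k (a m)) - \<zeta> n g\<bar> \<le> L * \<epsilon> + 2 * K * \<mu> n (E m)) V"
        by simp
    qed simp
    then have near: "\<bar>s m - t\<bar> \<le> e / 2 + 2 * K * M (E m)" for m
      using \<epsilon>(2) by (meson add_right_mono order_trans)
    have ME: "eventually (\<lambda>m. e / (4 * K) \<le> M (E m)) U"
      using far
    proof eventually_elim
      case (elim m)
      then have "e \<le> e / 2 + 2 * K * M (E m)" using near[of m] by linarith
      then show ?case using K by (simp add: field_simps)
    qed
    \<comment> \<open>How much of \<open>G\<close> a typical \<open>E m\<close> captures. Positivity
      of \<open>\<nu>\<close> is the invariant that lets a finite intersection of sets
      \<open>E m\<close> be extended by one more.\<close>
    define \<nu> where "\<nu> G = Lim U (\<lambda>m. M (G \<inter> E m))" for G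
    have \<nu>: "((\<lambda>m. M (G \<inter> E m)) \<longlongrightarrow> \<nu> G) U" for G
      unfolding \<nu>_def using M0 M_le by (intro ultrafilter_tendsto_Lim[OF uU, where B = L]) simp
    have \<nu>0: "0 \<le> \<nu> G" for G
      using M0 by (intro tendsto_lowerbound[OF \<nu>]) auto
    have \<nu>_un: "\<nu> (G \<union> H) \<le> \<nu> G + \<nu> H" for G H
    proof (rule tendsto_le[OF _ tendsto_add[OF \<nu> \<nu>] \<nu>])
      show "eventually (\<lambda>m. M ((G \<union> H) \<inter> E m) \<le> M (G \<inter> E m) + M (H \<inter> E m)) U"
      proof (intro always_eventually allI)
        fix m
        show "M ((G \<union> H) \<inter> E m) \<le> M (G \<inter> E m) + M (H \<inter> E m)"
          using M_un[of "G \<inter> E m" "H \<inter> E m"] M0[of "(G \<inter> E m) \<inter> (H \<inter> E m)"]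
          unfolding Int_Un_distrib2 by linarith
      qed
    qed simp
    \<comment> \<open>Otherwise one keeps adding sets \<open>G \<inter> E m\<close> to a union
      \<open>H\<close> with \<open>\<nu> H = 0\<close>. A typical new set has \<open>M\<close>-mass
      above three quarters of \<open>\<nu> G\<close> and overlaps \<open>H\<close> in less than a
      quarter, so each step gains half of \<open>\<nu> G\<close>, which eventually exceeds
      \<open>L\<close>.\<close>
    have fip: "eventually (\<lambda>m. 0 < \<nu> (G \<inter> E m)) U" if G: "0 < \<nu> G" for G
    proof (rule ccontr)
      assume "\<not> ?thesis"
      then have null: "eventually (\<lambda>m. \<nu> (G \<inter> E m) = 0) U"
        using ultrafilter_cases[OF uU, of "\<lambda>m. 0 < \<nu> (G \<inter> E m)"] \<nu>0
        by (auto simp: not_less elim!: eventually_mono intro: antisym)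
      have "\<exists>H. \<nu> H = 0 \<and> real N * (\<nu> G / 2) \<le> M H" for N
      proof (induction N)
        case 0
        have "\<nu> {} = 0"
          using tendsto_unique[OF _ \<nu>[of "{}"], of 0] M_empty by simp
        then show ?case using M0 by auto
      next
        case (Suc N)
        then obtain H where H: "\<nu> H = 0" "real N * (\<nu> G / 2) \<le> M H" by blast
        have "eventually (\<lambda>m. M (H \<inter> E m) < \<nu> G / 4) U"
          using H(1) G by (intro order_tendstoD(2)[OF \<nu>]) simp
        moreover have "eventually (\<lambda>m. 3 * \<nu> G / 4 < M (G \<inter> E m)) U"
          using G by (intro order_tendstoD(1)[OF \<nu>]) simp
        ultimately have "eventually (\<lambda>m. M (H \<inter> E m) < \<nu> G / 4 \<and> 3 * \<nu> G / 4 < M (G \<inter> E m)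
            \<and> \<nu> (G \<inter> E m) = 0) U"
          using null by eventually_elim simp
        then obtain m where m: "M (H \<inter> E m) < \<nu> G / 4" "3 * \<nu> G / 4 < M (G \<inter> E m)"
            "\<nu> (G \<inter> E m) = 0"
          using eventually_happens by fastforce
        have "\<nu> (H \<union> (G \<inter> E m)) = 0"
          using \<nu>_un[of H "G \<inter> E m"] \<nu>0[of "H \<union> (G \<inter> E m)"] H(1) m(3) by simp
        moreover have "real (Suc N) * (\<nu> G / 2) \<le> M (H \<union> (G \<inter> E m))"
        proof -
          have "M (H \<inter> (G \<inter> E m)) \<le> M (H \<inter> E m)" by (rule M_mono) auto
          moreover have "real (Suc N) * (\<nu> G / 2) = real N * (\<nu> G / 2) + \<nu> G / 2"
            by (simp add: algebra_simps)
          ultimately show ?thesis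
            using M_un[of H "G \<inter> E m"] H(2) m(1,2) by linarith
        qed
        ultimately show ?case by blast
      qed
      moreover obtain N where "L < real N * (\<nu> G / 2)"
        using ex_less_of_nat_mult[of "\<nu> G / 2" L] G by auto
      ultimately show False using M_le by (meson not_le order_trans)
    qed
    have "0 < \<nu> UNIV"
    proof -
      have "e / (4 * K) \<le> \<nu> UNIV"
        using ME by (intro tendsto_lowerbound[OF \<nu>]) auto
      then show ?thesis using e(1) K by (smt (verit) divide_pos_pos)
    qed
    \<comment> \<open>A choice \<open>r\<close> pairs an index \<open>m\<close> with a point
      \<open>i\<close>. The index keeps the intersection of positive \<open>\<nu>\<close> and has
      small deviation at the earlier points; the point is then taken in the intersection. So
      \<open>k (x j) (i j')\<close> is close to \<open>g (i j')\<close> for \<open>j > j'\<close>,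
      but at least \<open>\<epsilon>\<close> away for \<open>j \<le> j'\<close>.\<close>
    define P where "P f j r \<longleftrightarrow> 0 < \<nu> (\<Inter>l<j. E (fst (f l))) \<and>
        0 < \<nu> ((\<Inter>l<j. E (fst (f l))) \<inter> E (fst r)) \<and>
        snd r \<in> (\<Inter>l<j. E (fst (f l))) \<inter> E (fst r) \<and>
        (\<forall>l<j. \<bar>h (fst r) (snd (f l))\<bar> < 1 / real (Suc j))"
      for f :: "nat \<Rightarrow> nat \<times> 'b" and j r
    have "\<exists>f. \<forall>j. P f j (f j)"
    proof (rule dependent_wellorder_choice)
      fix r and f f' :: "nat \<Rightarrow> nat \<times> 'b" and j :: nat
      assume "\<And>y. y < j \<Longrightarrow> f y = f' y"
      then show "P f j r = P f' j r" unfolding P_def by auto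
    next
      fix j and f :: "nat \<Rightarrow> nat \<times> 'b"
      assume IH: "\<And>y. y < j \<Longrightarrow> P f y (f y)"
      define G where "G = (\<Inter>l<j. E (fst (f l)))"
      have G: "0 < \<nu> G"
      proof (cases j)
        case 0 then show ?thesis using \<open>0 < \<nu> UNIV\<close> by (simp add: G_def)
      next
        case (Suc j')
        then show ?thesis
          using IH[of j'] by (simp add: P_def G_def lessThan_Suc Int_commute)
      qed
      have "snd (f l) \<in> B" if "l < j" for l
        using IH[OF that] by (auto simp: P_def E_def)
      then have "eventually (\<lambda>m. \<forall>l\<in>{..<j}. \<bar>h m (snd (f l))\<bar> < 1 / real (Suc j)) U"
        using tendstoD[OF h0, where e = "1 / real (Suc j)"]
        by (intro eventually_ball_finite) (auto simp: dist_real_def)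
      then have "eventually (\<lambda>m. 0 < \<nu> (G \<inter> E m) \<and>
          (\<forall>l\<in>{..<j}. \<bar>h m (snd (f l))\<bar> < 1 / real (Suc j))) U"
        using fip[OF G] by eventually_elim simp
      then obtain m where m: "0 < \<nu> (G \<inter> E m)" "\<forall>l<j. \<bar>h m (snd (f l))\<bar> < 1 / real (Suc j)"
        using eventually_happens by fastforce
      have "G \<inter> E m \<noteq> {}"
        using m(1) tendsto_unique[OF _ \<nu>[of "{}"], of 0] M_empty by auto
      then obtain i where "i \<in> G \<inter> E m" by blast
      then have "P f j (m, i)" unfolding P_def using m G by (simp add: G_def)
      then show "\<exists>r. P f j r" ..
    qed
    then obtain f where f: "\<And>j. P f j (f j)" by blast
    define x where "x j = a (fst (f j))" for j
    define i where "i j = snd (f j)" for j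
    have iE: "i j' \<in> E (fst (f j))" if "j \<le> j'" for j j'
      using f[of j'] that by (cases "j = j'") (auto simp: P_def i_def)
    have iB: "i j \<in> B" for j using iE[of j j] by (auto simp: E_def)
    have xA: "x j \<in> A" for j using aA by (simp add: x_def)
    have far: "\<epsilon> \<le> \<bar>k (x j) (i j') - g (i j')\<bar>" if "j \<le> j'" for j j'
      using iE[OF that] by (simp add: E_def h_def x_def)
    have lim1: "Lim U (\<lambda>j. k (x j) (i j')) = g (i j')" for j'
    proof -
      have "(\<lambda>j. k (x j) (i j') - g (i j')) \<longlonglongrightarrow> 0"
      proof (rule Lim_null_comparison)
        show "eventually (\<lambda>j. norm (k (x j) (i j') - g (i j')) \<le> 1 / real (Suc j)) sequentially"
          using eventually_gt_at_top[of j']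
        proof eventually_elim
          case (elim j)
          then show ?case using f[of j] by (auto simp: P_def h_def x_def i_def less_imp_le)
        qed
        show "(\<lambda>j. 1 / real (Suc j)) \<longlonglongrightarrow> 0"
          using LIMSEQ_inverse_real_of_nat by (simp add: inverse_eq_divide)
      qed
      then have "((\<lambda>j. k (x j) (i j') - g (i j')) \<longlongrightarrow> 0) U"
        using nonprincipal_ultrafilter_le_sequentially[OF U] by (rule tendsto_mono[rotated])
      then show ?thesis by (intro tendsto_Lim) (auto simp: LIM_zero_iff)
    qed
    define \<gamma> where "\<gamma> = Lim U (\<lambda>j. g (i j))"
    have \<gamma>: "((\<lambda>j. g (i j)) \<longlongrightarrow> \<gamma>) U"
      unfolding \<gamma>_def using gK[OF iB] by (intro ultrafilter_tendsto_Lim[OF uU, where B = K]) auto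
    define p where "p j = Lim U (\<lambda>j'. k (x j) (i j'))" for j
    have p: "((\<lambda>j'. k (x j) (i j')) \<longlongrightarrow> p j) U" for j
      unfolding p_def using bd[OF xA iB] by (intro ultrafilter_tendsto_Lim[OF uU, where B = K]) auto
    have pK: "\<bar>p j\<bar> \<le> K" for j
      unfolding p_def using bd[OF xA iB] by (intro abs_Lim_le[OF uU, where B = K]) auto
    \<comment> \<open>The same ultrafilter \<open>U\<close> serves for both variables. The
      triangular pattern of close and distant values now contradicts this equality.\<close>
    have "Lim U p = \<gamma>"
    proof -
      have "Lim U (\<lambda>j. Lim U (\<lambda>j'. k (x j) (i j'))) = Lim U (\<lambda>j'. Lim U (\<lambda>j. k (x j) (i j')))"
        using dl xA iB U unfolding double_limit_def by blast
      then show ?thesis by (simp add: lim1 \<gamma>_def p_def[abs_def])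
    qed
    moreover have "(p \<longlongrightarrow> Lim U p) U"
      using pK by (intro ultrafilter_tendsto_Lim[OF uU, where B = K]) auto
    ultimately have "((\<lambda>j. \<bar>p j - \<gamma>\<bar>) \<longlongrightarrow> 0) U"
      by (auto intro!: tendsto_eq_intros)
    moreover have "\<epsilon> \<le> \<bar>p j - \<gamma>\<bar>" for j
    proof (rule tendsto_lowerbound)
      show "((\<lambda>j'. \<bar>k (x j) (i j') - g (i j')\<bar>) \<longlongrightarrow> \<bar>p j - \<gamma>\<bar>) U"
        by (intro tendsto_intros p \<gamma>)
      have "eventually (\<lambda>j'. j \<le> j') U"
        using nonprincipal_ultrafilter_le_sequentially[OF U] eventually_ge_at_top filter_leD by blast
      then show "eventually (\<lambda>j'. \<epsilon> \<le> \<bar>k (x j) (i j') - g (i j')\<bar>) U"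
        by eventually_elim (rule far)
    qed simp
    ultimately have "\<epsilon> \<le> 0"
      by (intro tendsto_lowerbound[of "\<lambda>j. \<bar>p j - \<gamma>\<bar>" 0 U]) auto
    then show False using \<epsilon>(1) by simp
  qed
  then show "Lim U (\<lambda>m. Lim V (\<lambda>n. \<zeta> n (k (a m)))) = Lim V (\<lambda>n. Lim U (\<lambda>m. \<zeta> n (k (a m))))"
    unfolding R by (simp add: tendsto_Lim s_def[abs_def] t_def)
qed

section \<open>The Hahn-Banach theorem\<close>

definition sublinear_on :: "('i \<Rightarrow> real) set \<Rightarrow> (('i \<Rightarrow> real) \<Rightarrow> real) \<Rightarrow> bool" where
  "sublinear_on S p \<longleftrightarrow> (\<forall>f\<in>S. \<forall>g\<in>S. p (\<lambda>i. f i + g i) \<le> p f + p g) \<and>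
     (\<forall>f\<in>S. \<forall>r\<ge>0. p (\<lambda>i. r * f i) = r * p f)"

definition linear_on_functions :: "('i \<Rightarrow> real) set \<Rightarrow> (('i \<Rightarrow> real) \<Rightarrow> real) \<Rightarrow> bool" where
  "linear_on_functions S l \<longleftrightarrow> (\<forall>f\<in>S. \<forall>g\<in>S. l (\<lambda>i. f i + g i) = l f + l g) \<and>
     (\<forall>f\<in>S. \<forall>r. l (\<lambda>i. r * f i) = r * l f)"

text \<open>Only one inequality for positive factors has to be checked: applying it with
  \<open>inverse r\<close> to the scaled function gives the other.\<close>

lemma sublinear_onI:
  assumes "\<And>f g. f \<in> S \<Longrightarrow> g \<in> S \<Longrightarrow> p (\<lambda>i. f i + g i) \<le> p f + p g"
    and pos: "\<And>f r. f \<in> S \<Longrightarrow> r > 0 \<Longrightarrow> p (\<lambda>i. r * f i) \<le> r * p f"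
    and z: "S \<noteq> {} \<Longrightarrow> p (\<lambda>i. 0) = 0"
    and S: "\<And>f r. f \<in> S \<Longrightarrow> (\<lambda>i. r * f i) \<in> S"
  shows "sublinear_on S p"
  unfolding sublinear_on_def
proof (intro conjI ballI allI impI)
  fix f r assume f: "f \<in> S" and r: "(0::real) \<le> r"
  show "p (\<lambda>i. r * f i) = r * p f"
  proof (cases "r = 0")
    case False
    then have r: "r > 0" using r by simp
    have "p f \<le> inverse r * p (\<lambda>i. r * f i)"
      using pos[OF S[OF f, of r], of "inverse r"] r by (simp add: mult.assoc[symmetric])
    then have "r * p f \<le> p (\<lambda>i. r * f i)"
      using r by (simp add: field_simps)
    then show ?thesis using pos[OF f r] by simp
  qed (use z f in auto)
qed (use assms in auto)

text \<open>
  A minimal sublinear functional \<open>q\<close> is linear, since for each \<open>f\<close> it coincides with the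
  sublinear functional \<open>g \<mapsto> inf\<^sub>t (q (g + t f) - t q f)\<close>, whose value at \<open>- f\<close>
  is at most \<open>- q f\<close>. Hence no one-dimensional extension step is needed.
\<close>

theorem Hahn_Banach_functions:
  fixes S :: "('i \<Rightarrow> real) set"
  assumes zero: "(\<lambda>i. 0) \<in> S"
    and add: "\<And>f g. f \<in> S \<Longrightarrow> g \<in> S \<Longrightarrow> (\<lambda>i. f i + g i) \<in> S"
    and scale: "\<And>f r. f \<in> S \<Longrightarrow> (\<lambda>i. r * f i) \<in> S"
    and p: "sublinear_on S p"
  obtains l where "linear_on_functions S l" "\<And>f. f \<in> S \<Longrightarrow> l f \<le> p f"
proof -
  \<comment> \<open>Fixing the value 0 off \<open>S\<close> makes the pointwise order on total
    functions compare functionals on \<open>S\<close> only.\<close>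
  define A where "A = {q. sublinear_on S q \<and> (\<forall>f\<in>S. q f \<le> p f) \<and> (\<forall>f. f \<notin> S \<longrightarrow> q f = 0)}"
  have neg: "(\<lambda>i. - f i) \<in> S" if "f \<in> S" for f using scale[OF that, of "-1"] by simp
  have sub: "q (\<lambda>i. f i + g i) \<le> q f + q g" if "sublinear_on S q" "f \<in> S" "g \<in> S" for q f g
    using that by (auto simp: sublinear_on_def)
  have hom: "q (\<lambda>i. r * f i) = r * q f" if "sublinear_on S q" "f \<in> S" "0 \<le> r" for q f r
    using that by (auto simp: sublinear_on_def)
  have at_zero: "q (\<lambda>i. 0) = 0" if "sublinear_on S q" for q
    using hom[OF that zero, of 0] by simp
  have neg_le: "- q (\<lambda>i. - f i) \<le> q f" if "sublinear_on S q" "f \<in> S" for q f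
    using sub[OF that(1,2) neg[OF that(2)]] at_zero[OF that(1)] by simp
  have lower: "- p (\<lambda>i. - f i) \<le> q f" if "q \<in> A" "f \<in> S" for q f
    using that neg_le[of q f] neg[OF that(2)] by (force simp: A_def)
  have "\<exists>q\<in>A. \<forall>q'\<in>A. q \<ge> q' \<longrightarrow> q' = q"
  proof (rule predicate_Zorn)
    show "partial_order_on A (relation_of (\<ge>) A)"
      by (auto simp: partial_order_on_def preorder_on_def refl_on_def trans_def antisym_def
          relation_of_def)
    fix K assume "K \<in> Chains (relation_of (\<ge>) A)"
    then have KA: "K \<subseteq> A" and ch: "\<And>q r. q \<in> K \<Longrightarrow> r \<in> K \<Longrightarrow> q \<le> r \<or> r \<le> q"
      by (auto simp: Chains_def relation_of_def)
    show "\<exists>u\<in>A. \<forall>a\<in>K. u \<le> a"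
    proof (cases "K = {}")
      case True
      have "(\<lambda>f. if f \<in> S then p f else 0) \<in> A"
        using p add scale by (auto simp: A_def sublinear_on_def)
      then show ?thesis using True by auto
    next
      case False
      define u where "u f = (if f \<in> S then INF q\<in>K. q f else 0)" for f
      have bb: "bdd_below ((\<lambda>q. q f) ` K)" if "f \<in> S" for f
        using lower[OF _ that] KA by (auto intro!: bdd_belowI[of _ "- p (\<lambda>i. - f i)"])
      have ule: "u f \<le> q f" if "q \<in> K" for f q
        using that bb[of f] KA by (auto simp: u_def A_def intro!: cINF_lower)
      have ugr: "c \<le> u f" if "f \<in> S" "\<And>q. q \<in> K \<Longrightarrow> c \<le> q f" for c f
        using that False by (auto simp: u_def intro!: cINF_greatest)
      obtain q0 where q0: "q0 \<in> K" using False by blast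
      have "sublinear_on S u"
      proof (rule sublinear_onI)
        fix f g assume fg: "f \<in> S" "g \<in> S"
        have "u (\<lambda>i. f i + g i) - u g \<le> u f"
        proof (rule ugr[OF fg(1)])
          fix q assume q: "q \<in> K"
          have "u (\<lambda>i. f i + g i) - q f \<le> u g"
          proof (rule ugr[OF fg(2)])
            fix r assume r: "r \<in> K"
            \<comment> \<open>Subadditivity of the infimum needs one functional below both
              \<open>q\<close> and \<open>r\<close>, which the chain provides.\<close>
            obtain s where s: "s \<in> K" "s \<le> q" "s \<le> r" using ch[OF q r] q r by blast
            have "u (\<lambda>i. f i + g i) \<le> s (\<lambda>i. f i + g i)" by (rule ule[OF s(1)])
            also have "\<dots> \<le> s f + s g" using s KA fg by (intro sub) (auto simp: A_def)
            also have "\<dots> \<le> q f + r g" using s by (auto simp: le_fun_def intro: add_mono)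
            finally show "u (\<lambda>i. f i + g i) - q f \<le> r g" by simp
          qed
          then show "u (\<lambda>i. f i + g i) - u g \<le> q f" by simp
        qed
        then show "u (\<lambda>i. f i + g i) \<le> u f + u g" by simp
      next
        fix f and r :: real assume f: "f \<in> S" and r: "r > 0"
        have "u (\<lambda>i. r * f i) / r \<le> u f"
        proof (rule ugr[OF f])
          fix q assume q: "q \<in> K"
          then have "u (\<lambda>i. r * f i) \<le> q (\<lambda>i. r * f i)" by (rule ule)
          also have "\<dots> = r * q f" using q KA f r by (intro hom) (auto simp: A_def)
          finally show "u (\<lambda>i. r * f i) / r \<le> q f" using r by (simp add: field_simps)
        qed
        then show "u (\<lambda>i. r * f i) \<le> r * u f" using r by (simp add: field_simps)
      next
        have "q (\<lambda>i. 0) = 0" if "q \<in> K" for q using that KA at_zero by (auto simp: A_def)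
        then show "u (\<lambda>i. 0) = 0"
          using ule[OF q0, of "\<lambda>i. 0"] ugr[OF zero, of 0] q0 by force
      qed (rule scale)
      moreover have "u f \<le> p f" if "f \<in> S" for f
        using ule[OF q0, of f] q0 KA that by (force simp: A_def)
      ultimately have "u \<in> A" by (auto simp: A_def u_def)
      then show ?thesis using ule by (auto simp: le_fun_def)
    qed
  qed
  then obtain q where qA: "q \<in> A" and min: "\<And>q'. q' \<in> A \<Longrightarrow> q' \<le> q \<Longrightarrow> q' = q"
    by blast
  have q: "sublinear_on S q" using qA by (simp add: A_def)
  have neg_q: "q (\<lambda>i. - f i) = - q f" if f: "f \<in> S" for f
  proof -
    define c where "c g t = q (\<lambda>i. g i + t * f i) - t * q f" for g t
    define q' where "q' g = (if g \<in> S then INF t\<in>{0..}. c g t else 0)" for g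
    have in_S: "(\<lambda>i. g i + t * f i) \<in> S" if "g \<in> S" for g t
      using add[OF that scale[OF f, of t]] by simp
    have c_lower: "- q (\<lambda>i. - g i) \<le> c g t" if "g \<in> S" "0 \<le> t" for g t
      using sub[OF q in_S[OF that(1), of t] neg[OF that(1)]] hom[OF q f that(2)] by (simp add: c_def)
    have q'_le: "q' g \<le> c g t" if "g \<in> S" "0 \<le> t" for g t
      using that c_lower[OF that(1)] unfolding q'_def
      by (auto intro!: cINF_lower bdd_belowI[of _ "- q (\<lambda>i. - g i)"])
    have q'_gr: "x \<le> q' g" if "g \<in> S" "\<And>t. 0 \<le> t \<Longrightarrow> x \<le> c g t" for x g
      using that unfolding q'_def by (auto intro!: cINF_greatest)
    have q'q: "q' g \<le> q g" for g
      using q'_le[of g 0] qA by (cases "g \<in> S") (auto simp: c_def q'_def A_def)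
    have "sublinear_on S q'"
    proof (rule sublinear_onI)
      fix g h assume gh: "g \<in> S" "h \<in> S"
      have "q' (\<lambda>i. g i + h i) - q' h \<le> q' g"
      proof (rule q'_gr[OF gh(1)])
        fix t :: real assume t: "0 \<le> t"
        have "q' (\<lambda>i. g i + h i) - c g t \<le> q' h"
        proof (rule q'_gr[OF gh(2)])
          fix s :: real assume s: "0 \<le> s"
          have "q' (\<lambda>i. g i + h i) \<le> c (\<lambda>i. g i + h i) (t + s)"
            using t s by (intro q'_le add gh) auto
          also have "\<dots> \<le> c g t + c h s"
            using sub[OF q in_S[OF gh(1), of t] in_S[OF gh(2), of s]]
            by (simp add: c_def algebra_simps)
          finally show "q' (\<lambda>i. g i + h i) - c g t \<le> c h s" by simp
        qed
        then show "q' (\<lambda>i. g i + h i) - q' h \<le> c g t" by simp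
      qed
      then show "q' (\<lambda>i. g i + h i) \<le> q' g + q' h" by simp
    next
      fix g and r :: real assume g: "g \<in> S" and r: "r > 0"
      have "q' (\<lambda>i. r * g i) / r \<le> q' g"
      proof (rule q'_gr[OF g])
        fix t :: real assume t: "0 \<le> t"
        have "q' (\<lambda>i. r * g i) \<le> c (\<lambda>i. r * g i) (r * t)"
          using t r g by (intro q'_le scale) auto
        also have "\<dots> = r * c g t"
          using hom[OF q in_S[OF g, of t], of r] r by (simp add: c_def algebra_simps)
        finally show "q' (\<lambda>i. r * g i) / r \<le> c g t" using r by (simp add: field_simps)
      qed
      then show "q' (\<lambda>i. r * g i) \<le> r * q' g" using r by (simp add: field_simps)
    next
      have "c (\<lambda>i. 0) t = 0" if "0 \<le> t" for t
        using hom[OF q f that] by (simp add: c_def)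
      then show "q' (\<lambda>i. 0) = 0"
        using q'_le[OF zero, of 0] q'_gr[OF zero, of 0] by force
    qed (rule scale)
    moreover have "q' g \<le> p g" if "g \<in> S" for g
      using q'q[of g] qA that by (force simp: A_def)
    ultimately have "q' \<in> A" by (auto simp: A_def q'_def)
    then have "q' = q" using q'q by (intro min) (auto simp: le_fun_def)
    then have "q (\<lambda>i. - f i) \<le> c (\<lambda>i. - f i) 1" using q'_le[OF neg[OF f], of 1] by simp
    then have "q (\<lambda>i. - f i) \<le> - q f" using at_zero[OF q] by (simp add: c_def)
    then show ?thesis using neg_le[OF q f] by simp
  qed
  have "linear_on_functions S q"
    unfolding linear_on_functions_def
  proof (intro conjI ballI allI)
    fix f g assume fg: "f \<in> S" "g \<in> S"
    have "- q (\<lambda>i. f i + g i) \<le> - q f - q g"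
      using sub[OF q neg[OF fg(1)] neg[OF fg(2)]] neg_q fg neg_q[OF add[OF fg]] by simp
    then show "q (\<lambda>i. f i + g i) = q f + q g" using sub[OF q fg] by simp
  next
    fix f and r :: real assume f: "f \<in> S"
    show "q (\<lambda>i. r * f i) = r * q f"
    proof (cases "0 \<le> r")
      case False
      then have "q (\<lambda>i. - (r * f i)) = - r * q f" using hom[OF q f, of "- r"] by simp
      then show ?thesis using neg_q[OF scale[OF f, of r]] by simp
    qed (use hom[OF q f] in auto)
  qed
  then show ?thesis using that qA by (auto simp: A_def)
qed

text \<open>The convex cone \<open>X\<close> lists lower constraints: a pair \<open>(f, w)\<close>
  demands \<open>- w \<le> l f\<close>. The infimum over \<open>X\<close> of
  \<open>N (g + f) + w\<close> is finite by \<open>pos\<close> and sublinear in \<open>g\<close>.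
  For a linear \<open>l\<close> below it, the pair \<open>(0, 0)\<close> gives
  \<open>l \<le> N\<close>, and evaluation at \<open>g = - f\<close> gives the constraint.\<close>

theorem Hahn_Banach_sandwich:
  fixes S :: "('i \<Rightarrow> real) set"
  assumes zero: "(\<lambda>i. 0) \<in> S"
    and add: "\<And>f g. f \<in> S \<Longrightarrow> g \<in> S \<Longrightarrow> (\<lambda>i. f i + g i) \<in> S"
    and scale: "\<And>f r. f \<in> S \<Longrightarrow> (\<lambda>i. r * f i) \<in> S"
    and N: "sublinear_on S N"
    and XS: "\<And>f w. (f, w) \<in> X \<Longrightarrow> f \<in> S"
    and X0: "((\<lambda>i. 0), 0) \<in> X"
    and X_add: "\<And>f w g u. (f, w) \<in> X \<Longrightarrow> (g, u) \<in> X \<Longrightarrow> ((\<lambda>i. f i + g i), w + u) \<in> X"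
    and X_scale: "\<And>f w r. (f, w) \<in> X \<Longrightarrow> r > 0 \<Longrightarrow> ((\<lambda>i. r * f i), r * w) \<in> X"
    and pos: "\<And>f w. (f, w) \<in> X \<Longrightarrow> 0 \<le> N f + w"
  shows "\<exists>l. linear_on_functions S l \<and> (\<forall>f\<in>S. l f \<le> N f) \<and> (\<forall>f w. (f, w) \<in> X \<longrightarrow> - w \<le> l f)"
proof -
  define c where "c g x = N (\<lambda>i. g i + fst x i) + snd x" for g and x :: "('i \<Rightarrow> real) \<times> real"
  define p where "p g = (INF x\<in>X. c g x)" for g
  have neg: "(\<lambda>i. - f i) \<in> S" if "f \<in> S" for f using scale[OF that, of "-1"] by simp
  have sub: "N (\<lambda>i. f i + g i) \<le> N f + N g" if "f \<in> S" "g \<in> S" for f g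
    using N that by (auto simp: sublinear_on_def)
  have hom: "N (\<lambda>i. r * f i) = r * N f" if "f \<in> S" "0 \<le> r" for f r
    using N that by (auto simp: sublinear_on_def)
  have N0: "N (\<lambda>i. 0) = 0" using hom[OF zero, of 0] by simp
  have c_lower: "- N (\<lambda>i. - g i) \<le> c g x" if g: "g \<in> S" and x: "x \<in> X" for g x
  proof -
    have fx: "fst x \<in> S" using x XS[of "fst x" "snd x"] by simp
    have "0 \<le> N (fst x) + snd x" using x pos[of "fst x" "snd x"] by simp
    then show ?thesis using sub[OF add[OF g fx] neg[OF g]] by (simp add: c_def)
  qed
  have p_le: "p g \<le> c g x" if "g \<in> S" "x \<in> X" for g x
    using that c_lower[OF that(1)] unfolding p_def
    by (auto intro!: cINF_lower bdd_belowI[of _ "- N (\<lambda>i. - g i)"])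
  have p_gr: "y \<le> p g" if "\<And>x. x \<in> X \<Longrightarrow> y \<le> c g x" for g y
    using that X0 unfolding p_def by (auto intro!: cINF_greatest)
  have "sublinear_on S p"
  proof (rule sublinear_onI)
    fix g h assume gh: "g \<in> S" "h \<in> S"
    have "p (\<lambda>i. g i + h i) - p h \<le> p g"
    proof (rule p_gr)
      fix x assume x: "x \<in> X"
      have "p (\<lambda>i. g i + h i) - c g x \<le> p h"
      proof (rule p_gr)
        fix y assume y: "y \<in> X"
        have xy: "fst x \<in> S" "fst y \<in> S"
          using x y XS[of "fst x" "snd x"] XS[of "fst y" "snd y"] by simp_all
        have "p (\<lambda>i. g i + h i)
            \<le> c (\<lambda>i. g i + h i) ((\<lambda>i. fst x i + fst y i), snd x + snd y)"
          using x y X_add[of "fst x" "snd x" "fst y" "snd y"] gh by (intro p_le add) auto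
        also have "\<dots> \<le> c g x + c h y"
          using sub[OF add[OF gh(1) xy(1)] add[OF gh(2) xy(2)]]
          by (simp add: c_def algebra_simps)
        finally show "p (\<lambda>i. g i + h i) - c g x \<le> c h y" by simp
      qed
      then show "p (\<lambda>i. g i + h i) - p h \<le> c g x" by simp
    qed
    then show "p (\<lambda>i. g i + h i) \<le> p g + p h" by simp
  next
    fix g and r :: real assume g: "g \<in> S" and r: "r > 0"
    have "p (\<lambda>i. r * g i) / r \<le> p g"
    proof (rule p_gr)
      fix x assume x: "x \<in> X"
      have fx: "fst x \<in> S" using x XS[of "fst x" "snd x"] by simp
      have "p (\<lambda>i. r * g i) \<le> c (\<lambda>i. r * g i) ((\<lambda>i. r * fst x i), r * snd x)"
        using x X_scale[of "fst x" "snd x" r] r g by (intro p_le scale) auto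
      also have "\<dots> = r * c g x"
        using hom[OF add[OF g fx], of r] r by (simp add: c_def algebra_simps)
      finally show "p (\<lambda>i. r * g i) / r \<le> c g x" using r by (simp add: field_simps)
    qed
    then show "p (\<lambda>i. r * g i) \<le> r * p g" using r by (simp add: field_simps)
  next
    have "p (\<lambda>i. 0) \<le> 0" using p_le[OF zero X0] N0 by (simp add: c_def)
    moreover have "0 \<le> p (\<lambda>i. 0)"
      using pos by (intro p_gr) (auto simp: c_def)
    ultimately show "p (\<lambda>i. 0) = 0" by simp
  qed (rule scale)
  then obtain l where l: "linear_on_functions S l" "\<And>f. f \<in> S \<Longrightarrow> l f \<le> p f"
    using Hahn_Banach_functions[OF zero add scale] by metis
  have "l f \<le> N f" if "f \<in> S" for f
    using l(2)[OF that] p_le[OF that X0] by (simp add: c_def)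
  moreover have "- w \<le> l f" if fw: "(f, w) \<in> X" for f w
  proof -
    have "l (\<lambda>i. - f i) \<le> w"
      using l(2)[OF neg[OF XS[OF fw]]] p_le[OF neg[OF XS[OF fw]] fw] N0 by (simp add: c_def)
    moreover have "l (\<lambda>i. - 1 * f i) = - 1 * l f"
      using l(1) XS[OF fw] unfolding linear_on_functions_def by blast
    ultimately show ?thesis by simp
  qed
  ultimately show ?thesis using l(1) by blast
qed

section \<open>Bounded functionals on bounded functions\<close>

definition bounded_functions :: "'i set \<Rightarrow> ('i \<Rightarrow> real) set" where
  "bounded_functions S = {f. \<exists>B. \<forall>i\<in>S. \<bar>f i\<bar> \<le> B}"

lemma bounded_functionsI: "(\<And>i. i \<in> S \<Longrightarrow> \<bar>f i\<bar> \<le> B) \<Longrightarrow> f \<in> bounded_functions S"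
  by (auto simp: bounded_functions_def)

lemma bounded_functionsE:
  assumes "f \<in> bounded_functions S"
  obtains B where "0 \<le> B" "\<And>i. i \<in> S \<Longrightarrow> \<bar>f i\<bar> \<le> B"
proof -
  obtain B where "\<forall>i\<in>S. \<bar>f i\<bar> \<le> B" using assms by (auto simp: bounded_functions_def)
  then show ?thesis using that[of "\<bar>B\<bar>"] by force
qed

lemma zero_in_bounded_functions: "(\<lambda>i. 0) \<in> bounded_functions S"
  by (auto intro: bounded_functionsI[where B = 0])

lemma bounded_functions_add:
  assumes "f \<in> bounded_functions S" "g \<in> bounded_functions S"
  shows "(\<lambda>i. f i + g i) \<in> bounded_functions S"
proof -
  obtain A B where "\<And>i. i \<in> S \<Longrightarrow> \<bar>f i\<bar> \<le> A" "\<And>i. i \<in> S \<Longrightarrow> \<bar>g i\<bar> \<le> B"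
    using assms by (metis bounded_functionsE)
  then show ?thesis by (intro bounded_functionsI[where B = "A + B"]) (smt (verit))
qed

lemma bounded_functions_mult:
  assumes "f \<in> bounded_functions S"
  shows "(\<lambda>i. r * f i) \<in> bounded_functions S"
proof -
  obtain B where "\<And>i. i \<in> S \<Longrightarrow> \<bar>f i\<bar> \<le> B"
    using assms by (metis bounded_functionsE)
  then show ?thesis
    by (intro bounded_functionsI[where B = "\<bar>r\<bar> * B"]) (simp add: abs_mult mult_left_mono)
qed

lemma bounded_functions_diff:
  assumes "f \<in> bounded_functions S" "g \<in> bounded_functions S"
  shows "(\<lambda>i. f i - g i) \<in> bounded_functions S"
  using bounded_functions_add[OF assms(1) bounded_functions_mult[OF assms(2), of "-1"]] by simp

lemma bounded_functions_sum:
  "(\<And>j. j \<in> J \<Longrightarrow> f j \<in> bounded_functions S) \<Longrightarrow> (\<lambda>i. \<Sum>j\<in>J. f j i) \<in> bounded_functions S"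
  by (induction J rule: infinite_finite_induct)
    (auto simp: zero_in_bounded_functions bounded_functions_add)

definition supnorm :: "'i set \<Rightarrow> ('i \<Rightarrow> real) \<Rightarrow> real" where
  "supnorm S f = (SUP i\<in>S. \<bar>f i\<bar>)"

lemma supnorm_upper: "f \<in> bounded_functions S \<Longrightarrow> i \<in> S \<Longrightarrow> \<bar>f i\<bar> \<le> supnorm S f"
  unfolding supnorm_def by (elim bounded_functionsE) (auto intro!: cSUP_upper bdd_aboveI)

lemma supnorm_least: "S \<noteq> {} \<Longrightarrow> (\<And>i. i \<in> S \<Longrightarrow> \<bar>f i\<bar> \<le> B) \<Longrightarrow> supnorm S f \<le> B"
  unfolding supnorm_def by (rule cSUP_least)

lemma supnorm_nonneg: "f \<in> bounded_functions S \<Longrightarrow> S \<noteq> {} \<Longrightarrow> 0 \<le> supnorm S f"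
  using supnorm_upper[of f S] by force

lemma sublinear_supnorm:
  assumes S: "S \<noteq> {}" and L: "0 \<le> L"
  shows "sublinear_on (bounded_functions S) (\<lambda>f. L * supnorm S f)"
proof (rule sublinear_onI)
  fix f g :: "'a \<Rightarrow> real" assume fg: "f \<in> bounded_functions S" "g \<in> bounded_functions S"
  have "supnorm S (\<lambda>i. f i + g i) \<le> supnorm S f + supnorm S g"
    using supnorm_upper[OF fg(1)] supnorm_upper[OF fg(2)]
    by (intro supnorm_least[OF S]) (smt (verit))
  then show "L * supnorm S (\<lambda>i. f i + g i) \<le> L * supnorm S f + L * supnorm S g"
    using L by (metis distrib_left mult_left_mono)
next
  fix f :: "'a \<Rightarrow> real" and r :: real assume f: "f \<in> bounded_functions S" and r: "r > 0"
  have "supnorm S (\<lambda>i. r * f i) \<le> r * supnorm S f"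
    using supnorm_upper[OF f] r by (intro supnorm_least[OF S]) (simp add: abs_mult)
  then show "L * supnorm S (\<lambda>i. r * f i) \<le> r * (L * supnorm S f)"
    using L by (metis mult.left_commute mult_left_mono)
next
  show "L * supnorm S (\<lambda>i. 0) = 0" using S by (simp add: supnorm_def)
qed (rule bounded_functions_mult)

text \<open>Since \<open>B = 0\<close> is allowed, \<open>\<psi>\<close> does not see values off
  \<open>S\<close>: functions that agree on \<open>S\<close> differ by one on which
  \<open>\<psi>\<close> vanishes.\<close>

definition bounded_functional :: "'i set \<Rightarrow> real \<Rightarrow> (('i \<Rightarrow> real) \<Rightarrow> real) \<Rightarrow> bool" where
  "bounded_functional S L \<psi> \<longleftrightarrow> 0 \<le> L \<and> linear_on_functions (bounded_functions S) \<psi> \<and>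
     (\<forall>f B. 0 \<le> B \<longrightarrow> (\<forall>i\<in>S. \<bar>f i\<bar> \<le> B) \<longrightarrow> \<bar>\<psi> f\<bar> \<le> L * B)"

lemma bounded_functionalI:
  assumes S: "S \<noteq> {}" and L: "0 \<le> L" and lin: "linear_on_functions (bounded_functions S) \<psi>"
    and le: "\<And>f. f \<in> bounded_functions S \<Longrightarrow> \<psi> f \<le> L * supnorm S f"
  shows "bounded_functional S L \<psi>"
proof -
  have "\<bar>\<psi> f\<bar> \<le> L * B" if B: "\<forall>i\<in>S. \<bar>f i\<bar> \<le> B" for f B
  proof -
    have f: "f \<in> bounded_functions S" using B by (auto intro: bounded_functionsI)
    have "\<psi> (\<lambda>i. - 1 * f i) = - 1 * \<psi> f"
      using lin f unfolding linear_on_functions_def by blast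
    moreover have "L * supnorm S f \<le> L * B" "L * supnorm S (\<lambda>i. - 1 * f i) \<le> L * B"
      using B L S by (auto intro!: mult_left_mono supnorm_least)
    ultimately show ?thesis
      using le[OF f] le[OF bounded_functions_mult[OF f, of "-1"]] by linarith
  qed
  then show ?thesis using L lin by (auto simp: bounded_functional_def)
qed

lemma bounded_functional_bound:
  "bounded_functional S L \<psi> \<Longrightarrow> 0 \<le> B \<Longrightarrow> (\<And>i. i \<in> S \<Longrightarrow> \<bar>f i\<bar> \<le> B) \<Longrightarrow> \<bar>\<psi> f\<bar> \<le> L * B"
  by (auto simp: bounded_functional_def)

lemma bounded_functional_add:
  "bounded_functional S L \<psi> \<Longrightarrow> f \<in> bounded_functions S \<Longrightarrow> g \<in> bounded_functions S \<Longrightarrow>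
    \<psi> (\<lambda>i. f i + g i) = \<psi> f + \<psi> g"
  by (auto simp: bounded_functional_def linear_on_functions_def)

lemma bounded_functional_mult:
  "bounded_functional S L \<psi> \<Longrightarrow> f \<in> bounded_functions S \<Longrightarrow> \<psi> (\<lambda>i. r * f i) = r * \<psi> f"
  by (auto simp: bounded_functional_def linear_on_functions_def)

lemma bounded_functional_diff:
  "bounded_functional S L \<psi> \<Longrightarrow> f \<in> bounded_functions S \<Longrightarrow> g \<in> bounded_functions S \<Longrightarrow>
    \<psi> (\<lambda>i. f i - g i) = \<psi> f - \<psi> g"
  using bounded_functional_add[of S L \<psi> f "\<lambda>i. - 1 * g i"]
    bounded_functional_mult[of S L \<psi> g "-1"] bounded_functions_mult[of g S "-1"] by simp

lemma bounded_functional_sum: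
  assumes \<psi>: "bounded_functional S L \<psi>" and f: "\<And>j. j \<in> J \<Longrightarrow> f j \<in> bounded_functions S"
  shows "\<psi> (\<lambda>i. \<Sum>j\<in>J. c j * f j i) = (\<Sum>j\<in>J. c j * \<psi> (f j))"
  using f
proof (induction J rule: infinite_finite_induct)
  case (insert j J)
  then show ?case
    using bounded_functional_add[OF \<psi> bounded_functions_mult bounded_functions_sum, of "f j" J
        "\<lambda>j i. c j * f j i" "c j"]
      bounded_functional_mult[OF \<psi>, of "f j" "c j"]
    by (simp add: bounded_functions_mult)
qed (use bounded_functional_bound[OF \<psi>, of 0 "\<lambda>i. 0"] in auto)

text \<open>A form of Goldstine's theorem. Rounding the finitely many functions in \<open>G\<close>
  to multiples of \<open>\<delta>\<close> splits \<open>S\<close> into finitely many classes.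
  Replacing \<open>\<psi>\<close> by its values on the indicators of the classes, placed at
  representatives, keeps the norm and changes \<open>\<psi> g\<close> by at most
  \<open>L * \<delta>\<close>.\<close>

lemma ex_fin_functional_approx:
  assumes \<psi>: "bounded_functional S L \<psi>" and G: "finite G" "G \<subseteq> bounded_functions S"
    and \<epsilon>: "\<epsilon> > 0"
  obtains \<zeta> where "\<zeta> \<in> fin_functionals S L" "\<And>g. g \<in> G \<Longrightarrow> \<bar>\<zeta> g - \<psi> g\<bar> \<le> \<epsilon>"
proof -
  have L: "0 \<le> L" using \<psi> by (simp add: bounded_functional_def)
  define \<delta> where "\<delta> = \<epsilon> / (L + 1)"
  have \<delta>: "\<delta> > 0" "L * \<delta> \<le> \<epsilon>" using L \<epsilon> by (auto simp: \<delta>_def field_simps)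
  define code where "code i = (\<lambda>g\<in>G. \<lfloor>g i / \<delta>\<rfloor>)" for i
  have "\<forall>g\<in>G. \<exists>B. \<forall>i\<in>S. \<bar>g i\<bar> \<le> B" using G(2) by (auto simp: bounded_functions_def)
  then obtain B where B: "\<And>g i. g \<in> G \<Longrightarrow> i \<in> S \<Longrightarrow> \<bar>g i\<bar> \<le> B g" by metis
  have "code ` S \<subseteq> PiE G (\<lambda>g. {\<lfloor>- B g / \<delta>\<rfloor>..\<lfloor>B g / \<delta>\<rfloor>})"
  proof (rule image_subsetI)
    fix i assume "i \<in> S"
    then have "- B g / \<delta> \<le> g i / \<delta>" "g i / \<delta> \<le> B g / \<delta>" if "g \<in> G" for g
      using B[OF that] \<delta>(1) by (fastforce simp: abs_le_iff intro!: divide_right_mono)+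
    then show "code i \<in> PiE G (\<lambda>g. {\<lfloor>- B g / \<delta>\<rfloor>..\<lfloor>B g / \<delta>\<rfloor>})"
      by (auto simp: code_def intro!: floor_mono)
  qed
  then have "finite (code ` S)"
    by (rule finite_subset) (use G(1) in \<open>auto intro: finite_PiE\<close>)
  \<comment> \<open>\<open>F\<close> holds one representative of each class.\<close>
  moreover obtain F where F: "F \<subseteq> S" "inj_on code F" "code ` S = code ` F"
    using subset_image_inj[of "code ` S" code S] by auto
  ultimately have fin: "finite F" by (metis finite_imageD)
  define P where "P i j = (if j \<in> S \<and> code j = code i then 1 else 0 :: real)" for i j
  have P: "P i \<in> bounded_functions S" for i
    by (intro bounded_functionsI[where B = 1]) (simp add: P_def)
  have P_sum: "\<exists>i0\<in>F. code i0 = code j \<and> (\<forall>c. (\<Sum>i\<in>F. c i * P i j) = (c i0 :: real))"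
    if j: "j \<in> S" for j
  proof -
    obtain i0 where i0: "i0 \<in> F" "code i0 = code j" using F(3) j by (metis imageE imageI)
    have "(\<Sum>i\<in>F. c i * P i j) = (\<Sum>i\<in>F. if i = i0 then c i else 0)" for c :: "'a \<Rightarrow> real"
      using i0 j F(2) by (intro sum.cong) (auto simp: P_def inj_on_def)
    then show ?thesis using i0 fin by auto
  qed
  define z where "z i = \<psi> (P i)" for i
  \<comment> \<open>With the right signs the total variation becomes a single value of
    \<open>\<psi>\<close>, at a function of modulus at most 1, since each \<open>j\<close> lies in
    exactly one class.\<close>
  have "(\<Sum>i\<in>F. \<bar>z i\<bar>) = \<psi> (\<lambda>j. \<Sum>i\<in>F. sgn (z i) * P i j)"
    by (subst bounded_functional_sum[OF \<psi> P]) (simp add: z_def[symmetric] sgn_mult_self_eq abs_sgn mult.commute)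
  also have "\<dots> \<le> L * 1"
  proof (rule order_trans[OF abs_ge_self bounded_functional_bound[OF \<psi>]])
    fix j assume "j \<in> S"
    then show "\<bar>\<Sum>i\<in>F. sgn (z i) * P i j\<bar> \<le> 1"
      using P_sum[of j] by (auto simp: abs_sgn_eq)
  qed simp
  finally have "(\<lambda>f. \<Sum>i\<in>F. z i * f i) \<in> fin_functionals S L"
    using fin F(1) by (intro fin_functionalsI) auto
  moreover have "\<bar>(\<Sum>i\<in>F. z i * g i) - \<psi> g\<bar> \<le> \<epsilon>" if g: "g \<in> G" for g
  proof -
    have gS: "g \<in> bounded_functions S" using g G(2) by auto
    have "(\<Sum>i\<in>F. z i * g i) = \<psi> (\<lambda>j. \<Sum>i\<in>F. g i * P i j)"
      by (subst bounded_functional_sum[OF \<psi> P]) (simp add: z_def mult.commute)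
    also have "\<dots> - \<psi> g = \<psi> (\<lambda>j. (\<Sum>i\<in>F. g i * P i j) - g j)"
      using bounded_functional_diff[OF \<psi> bounded_functions_sum gS, of F "\<lambda>i j. g i * P i j"]
        bounded_functions_mult[OF P] by simp
    also have "\<bar>\<dots>\<bar> \<le> L * \<delta>"
    proof (rule bounded_functional_bound[OF \<psi>])
      fix j assume "j \<in> S"
      then obtain i0 where i0: "code i0 = code j" "(\<Sum>i\<in>F. g i * P i j) = g i0"
        using P_sum[of j] by blast
      have "\<lfloor>g i0 / \<delta>\<rfloor> = \<lfloor>g j / \<delta>\<rfloor>"
        using fun_cong[OF i0(1), of g] g by (simp add: code_def)
      then have "\<bar>g i0 / \<delta> - g j / \<delta>\<bar> \<le> 1" by linarith
      then show "\<bar>(\<Sum>i\<in>F. g i * P i j) - g j\<bar> \<le> \<delta>"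
        using \<delta>(1) i0(2) by (simp add: abs_le_iff field_simps)
    qed (use \<delta> in simp)
    finally show ?thesis using \<delta>(2) by simp
  qed
  ultimately show ?thesis using that by blast
qed

text \<open>
  By the Hahn-Banach theorem, if \<open>\<psi>\<close> is not a uniform limit on \<open>C\<close> then some functional \<open>\<theta>\<close> on the
  bounded functions on \<open>C\<close> separates it from all finitely supported functionals. Approximating
  \<open>\<psi>\<close> and \<open>\<theta>\<close> alternately on finitely many functions then violates the double limit property.
\<close>

theorem ex_fin_functional_uniform_approx:
  fixes C :: "('i \<Rightarrow> real) set"
  assumes dl: "double_limit C UNIV (\<lambda>c i. c i)" and CK': "\<forall>c\<in>C. \<forall>i. \<bar>c i\<bar> \<le> K"
    and \<psi>: "bounded_functional UNIV L \<psi>" and \<epsilon>: "\<epsilon> > 0"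
  shows "\<exists>\<zeta>\<in>fin_functionals UNIV L. \<forall>c\<in>C. \<bar>\<psi> c - \<zeta> c\<bar> \<le> \<epsilon>"
proof (rule ccontr)
  assume "\<not> ?thesis"
  then have bad: "\<exists>c\<in>C. \<epsilon> < \<bar>\<psi> c - \<zeta> c\<bar>" if "\<zeta> \<in> fin_functionals UNIV L" for \<zeta>
    using that by force
  have CK: "\<bar>c i\<bar> \<le> K" if "c \<in> C" for c i using CK' that by blast
  have L: "0 \<le> L" using \<psi> by (simp add: bounded_functional_def)
  have C: "C \<noteq> {}" using bad[OF zero_in_fin_functionals[OF L]] by auto
  then have K: "0 \<le> K" using CK by force
  have \<psi>C: "\<bar>\<psi> c\<bar> \<le> L * K" if "c \<in> C" for c
    using CK[OF that] by (intro bounded_functional_bound[OF \<psi> K])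
  have \<psi>b: "\<psi> \<in> bounded_functions C" using \<psi>C by (rule bounded_functionsI)
  have \<zeta>b: "\<zeta> \<in> bounded_functions C" if "\<zeta> \<in> fin_functionals UNIV L'" for \<zeta> L'
    using fin_functionals_bound[OF that K] CK by (intro bounded_functionsI[where B = "L' * K"]) auto
  \<comment> \<open>The cone generated by the differences \<open>\<zeta> - \<psi>\<close>, with
    \<open>t\<close> as scaling factor; its constraints say that \<open>\<theta>\<close> is at least
    \<open>\<epsilon>\<close> on every unscaled difference.\<close>
  define X where "X = {((\<lambda>c. \<zeta> c - t * \<psi> c), - t * \<epsilon>) | \<zeta> t. 0 \<le> t \<and> \<zeta> \<in> fin_functionals UNIV (t * L)}"
  have XI: "0 \<le> t \<Longrightarrow> \<zeta> \<in> fin_functionals UNIV (t * L) \<Longrightarrow> f = (\<lambda>c. \<zeta> c - t * \<psi> c) \<Longrightarrow> w = - t * \<epsilon>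
      \<Longrightarrow> (f, w) \<in> X" for \<zeta> t f w
    unfolding X_def by blast
  have "\<exists>\<theta>. linear_on_functions (bounded_functions C) \<theta> \<and>
      (\<forall>f\<in>bounded_functions C. \<theta> f \<le> 1 * supnorm C f) \<and> (\<forall>f w. (f, w) \<in> X \<longrightarrow> - w \<le> \<theta> f)"
  proof (rule Hahn_Banach_sandwich[OF zero_in_bounded_functions bounded_functions_add
        bounded_functions_mult sublinear_supnorm[OF C zero_le_one]])
    show "((\<lambda>i. 0), 0) \<in> X"
      using zero_in_fin_functionals[of "0 * L" UNIV] by (intro XI[of 0 "\<lambda>f. 0"]) auto
    fix f w assume "(f, w) \<in> X"
    then obtain \<zeta> t where f: "0 \<le> t" "\<zeta> \<in> fin_functionals UNIV (t * L)"
        "f = (\<lambda>c. \<zeta> c - t * \<psi> c)" "w = - t * \<epsilon>"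
      unfolding X_def by blast
    show fb: "f \<in> bounded_functions C"
      unfolding f(3) using \<psi>b \<zeta>b[OF f(2)] by (intro bounded_functions_diff bounded_functions_mult)
    show "((\<lambda>i. r * f i), r * w) \<in> X" if "r > 0" for r
      using that f fin_functionals_scale[OF f(2), of r]
      by (intro XI[of "r * t" "\<lambda>f. r * \<zeta> f"]) (auto simp: algebra_simps)
    show "((\<lambda>i. f i + g i), w + u) \<in> X" if "(g, u) \<in> X" for g u
    proof -
      obtain \<eta> s where g: "0 \<le> s" "\<eta> \<in> fin_functionals UNIV (s * L)"
          "g = (\<lambda>c. \<eta> c - s * \<psi> c)" "u = - s * \<epsilon>"
        using \<open>(g, u) \<in> X\<close> unfolding X_def by blast
      then show ?thesis
        using f fin_functionals_plus[OF f(2) g(2)]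
        by (intro XI[of "t + s" "\<lambda>f. \<zeta> f + \<eta> f"]) (auto simp: algebra_simps)
    qed
    show "0 \<le> 1 * supnorm C f + w"
    proof (cases "t = 0")
      case True
      then show ?thesis using supnorm_nonneg[OF fb C] f(4) by simp
    next
      case False
      then have t: "t > 0" using f(1) by simp
      have "(\<lambda>f. inverse t * \<zeta> f) \<in> fin_functionals UNIV L"
        using fin_functionals_scale[OF f(2), of "inverse t"] t by (simp add: mult.assoc[symmetric])
      then obtain c where c: "c \<in> C" "\<epsilon> < \<bar>\<psi> c - inverse t * \<zeta> c\<bar>" using bad by blast
      have "t * \<epsilon> \<le> t * \<bar>\<psi> c - inverse t * \<zeta> c\<bar>" using c(2) t by simp
      also have "\<dots> = \<bar>t * (\<psi> c - inverse t * \<zeta> c)\<bar>" using t by (simp add: abs_mult)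
      also have "\<dots> = \<bar>f c\<bar>" using t
          by (simp add: f(3) right_diff_distrib mult.assoc[symmetric] abs_minus_commute)
      also have "\<dots> \<le> supnorm C f" by (rule supnorm_upper[OF fb c(1)])
      finally show ?thesis using f(4) by simp
    qed
  qed
  then obtain \<theta> where \<theta>: "linear_on_functions (bounded_functions C) \<theta>"
      "\<And>f. f \<in> bounded_functions C \<Longrightarrow> \<theta> f \<le> 1 * supnorm C f"
      "\<And>f w. (f, w) \<in> X \<Longrightarrow> - w \<le> \<theta> f"
    by blast
  have \<theta>': "bounded_functional C 1 \<theta>"
    by (rule bounded_functionalI[OF C zero_le_one \<theta>(1,2)])
  have sep: "\<theta> \<psi> + \<epsilon> \<le> \<theta> \<zeta>" if \<zeta>: "\<zeta> \<in> fin_functionals UNIV L" for \<zeta>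
  proof -
    have "((\<lambda>c. \<zeta> c - \<psi> c), - \<epsilon>) \<in> X" using \<zeta> by (intro XI[of 1 \<zeta>]) auto
    then have "\<epsilon> \<le> \<theta> (\<lambda>c. \<zeta> c - \<psi> c)" using \<theta>(3) by fastforce
    then show ?thesis using bounded_functional_diff[OF \<theta>' \<zeta>b[OF \<zeta>] \<psi>b] by simp
  qed
  \<comment> \<open>Each \<open>\<zeta>\<close> imitates \<open>\<psi>\<close> on the barycentres of
    the earlier \<open>\<eta>\<close>, and each \<open>\<eta>\<close> imitates
    \<open>\<theta>\<close> at \<open>\<psi>\<close> and at the earlier \<open>\<zeta>\<close>. With
    error \<open>\<epsilon> / 4\<close> per step, \<open>\<eta> n (\<zeta> m)\<close> is at most
    \<open>\<theta> \<psi> + \<epsilon> / 2\<close> for \<open>n < m\<close> and at least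
    \<open>\<theta> \<psi> + 3 * \<epsilon> / 4\<close> for \<open>m < n\<close>.\<close>
  define P where "P f n r \<longleftrightarrow> fst r \<in> fin_functionals UNIV L \<and> snd r \<in> fin_functionals C 1 \<and>
      (\<forall>j<n. \<bar>fst r (\<lambda>i. snd (f j) (\<lambda>c. c i)) - \<psi> (\<lambda>i. snd (f j) (\<lambda>c. c i))\<bar> \<le> \<epsilon> / 4) \<and>
      \<bar>snd r \<psi> - \<theta> \<psi>\<bar> \<le> \<epsilon> / 4 \<and> (\<forall>j<n. \<bar>snd r (fst (f j)) - \<theta> (fst (f j))\<bar> \<le> \<epsilon> / 4)"
    for f :: "nat \<Rightarrow> (('i \<Rightarrow> real) \<Rightarrow> real) \<times> ((('i \<Rightarrow> real) \<Rightarrow> real) \<Rightarrow> real)" and n r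
  have gb: "(\<lambda>i. \<eta> (\<lambda>c. c i)) \<in> bounded_functions UNIV" if "\<eta> \<in> fin_functionals C 1" for \<eta>
    using fin_functionals_bound[OF that K] CK by (intro bounded_functionsI[where B = "1 * K"]) auto
  have "\<exists>f. \<forall>n. P f n (f n)"
  proof (rule dependent_wellorder_choice)
    fix r and f f' :: "nat \<Rightarrow> (('i \<Rightarrow> real) \<Rightarrow> real) \<times> ((('i \<Rightarrow> real) \<Rightarrow> real) \<Rightarrow> real)" and n :: nat
    assume "\<And>y. y < n \<Longrightarrow> f y = f' y"
    then show "P f n r = P f' n r" unfolding P_def by auto
  next
    fix n and f :: "nat \<Rightarrow> (('i \<Rightarrow> real) \<Rightarrow> real) \<times> ((('i \<Rightarrow> real) \<Rightarrow> real) \<Rightarrow> real)"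
    assume IH: "\<And>y. y < n \<Longrightarrow> P f y (f y)"
    have "(\<lambda>j i. snd (f j) (\<lambda>c. c i)) ` {..<n} \<subseteq> bounded_functions UNIV"
      using IH gb by (auto simp: P_def)
    then obtain \<zeta> where \<zeta>: "\<zeta> \<in> fin_functionals UNIV L"
        "\<And>g. g \<in> (\<lambda>j i. snd (f j) (\<lambda>c. c i)) ` {..<n} \<Longrightarrow> \<bar>\<zeta> g - \<psi> g\<bar> \<le> \<epsilon> / 4"
      using ex_fin_functional_approx[OF \<psi>, of "(\<lambda>j i. snd (f j) (\<lambda>c. c i)) ` {..<n}" "\<epsilon> / 4"] \<epsilon>
      by auto
    have "fst (f j) \<in> bounded_functions C" if "j < n" for j
      using IH[OF that] by (intro \<zeta>b[where L' = L]) (simp add: P_def)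
    then have "insert \<psi> ((\<lambda>j. fst (f j)) ` {..<n}) \<subseteq> bounded_functions C"
      using \<psi>b by auto
    then obtain \<eta> where \<eta>: "\<eta> \<in> fin_functionals C 1"
        "\<And>g. g \<in> insert \<psi> ((\<lambda>j. fst (f j)) ` {..<n}) \<Longrightarrow> \<bar>\<eta> g - \<theta> g\<bar> \<le> \<epsilon> / 4"
      using ex_fin_functional_approx[OF \<theta>', of "insert \<psi> ((\<lambda>j. fst (f j)) ` {..<n})" "\<epsilon> / 4"] \<epsilon>
      by auto
    have "P f n (\<zeta>, \<eta>)" unfolding P_def using \<zeta> \<eta> by auto
    then show "\<exists>r. P f n r" ..
  qed
  then obtain f where f: "\<And>n. P f n (f n)" by blast
  define \<zeta> where "\<zeta> n = fst (f n)" for n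
  define \<eta> where "\<eta> n = snd (f n)" for n
  have \<zeta>: "\<zeta> n \<in> fin_functionals UNIV L" and \<eta>: "\<eta> n \<in> fin_functionals C 1"
    and \<eta>\<psi>: "\<bar>\<eta> n \<psi> - \<theta> \<psi>\<bar> \<le> \<epsilon> / 4" for n
    using f[of n] by (auto simp: P_def \<zeta>_def \<eta>_def)
  have up: "\<eta> n (\<zeta> m) \<le> \<theta> \<psi> + \<epsilon> / 2" if "n < m" for n m
  proof -
    obtain F z where F: "finite F" "F \<subseteq> C" "\<eta> n = (\<lambda>h. \<Sum>c\<in>F. z c * h c)"
      using \<eta>[of n] by (metis fin_functionalsE)
    have "\<psi> (\<lambda>i. \<eta> n (\<lambda>c. c i)) = \<eta> n \<psi>"
      unfolding F(3) using F(2) bounded_functional_sum[OF \<psi>, of F "\<lambda>c i. c i" z]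
        bounded_functionsI[of UNIV _ K] CK by fastforce
    moreover have "\<zeta> m (\<lambda>i. \<eta> n (\<lambda>c. c i)) = \<eta> n (\<zeta> m)"
      unfolding F(3) by (simp add: fin_functionals_sum[OF \<zeta>] fin_functionals_mult[OF \<zeta>])
    moreover have "\<bar>\<zeta> m (\<lambda>i. \<eta> n (\<lambda>c. c i)) - \<psi> (\<lambda>i. \<eta> n (\<lambda>c. c i))\<bar> \<le> \<epsilon> / 4"
      using f[of m] that by (auto simp: P_def \<zeta>_def \<eta>_def)
    ultimately show ?thesis using \<eta>\<psi>[of n] by linarith
  qed
  have low: "\<theta> \<psi> + 3 * \<epsilon> / 4 \<le> \<eta> n (\<zeta> m)" if "m < n" for n m
  proof -
    have "\<bar>\<eta> n (\<zeta> m) - \<theta> (\<zeta> m)\<bar> \<le> \<epsilon> / 4"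
      using f[of n] that by (auto simp: P_def \<zeta>_def \<eta>_def)
    then show ?thesis using sep[OF \<zeta>, of m] by linarith
  qed
  \<comment> \<open>The passage from points to measures is made twice, once in each
    variable.\<close>
  have "double_limit C (fin_functionals UNIV L) (\<lambda>c \<zeta>. \<zeta> c)"
    using double_limit_fin_functionals[of C UNIV "\<lambda>c i. c i" K L] dl CK by auto
  then have "double_limit (fin_functionals UNIV L) C (\<lambda>\<zeta> c. \<zeta> c)"
    by (rule double_limit_swap)
  then have "double_limit (fin_functionals UNIV L) (fin_functionals C 1) (\<lambda>\<zeta> \<eta>. \<eta> \<zeta>)"
    by (rule double_limit_fin_functionals[of _ _ "\<lambda>\<zeta> c. \<zeta> c" "L * K"])
      (rule fin_functionals_bound[OF _ K], assumption, rule CK)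
  moreover obtain U :: "nat filter" where U: "nonprincipal_ultrafilter U"
    using ex_nonprincipal_ultrafilter by blast
  ultimately have eq: "Lim U (\<lambda>m. Lim U (\<lambda>n. \<eta> n (\<zeta> m))) = Lim U (\<lambda>n. Lim U (\<lambda>m. \<eta> n (\<zeta> m)))"
    unfolding double_limit_def using \<zeta> \<eta> by (auto simp: image_subset_iff)
  have uU: "ultrafilter U" using U by (simp add: nonprincipal_ultrafilter_def)
  note nb = ultrafilter_not_bot[OF uU]
  have late: "eventually (\<lambda>n. m < n) U" for m
    using nonprincipal_ultrafilter_le_sequentially[OF U] eventually_gt_at_top filter_leD by blast
  have bnd: "\<bar>\<eta> n (\<zeta> m)\<bar> \<le> L * K" for n m
    using fin_functionals_bound[OF \<eta>, of "L * K" "\<zeta> m" n] fin_functionals_bound[OF \<zeta> K] CK L K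
    by simp
  have bl1: "\<bar>Lim U (\<lambda>n. \<eta> n (\<zeta> m))\<bar> \<le> L * K" for m
    using bnd by (intro abs_Lim_le[OF uU]) simp
  have bl2: "\<bar>Lim U (\<lambda>m. \<eta> n (\<zeta> m))\<bar> \<le> L * K" for n
    using bnd by (intro abs_Lim_le[OF uU]) simp
  have "\<theta> \<psi> + 3 * \<epsilon> / 4 \<le> Lim U (\<lambda>n. \<eta> n (\<zeta> m))" for m
    using late[of m] bnd
    by (intro Lim_ge_const[OF nb] ultrafilter_tendsto_Lim[OF uU, where B = "L * K"])
      (auto elim!: eventually_mono intro: low)
  then have "\<theta> \<psi> + 3 * \<epsilon> / 4 \<le> Lim U (\<lambda>m. Lim U (\<lambda>n. \<eta> n (\<zeta> m)))"
    using bl1 by (intro Lim_ge_const[OF nb] ultrafilter_tendsto_Lim[OF uU, where B = "L * K"]) auto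
  moreover have "Lim U (\<lambda>m. \<eta> n (\<zeta> m)) \<le> \<theta> \<psi> + \<epsilon> / 2" for n
    using late[of n] bnd
    by (intro Lim_le_const[OF nb] ultrafilter_tendsto_Lim[OF uU, where B = "L * K"])
      (auto elim!: eventually_mono intro: up)
  then have "Lim U (\<lambda>n. Lim U (\<lambda>m. \<eta> n (\<zeta> m))) \<le> \<theta> \<psi> + \<epsilon> / 2"
    using bl2 by (intro Lim_le_const[OF nb] ultrafilter_tendsto_Lim[OF uU, where B = "L * K"]) auto
  ultimately show False using eq \<epsilon> by simp
qed

section \<open>A reflexive interpolation space\<close>

text \<open>\<open>C\<close> need be neither convex nor symmetric, since only absolute values of
  functionals on it enter. \<open>zero_C\<close> is what extracts from the polar condition the bound
  \<open>1 / b n\<close> on the total variation.\<close>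

locale interpolation =
  fixes C :: "('i \<Rightarrow> real) set" and a b :: "nat \<Rightarrow> real"
  assumes zero_C: "(\<lambda>i. 0) \<in> C" and C_le_1: "\<And>c i. c \<in> C \<Longrightarrow> \<bar>c i\<bar> \<le> 1"
    and double_limit_C: "double_limit C UNIV (\<lambda>c i. c i)"
    and a_nonneg: "\<And>n. 0 \<le> a n" and b_pos: "\<And>n. 0 < b n" and b_null: "b \<longlonglongrightarrow> 0"
    and ab_sums: "(\<lambda>n. (1 / (a n + b n))\<^sup>2) sums 1"
begin

text \<open>
  \<open>N n\<close> is the gauge of the weak closure of \<open>a\<^sub>n aco(C) + b\<^sub>n B\<close>, where \<open>B\<close> is the unit ball for
  the supremum norm, but it is defined by duality, through the polar set. With \<open>ab_sums\<close>, the
  \<open>\<ell>\<^sub>2\<close>-sum of these gauges is a norm whose unit ball lies between \<open>C\<close> and \<open>B\<close>.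
\<close>

definition polar :: "nat \<Rightarrow> (('i \<Rightarrow> real) \<Rightarrow> real) set" where
  "polar n = {\<zeta>. \<exists>t. \<zeta> \<in> fin_functionals UNIV t \<and> (\<forall>c\<in>C. a n * \<bar>\<zeta> c\<bar> + b n * t \<le> 1)}"

definition N :: "nat \<Rightarrow> ('i \<Rightarrow> real) \<Rightarrow> real" where
  "N n v = (SUP \<zeta>\<in>polar n. \<bar>\<zeta> v\<bar>)"

definition Vc :: "('i \<Rightarrow> real) set" where
  "Vc = {v \<in> bounded_functions UNIV. \<exists>r. \<forall>k. L2_set (\<lambda>n. N n v) {..<k} \<le> r}"

text \<open>The \<open>\<ell>\<^sub>2\<close>-sum as a supremum of finite sums, so that membership
  and norm bounds both follow from estimates uniform in \<open>k\<close>.\<close>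

definition nrm :: "('i \<Rightarrow> real) \<Rightarrow> real" where
  "nrm v = (SUP k. L2_set (\<lambda>n. N n v) {..<k})"

definition V :: "('i \<Rightarrow> real) normed_module" where
  "V = \<lparr>carrier = Vc, monoid.mult = undefined, one = undefined, zero = (\<lambda>i. 0),
     add = (\<lambda>f g i. f i + g i), smult = (\<lambda>r f i. r * f i), vnorm = nrm\<rparr>"

section \<open>The gauges \<open>N n\<close>\<close>

lemma ab_pos: "0 < a n + b n"
  using a_nonneg[of n] b_pos[of n] by simp

lemma polarE:
  assumes "\<zeta> \<in> polar n"
  obtains t where "\<zeta> \<in> fin_functionals UNIV t" "0 \<le> t" "t \<le> 1 / b n"
    "\<And>c. c \<in> C \<Longrightarrow> a n * \<bar>\<zeta> c\<bar> + b n * t \<le> 1"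
proof -
  obtain t where t: "\<zeta> \<in> fin_functionals UNIV t" "\<And>c. c \<in> C \<Longrightarrow> a n * \<bar>\<zeta> c\<bar> + b n * t \<le> 1"
    using assms by (auto simp: polar_def)
  have "0 \<le> a n * \<bar>\<zeta> (\<lambda>i. 0)\<bar>" using a_nonneg by simp
  then have "b n * t \<le> 1" using t(2)[OF zero_C] by linarith
  then have "t \<le> 1 / b n" using b_pos[of n] by (simp add: field_simps)
  then show ?thesis using that t fin_functionals_nonneg by blast
qed

lemma zero_in_polar: "(\<lambda>f. 0) \<in> polar n"
  unfolding polar_def using zero_in_fin_functionals[of 0 UNIV] by fastforce

lemma polar_minus: "\<zeta> \<in> polar n \<Longrightarrow> (\<lambda>f. - \<zeta> f) \<in> polar n"
  unfolding polar_def using fin_functionals_scale[of \<zeta> UNIV _ "-1"] by fastforce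

lemma polar_bound:
  assumes "\<zeta> \<in> polar n" "0 \<le> B" "\<And>i. \<bar>v i\<bar> \<le> B"
  shows "\<bar>\<zeta> v\<bar> \<le> B / b n"
proof -
  obtain t where t: "\<zeta> \<in> fin_functionals UNIV t" "t \<le> 1 / b n"
    using assms(1) by (rule polarE)
  have "\<bar>\<zeta> v\<bar> \<le> t * B" using assms by (intro fin_functionals_bound[OF t(1)]) auto
  also have "\<dots> \<le> 1 / b n * B" using t(2) assms(2) by (rule mult_right_mono)
  finally show ?thesis by simp
qed

lemma N_upper:
  assumes "v \<in> bounded_functions UNIV" "\<zeta> \<in> polar n"
  shows "\<bar>\<zeta> v\<bar> \<le> N n v"
proof -
  obtain B where "0 \<le> B" "\<And>i. i \<in> UNIV \<Longrightarrow> \<bar>v i\<bar> \<le> B"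
    using assms(1) by (metis bounded_functionsE)
  then show ?thesis unfolding N_def using assms(2) polar_bound[of _ n B v]
    by (intro cSUP_upper bdd_aboveI[of _ "B / b n"]) auto
qed

lemma N_least: "(\<And>\<zeta>. \<zeta> \<in> polar n \<Longrightarrow> \<bar>\<zeta> v\<bar> \<le> x) \<Longrightarrow> N n v \<le> x"
  unfolding N_def using zero_in_polar by (intro cSUP_least) auto

lemma N_nonneg: "v \<in> bounded_functions UNIV \<Longrightarrow> 0 \<le> N n v"
  using N_upper[OF _ zero_in_polar] by force

lemma N_add:
  assumes "v \<in> bounded_functions UNIV" "w \<in> bounded_functions UNIV"
  shows "N n (\<lambda>i. v i + w i) \<le> N n v + N n w"
proof (rule N_least)
  fix \<zeta> assume \<zeta>: "\<zeta> \<in> polar n"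
  then obtain t where t: "\<zeta> \<in> fin_functionals UNIV t" by (rule polarE)
  show "\<bar>\<zeta> (\<lambda>i. v i + w i)\<bar> \<le> N n v + N n w"
    using N_upper[OF assms(1) \<zeta>] N_upper[OF assms(2) \<zeta>] by (simp add: fin_functionals_add[OF t])
qed

lemma N_mult:
  assumes v: "v \<in> bounded_functions UNIV"
  shows "N n (\<lambda>i. r * v i) = \<bar>r\<bar> * N n v"
proof -
  have le: "N n (\<lambda>i. r * v i) \<le> \<bar>r\<bar> * N n v" if v: "v \<in> bounded_functions UNIV" for r v
  proof (rule N_least)
    fix \<zeta> assume \<zeta>: "\<zeta> \<in> polar n"
    then obtain t where t: "\<zeta> \<in> fin_functionals UNIV t" by (rule polarE)
    show "\<bar>\<zeta> (\<lambda>i. r * v i)\<bar> \<le> \<bar>r\<bar> * N n v"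
      using N_upper[OF v \<zeta>] by (simp add: fin_functionals_mult[OF t] abs_mult mult_left_mono)
  qed
  show ?thesis
  proof (cases "r = 0")
    case True
    then show ?thesis using le[OF v, of 0] N_nonneg[OF zero_in_bounded_functions, of n] by simp
  next
    case False
    have "N n (\<lambda>i. inverse r * (r * v i)) \<le> \<bar>inverse r\<bar> * N n (\<lambda>i. r * v i)"
      using v by (intro le bounded_functions_mult)
    then have "\<bar>r\<bar> * N n v \<le> N n (\<lambda>i. r * v i)"
      using False by (simp add: mult.assoc[symmetric] field_simps)
    then show ?thesis using le[OF v, of r] by simp
  qed
qed

lemma N_zero: "N n (\<lambda>i. 0) = 0"
  using N_mult[OF zero_in_bounded_functions, of n 0] by simp

lemma N_diff_abs:
  assumes "v \<in> bounded_functions UNIV" "w \<in> bounded_functions UNIV"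
  shows "\<bar>N n v - N n w\<bar> \<le> N n (\<lambda>i. v i - w i)"
proof -
  have "N n v \<le> N n (\<lambda>i. v i - w i) + N n w"
    using N_add[OF bounded_functions_diff[OF assms] assms(2), of n] by simp
  moreover have "N n w \<le> N n (\<lambda>i. w i - v i) + N n v"
    using N_add[OF bounded_functions_diff[OF assms(2,1)] assms(1), of n] by simp
  moreover have "N n (\<lambda>i. w i - v i) = N n (\<lambda>i. v i - w i)"
    using N_mult[OF bounded_functions_diff[OF assms], of n "-1"] by simp
  ultimately show ?thesis by linarith
qed

lemma N_le_sup: "0 \<le> B \<Longrightarrow> (\<And>i. \<bar>v i\<bar> \<le> B) \<Longrightarrow> N n v \<le> B / b n"
  by (intro N_least polar_bound)

text \<open>A point of \<open>C\<close> also lies in the unit ball B, so its multiple by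
  \<open>a n + b n\<close> lies in the sum set. Dually,
  \<open>\<bar>\<zeta> c\<bar> \<le> t\<close>, so both terms of the polar condition control
  \<open>\<bar>\<zeta> c\<bar>\<close>.\<close>

lemma N_C:
  assumes c: "c \<in> C"
  shows "N n c \<le> 1 / (a n + b n)"
proof (rule N_least)
  fix \<zeta> assume "\<zeta> \<in> polar n"
  then obtain t where t: "\<zeta> \<in> fin_functionals UNIV t" "\<And>c. c \<in> C \<Longrightarrow> a n * \<bar>\<zeta> c\<bar> + b n * t \<le> 1"
    by (metis polarE)
  have "\<bar>\<zeta> c\<bar> \<le> t * 1" using C_le_1[OF c] by (intro fin_functionals_bound[OF t(1)]) auto
  then have "b n * \<bar>\<zeta> c\<bar> \<le> b n * t" using b_pos[of n] by simp
  then have "(a n + b n) * \<bar>\<zeta> c\<bar> \<le> 1" using t(2)[OF c] by (simp add: distrib_right)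
  then show "\<bar>\<zeta> c\<bar> \<le> 1 / (a n + b n)" using ab_pos[of n] by (simp add: field_simps)
qed

text \<open>Homogeneity of the polar condition: dividing by \<open>D\<close> puts the functional
  into \<open>polar n\<close>.\<close>

lemma N_scaled:
  assumes v: "v \<in> bounded_functions UNIV" and \<zeta>: "\<zeta> \<in> fin_functionals UNIV t" and D: "D > 0"
    and le: "\<And>c. c \<in> C \<Longrightarrow> a n * \<bar>\<zeta> c\<bar> + b n * t \<le> D"
  shows "\<bar>\<zeta> v\<bar> \<le> D * N n v"
proof -
  have "a n * \<bar>inverse D * \<zeta> c\<bar> + b n * (inverse D * t) \<le> 1" if "c \<in> C" for c
  proof -
    have "inverse D * (a n * \<bar>\<zeta> c\<bar> + b n * t) \<le> inverse D * D"
      using le[OF that] D by (intro mult_left_mono) auto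
    then show ?thesis using D by (simp add: abs_mult algebra_simps)
  qed
  then have "(\<lambda>f. inverse D * \<zeta> f) \<in> polar n"
    unfolding polar_def using fin_functionals_scale[OF \<zeta>, of "inverse D"] D by auto
  from N_upper[OF v this] show ?thesis using D by (simp add: abs_mult field_simps)
qed

text \<open>Counterpart of \<open>N_C\<close>: as \<open>C\<close> lies in B, the sum set lies in
  the ball of radius \<open>a n + b n\<close>, so evaluation at a point is in the correspondingly
  scaled polar.\<close>

lemma N_point:
  assumes v: "v \<in> bounded_functions UNIV"
  shows "\<bar>v i\<bar> \<le> (a n + b n) * N n v"
proof (rule N_scaled[OF v eval_in_fin_functionals ab_pos, of i])
  fix c assume "c \<in> C"
  then have "a n * \<bar>c i\<bar> \<le> a n * 1" using a_nonneg C_le_1 by (intro mult_left_mono) auto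
  then show "a n * \<bar>c i\<bar> + b n * 1 \<le> a n + b n" by simp
qed simp

section \<open>The interpolation norm as a complete norm between \<open>C\<close> and the supremum
  norm\<close>

lemma Vc_bounded: "v \<in> Vc \<Longrightarrow> v \<in> bounded_functions UNIV"
  by (simp add: Vc_def)

lemma nrm_upper: "v \<in> Vc \<Longrightarrow> L2_set (\<lambda>n. N n v) {..<k} \<le> nrm v"
  unfolding Vc_def nrm_def by (auto intro!: cSUP_upper bdd_aboveI)

lemma nrm_least: "(\<And>k. L2_set (\<lambda>n. N n v) {..<k} \<le> r) \<Longrightarrow> nrm v \<le> r"
  unfolding nrm_def by (rule cSUP_least) auto

lemma nrm_nonneg: "v \<in> Vc \<Longrightarrow> 0 \<le> nrm v"
  using nrm_upper[of v 0] by simp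

lemma VcI:
  assumes "v \<in> bounded_functions UNIV" "\<And>k. L2_set (\<lambda>n. N n v) {..<k} \<le> r"
  shows "v \<in> Vc" "nrm v \<le> r"
  using assms nrm_least by (auto simp: Vc_def)

lemma N_le_nrm:
  assumes "v \<in> Vc"
  shows "N n v \<le> nrm v"
proof -
  have "N n v \<le> L2_set (\<lambda>n. N n v) {..<Suc n}"
    by (rule member_le_L2_set) auto
  then show ?thesis using nrm_upper[OF assms, of "Suc n"] by linarith
qed

lemma zero_Vc: "(\<lambda>i. 0) \<in> Vc" "nrm (\<lambda>i. 0) = 0"
proof -
  show "(\<lambda>i. 0) \<in> Vc"
    by (rule VcI(1)[of _ 0]) (simp_all add: N_zero zero_in_bounded_functions L2_set_def)
  show "nrm (\<lambda>i. 0) = 0"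
    by (simp add: nrm_def N_zero L2_set_def)
qed

lemma add_Vc:
  assumes v: "v \<in> Vc" and w: "w \<in> Vc"
  shows "(\<lambda>i. v i + w i) \<in> Vc" "nrm (\<lambda>i. v i + w i) \<le> nrm v + nrm w"
proof -
  note vb = Vc_bounded[OF v] and wb = Vc_bounded[OF w]
  note sb = bounded_functions_add[OF vb wb]
  have "L2_set (\<lambda>n. N n (\<lambda>i. v i + w i)) {..<k} \<le> nrm v + nrm w" for k
  proof -
    have "L2_set (\<lambda>n. N n (\<lambda>i. v i + w i)) {..<k} \<le> L2_set (\<lambda>n. N n v + N n w) {..<k}"
      by (intro L2_set_mono N_add vb wb N_nonneg sb)
    also have "\<dots> \<le> L2_set (\<lambda>n. N n v) {..<k} + L2_set (\<lambda>n. N n w) {..<k}"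
      by (rule L2_set_triangle_ineq)
    also have "\<dots> \<le> nrm v + nrm w"
      by (intro add_mono nrm_upper v w)
    finally show ?thesis .
  qed
  from VcI[OF sb this] show "(\<lambda>i. v i + w i) \<in> Vc" "nrm (\<lambda>i. v i + w i) \<le> nrm v + nrm w"
    by auto
qed

lemma mult_Vc:
  assumes v: "v \<in> Vc"
  shows "(\<lambda>i. r * v i) \<in> Vc" "nrm (\<lambda>i. r * v i) = \<bar>r\<bar> * nrm v"
proof -
  have le: "(\<lambda>i. r * v i) \<in> Vc \<and> nrm (\<lambda>i. r * v i) \<le> \<bar>r\<bar> * nrm v" if v: "v \<in> Vc" for r v
  proof -
    have "L2_set (\<lambda>n. N n (\<lambda>i. r * v i)) {..<k} \<le> \<bar>r\<bar> * nrm v" for k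
      using nrm_upper[OF v, of k]
      by (simp add: N_mult[OF Vc_bounded[OF v]] mult_left_mono flip: L2_set_right_distrib)
    from VcI[OF bounded_functions_mult[OF Vc_bounded[OF v]] this] show ?thesis by auto
  qed
  then show *: "(\<lambda>i. r * v i) \<in> Vc" using v by simp
  show "nrm (\<lambda>i. r * v i) = \<bar>r\<bar> * nrm v"
  proof (cases "r = 0")
    case False
    have "nrm (\<lambda>i. inverse r * (r * v i)) \<le> \<bar>inverse r\<bar> * nrm (\<lambda>i. r * v i)"
      using le[OF *] by blast
    then have "\<bar>r\<bar> * nrm v \<le> nrm (\<lambda>i. r * v i)"
      using False by (simp add: mult.assoc[symmetric] field_simps)
    then show ?thesis using le[OF v, of r] by simp
  qed (simp add: zero_Vc)
qed

lemma diff_Vc: "v \<in> Vc \<Longrightarrow> w \<in> Vc \<Longrightarrow> (\<lambda>i. v i - w i) \<in> Vc"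
  using add_Vc(1)[OF _ mult_Vc(1), of v w "-1"] by simp

text \<open>By \<open>N_point\<close> each gauge is at least
  \<open>\<bar>v i\<bar> / (a n + b n)\<close>. Summing squares gives the constant exactly 1 by
  \<open>ab_sums\<close>.\<close>

lemma point_le_nrm:
  assumes v: "v \<in> Vc"
  shows "\<bar>v i\<bar> \<le> nrm v"
proof -
  have "\<bar>v i\<bar> * sqrt (\<Sum>n<k. (1 / (a n + b n))\<^sup>2) \<le> nrm v" for k
  proof -
    have "\<bar>v i\<bar> * sqrt (\<Sum>n<k. (1 / (a n + b n))\<^sup>2) = L2_set (\<lambda>n. \<bar>v i\<bar> * (1 / (a n + b n))) {..<k}"
      unfolding L2_set_def[symmetric] by (rule L2_set_right_distrib) simp
    also have "\<dots> \<le> L2_set (\<lambda>n. N n v) {..<k}"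
      using N_point[OF Vc_bounded[OF v], of i] ab_pos
      by (intro L2_set_mono) (auto simp: field_simps less_imp_le)
    also have "\<dots> \<le> nrm v" by (rule nrm_upper[OF v])
    finally show ?thesis .
  qed
  moreover have "(\<lambda>k. \<bar>v i\<bar> * sqrt (\<Sum>n<k. (1 / (a n + b n))\<^sup>2)) \<longlonglongrightarrow> \<bar>v i\<bar> * sqrt 1"
    using ab_sums unfolding sums_def by (intro tendsto_intros)
  ultimately have "\<bar>v i\<bar> * sqrt 1 \<le> nrm v"
    by (intro LIMSEQ_le_const2) auto
  then show ?thesis by simp
qed

lemma C_Vc:
  assumes c: "c \<in> C"
  shows "c \<in> Vc" "nrm c \<le> 1"
proof -
  have cb: "c \<in> bounded_functions UNIV"
    using C_le_1[OF c] by (intro bounded_functionsI)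
  have "L2_set (\<lambda>n. N n c) {..<k} \<le> 1" for k
  proof -
    have "L2_set (\<lambda>n. N n c) {..<k} \<le> L2_set (\<lambda>n. 1 / (a n + b n)) {..<k}"
      by (intro L2_set_mono N_C[OF c] N_nonneg cb)
    also have "\<dots> \<le> sqrt 1"
      unfolding L2_set_def
      using sum_le_suminf[OF sums_summable[OF ab_sums], of "{..<k}"] sums_unique[OF ab_sums] by simp
    finally show ?thesis by simp
  qed
  from VcI[OF cb this] show "c \<in> Vc" "nrm c \<le> 1" by auto
qed

lemma V_simps [simp]: "carrier V = Vc" "\<zero>\<^bsub>V\<^esub> = (\<lambda>i. 0)" "f \<oplus>\<^bsub>V\<^esub> g = (\<lambda>i. f i + g i)"
  "r \<odot>\<^bsub>V\<^esub> f = (\<lambda>i. r * f i)" "vnorm V = nrm"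
  by (simp_all add: V_def)

lemma nrm_zero_imp: "v \<in> Vc \<Longrightarrow> nrm v = 0 \<Longrightarrow> v = (\<lambda>i. 0)"
  using point_le_nrm by fastforce

lemma real_normed_space_V: "real_normed_space V"
proof -
  have "abelian_group V"
  proof (rule abelian_groupI)
    show "\<exists>y\<in>carrier V. y \<oplus>\<^bsub>V\<^esub> x = \<zero>\<^bsub>V\<^esub>" if "x \<in> carrier V" for x
      using that mult_Vc(1)[of x "-1"] by (intro bexI[of _ "\<lambda>i. - x i"]) auto
  qed (auto simp: add_Vc zero_Vc add_ac)
  then have "Module.module (ring_of_type_algebra :: real ring) V"
    by (intro moduleI cring_from_type_algebra)
      (auto simp: mult_Vc ring_of_type_algebra_def algebra_simps)
  then show ?thesis
    unfolding real_normed_space_def real_normed_space_axioms_def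
    by (simp add: mult_Vc(2) add_Vc(2)) (use nrm_zero_imp in blast)
qed

lemma minus_V: "v \<in> Vc \<Longrightarrow> w \<in> Vc \<Longrightarrow> v \<ominus>\<^bsub>V\<^esub> w = (\<lambda>i. v i - w i)"
proof -
  interpret real_normed_space V by (rule real_normed_space_V)
  assume w: "w \<in> Vc" and "v \<in> Vc"
  have "\<ominus>\<^bsub>V\<^esub> w = (\<lambda>i. - w i)"
    using w mult_Vc(1)[OF w, of "-1"] by (intro vs.M.minus_equality) auto
  then show ?thesis by (simp add: a_minus_def)
qed

lemma mdist_V: "v \<in> Vc \<Longrightarrow> w \<in> Vc \<Longrightarrow> mdist (norm_metric V) v w = nrm (\<lambda>i. v i - w i)"
  using real_normed_space.mdist_norm_metric[OF real_normed_space_V, of v w] by (simp add: minus_V)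

lemma mspace_V: "mspace (norm_metric V) = Vc"
  using real_normed_space.mspace_norm_metric[OF real_normed_space_V] by simp

text \<open>By \<open>point_le_nrm\<close> a Cauchy sequence converges uniformly. Each finite
  partial sum of the norm is continuous under uniform convergence, so the Cauchy estimates pass to
  the limit function.\<close>

lemma banach_space_V: "banach_space V"
proof -
  note MV = Metric_space_mspace_mdist[of "norm_metric V"]
  have "\<exists>v. limitin (Metric_space.mtopology (mspace (norm_metric V)) (mdist (norm_metric V))) \<sigma> v sequentially"
    if \<sigma>: "Metric_space.MCauchy (mspace (norm_metric V)) (mdist (norm_metric V)) \<sigma>" for \<sigma>
  proof -
    have \<sigma>': "range \<sigma> \<subseteq> mspace (norm_metric V)"
        "\<And>e. 0 < e \<Longrightarrow> \<exists>K. \<forall>k l. K \<le> k \<longrightarrow> K \<le> l \<longrightarrow> mdist (norm_metric V) (\<sigma> k) (\<sigma> l) < e"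
      using \<sigma> unfolding Metric_space.MCauchy_def[OF MV] by blast+
    have \<sigma>V: "\<sigma> k \<in> Vc" for k using \<sigma>'(1) unfolding mspace_V by blast
    note \<sigma>b = Vc_bounded[OF \<sigma>V]
    have pt: "\<bar>\<sigma> k i - \<sigma> l i\<bar> \<le> nrm (\<lambda>i. \<sigma> k i - \<sigma> l i)" for k l i
      by (rule point_le_nrm[OF diff_Vc[OF \<sigma>V \<sigma>V]])
    have L2: "L2_set (\<lambda>n. N n (\<lambda>i. \<sigma> k i - \<sigma> l i)) {..<m} \<le> nrm (\<lambda>i. \<sigma> k i - \<sigma> l i)" for k l m
      by (rule nrm_upper[OF diff_Vc[OF \<sigma>V \<sigma>V]])
    have cau: "\<exists>K. \<forall>k\<ge>K. \<forall>l\<ge>K. nrm (\<lambda>i. \<sigma> k i - \<sigma> l i) < e" if "e > 0" for e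
      using \<sigma>'(2)[OF that] by (simp add: mdist_V \<sigma>V)
    have "Cauchy (\<lambda>k. \<sigma> k i)" for i
    proof (rule metric_CauchyI)
      fix e :: real assume "e > 0"
      then obtain K where K: "\<forall>k\<ge>K. \<forall>l\<ge>K. nrm (\<lambda>i. \<sigma> k i - \<sigma> l i) < e" using cau by blast
      have "\<bar>\<sigma> k i - \<sigma> l i\<bar> < e" if "k \<ge> K" "l \<ge> K" for k l
        using K that pt[of k i l] by (meson le_less_trans)
      then show "\<exists>M. \<forall>m\<ge>M. \<forall>n\<ge>M. dist (\<sigma> m i) (\<sigma> n i) < e"
        by (auto simp: dist_real_def)
    qed
    then have "\<exists>x. (\<lambda>k. \<sigma> k i) \<longlonglongrightarrow> x" for i
      using Cauchy_convergent convergent_def by blast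
    then obtain v where v: "\<And>i. (\<lambda>k. \<sigma> k i) \<longlonglongrightarrow> v i" by metis
    have unif: "\<bar>\<sigma> k i - v i\<bar> \<le> e"
      if K: "\<forall>k\<ge>K. \<forall>l\<ge>K. nrm (\<lambda>i. \<sigma> k i - \<sigma> l i) < e" and k: "K \<le> k" for k i K e
    proof (rule LIMSEQ_le_const2)
      show "(\<lambda>l. \<bar>\<sigma> k i - \<sigma> l i\<bar>) \<longlonglongrightarrow> \<bar>\<sigma> k i - v i\<bar>" by (intro tendsto_intros v)
      show "\<exists>M. \<forall>l\<ge>M. \<bar>\<sigma> k i - \<sigma> l i\<bar> \<le> e"
        using K k pt[of k i] by (meson less_imp_le order_trans)
    qed
    have vb: "v \<in> bounded_functions UNIV"
    proof -
      obtain K where K: "\<forall>k\<ge>K. \<forall>l\<ge>K. nrm (\<lambda>i. \<sigma> k i - \<sigma> l i) < 1" using cau[of 1] by auto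
      have "(\<lambda>i. \<sigma> K i - v i) \<in> bounded_functions UNIV"
        using unif[OF K order_refl] by (intro bounded_functionsI)
      from bounded_functions_diff[OF \<sigma>b[of K] this] show ?thesis by simp
    qed
    \<comment> \<open>Each gauge is dominated by the supremum norm, with a constant
      \<open>1 / b n\<close> that depends on \<open>n\<close>; therefore only finite partial sums
      pass to the limit.\<close>
    have N_lim: "(\<lambda>l. N n (\<lambda>i. \<sigma> k i - \<sigma> l i)) \<longlonglongrightarrow> N n (\<lambda>i. \<sigma> k i - v i)" for n k
    proof (rule LIMSEQ_I)
      fix e :: real assume e: "e > 0"
      then obtain K where K: "\<forall>k\<ge>K. \<forall>l\<ge>K. nrm (\<lambda>i. \<sigma> k i - \<sigma> l i) < e * b n / 2"
        using cau[of "e * b n / 2"] b_pos[of n] by auto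
      have "\<bar>N n (\<lambda>i. \<sigma> k i - \<sigma> l i) - N n (\<lambda>i. \<sigma> k i - v i)\<bar> < e" if l: "l \<ge> K" for l
      proof -
        have "\<bar>N n (\<lambda>i. \<sigma> k i - \<sigma> l i) - N n (\<lambda>i. \<sigma> k i - v i)\<bar>
            \<le> N n (\<lambda>i. (\<sigma> k i - \<sigma> l i) - (\<sigma> k i - v i))"
          by (intro N_diff_abs bounded_functions_diff \<sigma>b vb)
        also have "\<dots> \<le> (e * b n / 2) / b n"
          using unif[OF K l] e b_pos[of n]
          by (intro N_le_sup) (auto simp: abs_minus_commute)
        also have "\<dots> < e" using e b_pos[of n] by (simp add: field_simps)
        finally show ?thesis .
      qed
      then show "\<exists>L. \<forall>l\<ge>L. norm (N n (\<lambda>i. \<sigma> k i - \<sigma> l i) - N n (\<lambda>i. \<sigma> k i - v i)) < e"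
        by auto
    qed
    have close: "(\<lambda>i. \<sigma> k i - v i) \<in> Vc \<and> nrm (\<lambda>i. \<sigma> k i - v i) \<le> e"
      if K: "\<forall>k\<ge>K. \<forall>l\<ge>K. nrm (\<lambda>i. \<sigma> k i - \<sigma> l i) < e" and k: "K \<le> k" for k K e
    proof -
      have "L2_set (\<lambda>n. N n (\<lambda>i. \<sigma> k i - v i)) {..<m} \<le> e" for m
      proof (rule LIMSEQ_le_const2)
        show "(\<lambda>l. L2_set (\<lambda>n. N n (\<lambda>i. \<sigma> k i - \<sigma> l i)) {..<m})
            \<longlonglongrightarrow> L2_set (\<lambda>n. N n (\<lambda>i. \<sigma> k i - v i)) {..<m}"
          unfolding L2_set_def by (intro tendsto_intros N_lim)
        show "\<exists>M. \<forall>l\<ge>M. L2_set (\<lambda>n. N n (\<lambda>i. \<sigma> k i - \<sigma> l i)) {..<m} \<le> e"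
          using K k L2[of k _ m] by (meson less_imp_le order_trans)
      qed
      from VcI[OF bounded_functions_diff[OF \<sigma>b vb] this] show ?thesis by simp
    qed
    have vV: "v \<in> Vc"
    proof -
      obtain K where "\<forall>k\<ge>K. \<forall>l\<ge>K. nrm (\<lambda>i. \<sigma> k i - \<sigma> l i) < 1" using cau[of 1] by auto
      from diff_Vc[OF \<sigma>V[of K]] close[OF this order_refl] show ?thesis by fastforce
    qed
    have conv: "\<exists>K. \<forall>k\<ge>K. \<sigma> k \<in> Vc \<and> mdist (norm_metric V) (\<sigma> k) v < e" if e: "e > 0" for e
    proof -
      obtain K where "\<forall>k\<ge>K. \<forall>l\<ge>K. nrm (\<lambda>i. \<sigma> k i - \<sigma> l i) < e / 2" using cau[of "e / 2"] e by auto
      from close[OF this] show ?thesis using e \<sigma>V vV by (force simp: mdist_V)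
    qed
    have "limitin (Metric_space.mtopology (mspace (norm_metric V)) (mdist (norm_metric V))) \<sigma> v sequentially"
      unfolding Metric_space.limit_metric_sequentially[OF MV] unfolding mspace_V
      by (rule conjI[OF vV]) (intro allI impI conv)
    then show ?thesis by (rule exI[of _ v])
  qed
  then show ?thesis
    using real_normed_space_V by (simp add: banach_space_def mcomplete_of_def Metric_space.mcomplete_def[OF MV])
qed

section \<open>The dual of \<open>V\<close>: density of the finitely supported functionals, and
  reflexivity\<close>

abbreviation D where "D \<equiv> dual_space V"

lemma in_dual_iff:
  "\<phi> \<in> carrier D \<longleftrightarrow> \<phi> \<in> extensional Vc \<and>
     (\<forall>v\<in>Vc. \<forall>w\<in>Vc. \<phi> (\<lambda>i. v i + w i) = \<phi> v + \<phi> w) \<and>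
     (\<forall>r. \<forall>v\<in>Vc. \<phi> (\<lambda>i. r * v i) = r * \<phi> v) \<and> (\<exists>B. \<forall>v\<in>Vc. \<bar>\<phi> v\<bar> \<le> B * nrm v)"
  by (simp add: dual_space_def)

lemma dual_add: "\<phi> \<in> carrier D \<Longrightarrow> v \<in> Vc \<Longrightarrow> w \<in> Vc \<Longrightarrow> \<phi> (\<lambda>i. v i + w i) = \<phi> v + \<phi> w"
  and dual_mult: "\<phi> \<in> carrier D \<Longrightarrow> v \<in> Vc \<Longrightarrow> \<phi> (\<lambda>i. r * v i) = r * \<phi> v"
  by (auto simp: in_dual_iff)

lemma dual_zero: "\<phi> \<in> carrier D \<Longrightarrow> \<phi> (\<lambda>i. 0) = 0"
  using dual_mult[OF _ zero_Vc(1), of \<phi> 0] by simp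

lemma dual_bound:
  assumes "\<phi> \<in> carrier D"
  obtains B where "0 \<le> B" "\<And>v. v \<in> Vc \<Longrightarrow> \<bar>\<phi> v\<bar> \<le> B * nrm v"
proof -
  obtain B where "\<forall>v\<in>Vc. \<bar>\<phi> v\<bar> \<le> B * nrm v" using assms by (auto simp: in_dual_iff)
  moreover have "B * nrm v \<le> \<bar>B\<bar> * nrm v" if "v \<in> Vc" for v
    using nrm_nonneg[OF that] by (intro mult_right_mono) auto
  ultimately show ?thesis using that[of "\<bar>B\<bar>"] by (meson abs_ge_zero order_trans)
qed

lemma dual_ops [simp]:
  "\<phi> \<oplus>\<^bsub>D\<^esub> \<psi> = (\<lambda>x\<in>Vc. \<phi> x + \<psi> x)" "r \<odot>\<^bsub>D\<^esub> \<phi> = (\<lambda>x\<in>Vc. r * \<phi> x)"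
  by (simp_all add: dual_space_def)

lemma vnorm_dual: "vnorm D \<phi> = Sup {\<bar>\<phi> x\<bar> | x. x \<in> Vc \<and> nrm x \<le> 1}"
  by (simp add: dual_space_def)

lemma vnorm_dual_le:
  assumes "0 \<le> r" "\<And>v. v \<in> Vc \<Longrightarrow> \<bar>\<phi> v\<bar> \<le> r * nrm v"
  shows "vnorm D \<phi> \<le> r"
  unfolding vnorm_dual
proof (rule cSup_least)
  show "{\<bar>\<phi> x\<bar> | x. x \<in> Vc \<and> nrm x \<le> 1} \<noteq> {}" using zero_Vc by force
  fix y assume "y \<in> {\<bar>\<phi> x\<bar> | x. x \<in> Vc \<and> nrm x \<le> 1}"
  then obtain x where x: "x \<in> Vc" "nrm x \<le> 1" "y = \<bar>\<phi> x\<bar>" by blast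
  have "r * nrm x \<le> r * 1" using assms(1) x(2) by (intro mult_left_mono)
  then show "y \<le> r" using assms(2)[OF x(1)] x(3) by simp
qed

lemma dual_le_vnorm:
  assumes \<phi>: "\<phi> \<in> carrier D" and v: "v \<in> Vc"
  shows "\<bar>\<phi> v\<bar> \<le> vnorm D \<phi> * nrm v"
proof (cases "nrm v = 0")
  case True
  then show ?thesis using nrm_zero_imp[OF v] dual_zero[OF \<phi>] by simp
next
  case False
  then have pos: "0 < nrm v" using nrm_nonneg[OF v] by simp
  obtain B where B: "0 \<le> B" "\<And>v. v \<in> Vc \<Longrightarrow> \<bar>\<phi> v\<bar> \<le> B * nrm v" using \<phi> by (rule dual_bound) blast
  define w where "w = (\<lambda>i. inverse (nrm v) * v i)"
  have w: "w \<in> Vc" "nrm w \<le> 1" using mult_Vc[OF v, of "inverse (nrm v)"] pos by (simp_all add: w_def)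
  have "\<bar>\<phi> w\<bar> \<le> vnorm D \<phi>"
    unfolding vnorm_dual
  proof (rule cSup_upper)
    show "\<bar>\<phi> w\<bar> \<in> {\<bar>\<phi> x\<bar> | x. x \<in> Vc \<and> nrm x \<le> 1}" using w by blast
    have "\<bar>\<phi> x\<bar> \<le> B" if "x \<in> Vc" "nrm x \<le> 1" for x
      using B(2)[OF that(1)] mult_left_mono[OF that(2) B(1)] by simp
    then show "bdd_above {\<bar>\<phi> x\<bar> | x. x \<in> Vc \<and> nrm x \<le> 1}" by (intro bdd_aboveI[of _ B]) blast
  qed
  moreover have "\<phi> w = inverse (nrm v) * \<phi> v" unfolding w_def by (rule dual_mult[OF \<phi> v])
  ultimately show ?thesis using pos by (simp add: abs_mult field_simps)
qed

lemma L2_set_mult_le: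
  assumes v: "v \<in> bounded_functions UNIV" and w: "w \<in> Vc"
  shows "(\<Sum>n<k. N n v * N n w) \<le> L2_set (\<lambda>n. N n v) {..<k} * nrm w"
proof -
  have "(\<Sum>n<k. N n v * N n w) = (\<Sum>n<k. \<bar>N n v\<bar> * \<bar>N n w\<bar>)"
    using N_nonneg[OF v] N_nonneg[OF Vc_bounded[OF w]] by (intro sum.cong) auto
  also have "\<dots> \<le> L2_set (\<lambda>n. N n v) {..<k} * L2_set (\<lambda>n. N n w) {..<k}"
    by (rule L2_set_mult_ineq)
  also have "\<dots> \<le> L2_set (\<lambda>n. N n v) {..<k} * nrm w"
    by (intro mult_left_mono nrm_upper w) simp
  finally show ?thesis .
qed

text \<open>
  A uniformly small element \<open>w\<close> of the unit ball has small gauges \<open>N n w\<close> for the finitely many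
  \<open>n\<close> that carry almost all the norm of a given \<open>v\<close>, so it is almost orthogonal to \<open>v\<close>
  in the \<open>\<ell>\<^sub>2\<close>-sum. If \<open>v\<close> almost attains the norm of \<open>\<phi>\<close>, comparing \<open>\<phi> (v + t w)\<close> with
  \<open>\<parallel>v + t w\<parallel> \<le> 1 + t \<eta> + t\<^sup>2 / 2\<close> shows that \<open>\<phi> w\<close> is small.
\<close>

lemma dual_small_on_uniformly_small:
  assumes \<phi>: "\<phi> \<in> carrier D" and \<epsilon>: "\<epsilon> > 0"
  shows "\<exists>\<kappa>>0. \<forall>w\<in>Vc. nrm w \<le> 1 \<longrightarrow> (\<forall>i. \<bar>w i\<bar> \<le> \<kappa>) \<longrightarrow> \<phi> w \<le> \<epsilon>"
proof -
  define \<beta> where "\<beta> = vnorm D \<phi>"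
  have \<phi>\<beta>: "\<phi> v \<le> \<beta> * nrm v" if "v \<in> Vc" for v
    using dual_le_vnorm[OF \<phi> that] by (simp add: \<beta>_def)
  have \<beta>0: "0 \<le> \<beta>"
  proof -
    have "\<bar>\<phi> (\<lambda>i. 0)\<bar> \<le> \<beta>"
      unfolding \<beta>_def vnorm_dual
    proof (rule cSup_upper)
      show "\<bar>\<phi> (\<lambda>i. 0)\<bar> \<in> {\<bar>\<phi> x\<bar> | x. x \<in> Vc \<and> nrm x \<le> 1}" using zero_Vc by force
      obtain B where B: "0 \<le> B" "\<And>v. v \<in> Vc \<Longrightarrow> \<bar>\<phi> v\<bar> \<le> B * nrm v" using \<phi> by (rule dual_bound) blast
      have "\<bar>\<phi> x\<bar> \<le> B" if "x \<in> Vc" "nrm x \<le> 1" for x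
        using B(2)[OF that(1)] mult_left_mono[OF that(2) B(1)] by simp
      then show "bdd_above {\<bar>\<phi> x\<bar> | x. x \<in> Vc \<and> nrm x \<le> 1}" by (intro bdd_aboveI[of _ B]) blast
    qed
    then show ?thesis by linarith
  qed
  \<comment> \<open>The constants make each of the final error terms \<open>\<delta>\<close>,
    \<open>t * (\<beta> * \<eta>)\<close> and \<open>t * (\<beta> * t / 2)\<close> at most a quarter
    of \<open>t * \<epsilon>\<close>.\<close>
  define t where "t = \<epsilon> / (2 * (\<beta> + 1))"
  define \<eta> where "\<eta> = \<epsilon> / (4 * (\<beta> + 1))"
  have t: "0 < t" "\<beta> * t \<le> \<epsilon> / 2" and \<eta>: "0 < \<eta>" "\<beta> * \<eta> \<le> \<epsilon> / 4"
    using \<epsilon> \<beta>0 by (auto simp: t_def \<eta>_def field_simps)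
  define \<delta> where "\<delta> = \<epsilon> * t / 4"
  have \<delta>: "0 < \<delta>" using \<epsilon> t by (simp add: \<delta>_def)
  obtain v where v: "v \<in> Vc" "nrm v \<le> 1" "\<beta> - \<delta> \<le> \<phi> v"
  proof -
    have "\<beta> - \<delta> < Sup {\<bar>\<phi> x\<bar> | x. x \<in> Vc \<and> nrm x \<le> 1}"
      using \<delta> by (simp add: \<beta>_def vnorm_dual)
    then obtain x where x: "x \<in> Vc" "nrm x \<le> 1" "\<beta> - \<delta> < \<bar>\<phi> x\<bar>"
      using less_cSupE[of "\<beta> - \<delta>" "{\<bar>\<phi> x\<bar> | x. x \<in> Vc \<and> nrm x \<le> 1}"] zero_Vc by force
    show ?thesis
    proof (cases "0 \<le> \<phi> x")
      case True then show ?thesis using that x by force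
    next
      case False
      then show ?thesis
        using that[of "\<lambda>i. - 1 * x i"] mult_Vc[OF x(1), of "-1"] dual_mult[OF \<phi> x(1), of "-1"] x by force
    qed
  qed
  note vb = Vc_bounded[OF v(1)]
  \<comment> \<open>Convergence of \<open>T\<close> yields \<open>k0\<close> beyond which the gauges
    of \<open>v\<close> have \<open>\<ell>\<^sub>2\<close>-norm at most \<open>\<eta> / 2\<close>,
    and Cauchy-Schwarz handles the cross terms there. Below \<open>k0\<close> the bound
    \<open>\<kappa> / b n\<close> on the gauges of \<open>w\<close> is used, and \<open>H\<close>
    collects the resulting factors.\<close>
  define T where "T k = (\<Sum>n<k. (N n v)\<^sup>2)" for k
  have "incseq T" by (auto simp: T_def incseq_def intro!: sum_mono2)
  have T1: "T k \<le> 1" for k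
  proof -
    have "sqrt (T k) \<le> 1" using order_trans[OF nrm_upper[OF v(1)] v(2)] unfolding T_def L2_set_def .
    then show ?thesis by simp
  qed
  obtain l where "T \<longlonglongrightarrow> l" using incseq_convergent[OF \<open>incseq T\<close>, of 1] T1 by metis
  then have "Cauchy T" by (rule LIMSEQ_imp_Cauchy)
  then obtain k0 where k0: "\<And>k. k \<ge> k0 \<Longrightarrow> \<bar>T k - T k0\<bar> < (\<eta> / 2)\<^sup>2"
    using \<eta>(1) unfolding Cauchy_def dist_real_def by (metis half_gt_zero order_refl zero_less_power)
  define H where "H = (\<Sum>n<k0. N n v / b n)"
  have H: "0 \<le> H"
    unfolding H_def using N_nonneg[OF vb] b_pos by (intro sum_nonneg divide_nonneg_pos)
  define \<kappa> where "\<kappa> = \<eta> / (2 * (H + 1))"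
  have \<kappa>: "0 < \<kappa>" "\<kappa> * H \<le> \<eta> / 2" using \<eta>(1) H by (auto simp: \<kappa>_def field_simps)
  have "\<phi> w \<le> \<epsilon>" if w: "w \<in> Vc" "nrm w \<le> 1" "\<forall>i. \<bar>w i\<bar> \<le> \<kappa>" for w
  proof -
    note wb = Vc_bounded[OF w(1)]
    have cross: "(\<Sum>n<k. N n v * N n w) \<le> \<eta>" if "k0 \<le> k" for k
    proof -
      have split: "{..<k} = {..<k0} \<union> {k0..<k}" using that by auto
      have "(\<Sum>n<k0. N n v * N n w) \<le> (\<Sum>n<k0. \<kappa> * (N n v / b n))"
      proof (rule sum_mono)
        fix n
        have "N n w \<le> \<kappa> / b n" using w(3) \<kappa>(1) by (intro N_le_sup) auto
        then have "N n v * N n w \<le> N n v * (\<kappa> / b n)" using N_nonneg[OF vb] by (rule mult_left_mono)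
        then show "N n v * N n w \<le> \<kappa> * (N n v / b n)" by (simp add: mult.commute)
      qed
      also have "\<dots> = \<kappa> * H" by (simp add: H_def sum_distrib_left)
      finally have 1: "(\<Sum>n<k0. N n v * N n w) \<le> \<eta> / 2" using \<kappa>(2) by simp
      have "(\<Sum>n\<in>{k0..<k}. N n v * N n w) = (\<Sum>n\<in>{k0..<k}. \<bar>N n v\<bar> * \<bar>N n w\<bar>)"
        using N_nonneg[OF vb] N_nonneg[OF wb] by (intro sum.cong) auto
      also have "\<dots> \<le> L2_set (\<lambda>n. N n v) {k0..<k} * L2_set (\<lambda>n. N n w) {k0..<k}"
        by (rule L2_set_mult_ineq)
      also have "\<dots> \<le> (\<eta> / 2) * 1"
      proof (intro mult_mono)
        have "(\<Sum>n\<in>{k0..<k}. (N n v)\<^sup>2) = T k - T k0"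
          unfolding T_def split by (subst sum.union_disjoint) auto
        then have "sqrt (\<Sum>n\<in>{k0..<k}. (N n v)\<^sup>2) \<le> sqrt ((\<eta> / 2)\<^sup>2)"
          using k0[OF that] by (intro real_sqrt_le_mono) simp
        then show "L2_set (\<lambda>n. N n v) {k0..<k} \<le> \<eta> / 2" using \<eta>(1) by (simp add: L2_set_def)
        have "L2_set (\<lambda>n. N n w) {k0..<k} \<le> L2_set (\<lambda>n. N n w) {..<k}"
          unfolding L2_set_def by (intro real_sqrt_le_mono sum_mono2) auto
        also have "\<dots> \<le> 1" using nrm_upper[OF w(1), of k] w(2) by simp
        finally show "L2_set (\<lambda>n. N n w) {k0..<k} \<le> 1" .
      qed (use \<eta>(1) in auto)
      finally have 2: "(\<Sum>n\<in>{k0..<k}. N n v * N n w) \<le> \<eta> / 2" by simp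
      have "(\<Sum>n<k. N n v * N n w) = (\<Sum>n<k0. N n v * N n w) + (\<Sum>n\<in>{k0..<k}. N n v * N n w)"
        unfolding split by (subst sum.union_disjoint) auto
      then show ?thesis using 1 2 by simp
    qed
    have cross': "(\<Sum>n<k. N n v * N n w) \<le> \<eta>" for k
    proof -
      have "(\<Sum>n<k. N n v * N n w) \<le> (\<Sum>n<max k k0. N n v * N n w)"
        using N_nonneg[OF vb] N_nonneg[OF wb] by (intro sum_mono2) auto
      also have "\<dots> \<le> \<eta>" by (rule cross) simp
      finally show ?thesis .
    qed
    define u where "u = (\<lambda>i. v i + t * w i)"
    have tw: "(\<lambda>i. t * w i) \<in> Vc" by (rule mult_Vc(1)[OF w(1)])
    have uV: "u \<in> Vc" unfolding u_def by (rule add_Vc(1)[OF v(1) tw])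
    have "nrm u \<le> 1 + t * \<eta> + t\<^sup>2 / 2"
    proof (rule nrm_least)
      fix k
      have Nu: "N n u \<le> N n v + t * N n w" for n
        using N_add[OF vb Vc_bounded[OF tw], of n] N_mult[OF wb, of n t] t(1) by (simp add: u_def)
      have "(\<Sum>n<k. (N n u)\<^sup>2) \<le> (\<Sum>n<k. (N n v + t * N n w)\<^sup>2)"
        using Nu N_nonneg[OF Vc_bounded[OF uV]] by (intro sum_mono power_mono)
      also have "\<dots> = T k + 2 * t * (\<Sum>n<k. N n v * N n w) + t\<^sup>2 * (\<Sum>n<k. (N n w)\<^sup>2)"
        by (simp add: T_def power2_sum power_mult_distrib sum.distrib sum_distrib_left mult_ac)
      also have "\<dots> \<le> 1 + 2 * t * \<eta> + t\<^sup>2 * 1"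
      proof (intro add_mono mult_left_mono T1 cross')
        have "sqrt (\<Sum>n<k. (N n w)\<^sup>2) \<le> 1"
          using order_trans[OF nrm_upper[OF w(1)] w(2)] unfolding L2_set_def .
        then show "(\<Sum>n<k. (N n w)\<^sup>2) \<le> 1" by simp
      qed (use t(1) in auto)
      \<comment> \<open>The extra term completes the square, so that the root can be taken.\<close>
      also have "\<dots> \<le> 1 + 2 * t * \<eta> + t\<^sup>2 * 1 + (t * \<eta> + t\<^sup>2 / 2)\<^sup>2" by simp
      also have "\<dots> = (1 + t * \<eta> + t\<^sup>2 / 2)\<^sup>2"
        by (simp add: power2_eq_square algebra_simps)
      finally have "sqrt (\<Sum>n<k. (N n u)\<^sup>2) \<le> sqrt ((1 + t * \<eta> + t\<^sup>2 / 2)\<^sup>2)"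
        by (rule real_sqrt_le_mono)
      then show "L2_set (\<lambda>n. N n u) {..<k} \<le> 1 + t * \<eta> + t\<^sup>2 / 2"
        using t(1) \<eta>(1) by (simp add: L2_set_def)
    qed
    then have "\<phi> u \<le> \<beta> * (1 + t * \<eta> + t\<^sup>2 / 2)"
      using \<phi>\<beta>[OF uV] \<beta>0 by (meson mult_left_mono order_trans)
    moreover have "\<phi> u = \<phi> v + t * \<phi> w"
      unfolding u_def using dual_add[OF \<phi> v(1) tw] dual_mult[OF \<phi> w(1)] by simp
    ultimately have "t * \<phi> w \<le> \<delta> + t * (\<beta> * \<eta>) + t * (\<beta> * t / 2)"
      using v(3) by (simp add: algebra_simps power2_eq_square)
    also have "\<dots> \<le> \<epsilon> * t / 4 + t * (\<epsilon> / 4) + t * (\<epsilon> / 4)"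
      unfolding \<delta>_def using t \<eta> by (intro add_mono mult_left_mono) auto
    also have "\<dots> \<le> t * \<epsilon>" using t(1) \<epsilon> by (simp add: algebra_simps)
    finally show ?thesis using t(1) by simp
  qed
  then show ?thesis using \<kappa>(1) by blast
qed

text \<open>If \<open>v\<close> is uniformly small relative to its norm, the previous estimate gives
  the first term. Otherwise \<open>nrm v\<close> is at most
  \<open>supnorm UNIV v / \<kappa>\<close>, and boundedness of \<open>\<phi>\<close> gives the
  second.\<close>

lemma dual_le_nrm_plus_supnorm:
  assumes \<phi>: "\<phi> \<in> carrier D" and \<epsilon>: "\<epsilon> > 0"
  shows "\<exists>L\<ge>0. \<forall>v\<in>Vc. \<phi> v \<le> \<epsilon> * nrm v + L * supnorm UNIV v"
proof -
  obtain \<kappa> where \<kappa>: "0 < \<kappa>" "\<And>w. w \<in> Vc \<Longrightarrow> nrm w \<le> 1 \<Longrightarrow> \<forall>i. \<bar>w i\<bar> \<le> \<kappa> \<Longrightarrow> \<phi> w \<le> \<epsilon>"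
    using dual_small_on_uniformly_small[OF assms] by blast
  obtain B where B: "0 \<le> B" "\<And>v. v \<in> Vc \<Longrightarrow> \<bar>\<phi> v\<bar> \<le> B * nrm v" using \<phi> by (rule dual_bound) blast
  have "\<phi> v \<le> \<epsilon> * nrm v + B / \<kappa> * supnorm UNIV v" if v: "v \<in> Vc" for v
  proof (cases "nrm v = 0")
    case True
    then have "v = (\<lambda>i. 0)" by (rule nrm_zero_imp[OF v])
    then show ?thesis using dual_zero[OF \<phi>] zero_Vc(2) by (simp add: supnorm_def)
  next
    case False
    then have pos: "0 < nrm v" using nrm_nonneg[OF v] by simp
    note s = supnorm_upper[OF Vc_bounded[OF v]]
    have s0: "0 \<le> supnorm UNIV v" by (rule supnorm_nonneg[OF Vc_bounded[OF v]]) simp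
    show ?thesis
    proof (cases "supnorm UNIV v \<le> \<kappa> * nrm v")
      case True
      have "\<phi> (\<lambda>i. inverse (nrm v) * v i) \<le> \<epsilon>"
      proof (rule \<kappa>(2))
        show "(\<lambda>i. inverse (nrm v) * v i) \<in> Vc" "nrm (\<lambda>i. inverse (nrm v) * v i) \<le> 1"
          using mult_Vc[OF v, of "inverse (nrm v)"] pos by simp_all
        show "\<forall>i. \<bar>inverse (nrm v) * v i\<bar> \<le> \<kappa>"
        proof
          fix i
          have "\<bar>v i\<bar> \<le> \<kappa> * nrm v" using s[of i] True by simp
          then show "\<bar>inverse (nrm v) * v i\<bar> \<le> \<kappa>" using pos by (simp add: abs_mult field_simps)
        qed
      qed
      then have "inverse (nrm v) * \<phi> v \<le> \<epsilon>"
        unfolding dual_mult[OF \<phi> v] .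
      then have "\<phi> v \<le> \<epsilon> * nrm v" using pos by (simp add: field_simps)
      moreover have "0 \<le> B / \<kappa> * supnorm UNIV v" using B(1) \<kappa>(1) s0 by simp
      ultimately show ?thesis by linarith
    next
      case False
      then have "B / \<kappa> * (\<kappa> * nrm v) \<le> B / \<kappa> * supnorm UNIV v"
        using B(1) \<kappa>(1) by (intro mult_left_mono) auto
      then have "\<phi> v \<le> B / \<kappa> * supnorm UNIV v" using B(2)[OF v] \<kappa>(1) by simp
      moreover have "0 \<le> \<epsilon> * nrm v" using pos \<epsilon> by simp
      ultimately show ?thesis by linarith
    qed
  qed
  moreover have "0 \<le> B / \<kappa>" using B(1) \<kappa>(1) by simp
  ultimately show ?thesis by blast
qed

text \<open>The preceding bound says that the demands \<open>\<psi> \<le> L * supnorm\<close> on all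
  bounded functions and \<open>\<phi> - \<epsilon> * nrm \<le> \<psi>\<close> on \<open>Vc\<close>
  are compatible, so the sandwich theorem gives \<open>\<psi>\<close>. Applying the lower bound to
  \<open>- v\<close> as well makes it two-sided.\<close>

lemma ex_bounded_functional_near_dual:
  assumes \<phi>: "\<phi> \<in> carrier D" and \<epsilon>: "\<epsilon> > 0"
  shows "\<exists>L \<psi>. bounded_functional UNIV L \<psi> \<and> (\<forall>v\<in>Vc. \<bar>\<phi> v - \<psi> v\<bar> \<le> \<epsilon> * nrm v)"
proof -
  obtain L where L: "0 \<le> L" "\<And>v. v \<in> Vc \<Longrightarrow> \<phi> v \<le> \<epsilon> * nrm v + L * supnorm UNIV v"
    using dual_le_nrm_plus_supnorm[OF assms] by blast
  \<comment> \<open>The epigraph of the sublinear function \<open>\<epsilon> * nrm - \<phi>\<close>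
    on \<open>Vc\<close>.\<close>
  define X where "X = {(v, w). v \<in> Vc \<and> \<epsilon> * nrm v - \<phi> v \<le> w}"
  have "\<exists>\<psi>. linear_on_functions (bounded_functions UNIV) \<psi> \<and>
      (\<forall>f\<in>bounded_functions UNIV. \<psi> f \<le> L * supnorm UNIV f) \<and> (\<forall>f w. (f, w) \<in> X \<longrightarrow> - w \<le> \<psi> f)"
  proof (rule Hahn_Banach_sandwich[OF zero_in_bounded_functions bounded_functions_add
        bounded_functions_mult sublinear_supnorm[OF _ L(1)]])
    show "((\<lambda>i. 0), 0) \<in> X" using zero_Vc dual_zero[OF \<phi>] by (simp add: X_def)
    fix f w assume "(f, w) \<in> X"
    then have f: "f \<in> Vc" "\<epsilon> * nrm f - \<phi> f \<le> w" by (auto simp: X_def)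
    show "f \<in> bounded_functions UNIV" by (rule Vc_bounded[OF f(1)])
    show "0 \<le> L * supnorm UNIV f + w" using L(2)[OF f(1)] f(2) by linarith
    show "((\<lambda>i. r * f i), r * w) \<in> X" if "r > 0" for r
    proof -
      have "r * (\<epsilon> * nrm f - \<phi> f) \<le> r * w" using f(2) that by simp
      then show ?thesis using mult_Vc[OF f(1), of r] dual_mult[OF \<phi> f(1)] that
        by (simp add: X_def algebra_simps)
    qed
    show "((\<lambda>i. f i + g i), w + u) \<in> X" if "(g, u) \<in> X" for g u
    proof -
      have g: "g \<in> Vc" "\<epsilon> * nrm g - \<phi> g \<le> u" using that by (auto simp: X_def)
      have "\<epsilon> * nrm (\<lambda>i. f i + g i) \<le> \<epsilon> * (nrm f + nrm g)"
        using add_Vc(2)[OF f(1) g(1)] \<epsilon> by simp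
      then show ?thesis using add_Vc(1)[OF f(1) g(1)] dual_add[OF \<phi> f(1) g(1)] f(2) g(2)
        by (simp add: X_def algebra_simps)
    qed
  qed auto
  then obtain \<psi> where \<psi>: "linear_on_functions (bounded_functions UNIV) \<psi>"
      "\<And>f. f \<in> bounded_functions UNIV \<Longrightarrow> \<psi> f \<le> L * supnorm UNIV f"
      "\<And>f w. (f, w) \<in> X \<Longrightarrow> - w \<le> \<psi> f"
    by blast
  have b\<psi>: "bounded_functional UNIV L \<psi>"
    by (rule bounded_functionalI[OF _ L(1) \<psi>(1,2)]) simp
  have le: "\<phi> v - \<epsilon> * nrm v \<le> \<psi> v" if "v \<in> Vc" for v
    using \<psi>(3)[of v "\<epsilon> * nrm v - \<phi> v"] that by (simp add: X_def)
  have "\<bar>\<phi> v - \<psi> v\<bar> \<le> \<epsilon> * nrm v" if v: "v \<in> Vc" for v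
    using le[OF v] le[OF mult_Vc(1)[OF v, of "-1"]] mult_Vc(2)[OF v, of "-1"]
      dual_mult[OF \<phi> v, of "-1"] bounded_functional_mult[OF b\<psi> Vc_bounded[OF v], of "-1"]
    by (simp add: abs_le_iff)
  then show ?thesis using b\<psi> by blast
qed

text \<open>The gauges only test finitely supported functionals, so \<open>\<psi> - \<zeta>\<close>
  cannot be compared with them directly. For each \<open>v\<close> a second approximation
  \<open>\<zeta>'\<close> of \<open>\<psi>\<close>, good on \<open>C\<close> and at
  \<open>v\<close>, stands in for \<open>\<psi>\<close>. Then \<open>\<zeta>' - \<zeta>\<close> has
  variation at most \<open>2 * L\<close> and is small on \<open>C\<close>, hence lies in
  \<open>\<epsilon>\<close> times the polar: first \<open>b n\<close> is made small to absorb
  \<open>2 * L\<close>, then \<open>e\<close> is fitted to \<open>a n\<close>.\<close>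

lemma ex_fin_functional_near_bounded_functional:
  assumes \<psi>: "bounded_functional UNIV L \<psi>" and \<epsilon>: "\<epsilon> > 0"
  shows "\<exists>\<zeta>\<in>fin_functionals UNIV L. \<forall>v\<in>Vc. \<bar>\<psi> v - \<zeta> v\<bar> \<le> \<epsilon> * nrm v"
proof -
  have L: "0 \<le> L" using \<psi> by (simp add: bounded_functional_def)
  have "eventually (\<lambda>n. b n < \<epsilon> / (4 * (L + 1))) sequentially"
    using \<epsilon> L by (intro order_tendstoD(2)[OF b_null]) simp
  then obtain n where n: "b n < \<epsilon> / (4 * (L + 1))"
    using eventually_happens by fastforce
  have bn: "b n * (2 * L) \<le> \<epsilon> / 2"
  proof -
    have "b n * (2 * L) \<le> \<epsilon> / (4 * (L + 1)) * (2 * L)" using n L by (intro mult_right_mono) auto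
    also have "\<dots> \<le> \<epsilon> / 2" using \<epsilon> L by (simp add: field_simps)
    finally show ?thesis .
  qed
  define e where "e = \<epsilon> / (4 * (a n + 1))"
  have e: "0 < e" "a n * (2 * e) \<le> \<epsilon> / 2"
    using \<epsilon> a_nonneg[of n] by (auto simp: e_def field_simps)
  obtain \<zeta> where \<zeta>: "\<zeta> \<in> fin_functionals UNIV L" "\<And>c. c \<in> C \<Longrightarrow> \<bar>\<psi> c - \<zeta> c\<bar> \<le> e"
    using ex_fin_functional_uniform_approx[OF double_limit_C _ \<psi> e(1), of 1] C_le_1 by blast
  have "\<bar>\<psi> v - \<zeta> v\<bar> \<le> \<epsilon> * nrm v" if v: "v \<in> Vc" for v
  proof (rule field_le_epsilon)
    fix d :: real assume d: "0 < d"
    obtain B where B: "0 \<le> B" "\<And>i. i \<in> UNIV \<Longrightarrow> \<bar>v i\<bar> \<le> B"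
      using Vc_bounded[OF v] by (metis bounded_functionsE)
    have dl: "double_limit (insert v C) UNIV (\<lambda>c i. c i)"
      using B(2) by (intro double_limit_insert[OF double_limit_C])
    have bd: "\<forall>c\<in>insert v C. \<forall>i. \<bar>c i\<bar> \<le> max 1 B"
      using B(2) C_le_1 by (auto simp: le_max_iff_disj)
    have "0 < min d e" using d e(1) by simp
    from ex_fin_functional_uniform_approx[OF dl bd \<psi> this]
    obtain \<zeta>' where \<zeta>': "\<zeta>' \<in> fin_functionals UNIV L"
        "\<And>c. c \<in> insert v C \<Longrightarrow> \<bar>\<psi> c - \<zeta>' c\<bar> \<le> min d e"
      by blast
    have "(\<lambda>f. \<zeta>' f - \<zeta> f) \<in> fin_functionals UNIV (L + L)"
      by (rule fin_functionals_minus[OF \<zeta>'(1) \<zeta>(1)])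
    then have "\<bar>\<zeta>' v - \<zeta> v\<bar> \<le> \<epsilon> * N n v"
    proof (rule N_scaled[OF Vc_bounded[OF v] _ \<epsilon>])
      fix c assume c: "c \<in> C"
      have "\<bar>\<zeta>' c - \<zeta> c\<bar> \<le> 2 * e" using \<zeta>(2)[OF c] \<zeta>'(2)[of c] c by auto
      then have "a n * \<bar>\<zeta>' c - \<zeta> c\<bar> \<le> a n * (2 * e)" using a_nonneg by (rule mult_left_mono)
      then show "a n * \<bar>\<zeta>' c - \<zeta> c\<bar> + b n * (L + L) \<le> \<epsilon>" using e(2) bn by simp
    qed
    also have "\<dots> \<le> \<epsilon> * nrm v" using N_le_nrm[OF v] \<epsilon> by simp
    finally show "\<bar>\<psi> v - \<zeta> v\<bar> \<le> \<epsilon> * nrm v + d" using \<zeta>'(2)[of v] by auto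
  qed
  then show ?thesis using \<zeta>(1) by blast
qed

lemma ex_fin_functional_near_dual:
  assumes \<phi>: "\<phi> \<in> carrier D" and \<epsilon>: "\<epsilon> > 0"
  shows "\<exists>L. \<exists>\<zeta>\<in>fin_functionals UNIV L. \<forall>v\<in>Vc. \<bar>\<phi> v - \<zeta> v\<bar> \<le> \<epsilon> * nrm v"
proof -
  have e: "\<epsilon> / 2 > 0" using \<epsilon> by simp
  obtain L \<psi> where \<psi>: "bounded_functional UNIV L \<psi>" "\<And>v. v \<in> Vc \<Longrightarrow> \<bar>\<phi> v - \<psi> v\<bar> \<le> \<epsilon> / 2 * nrm v"
    using ex_bounded_functional_near_dual[OF \<phi> e] by blast
  obtain \<zeta> where \<zeta>: "\<zeta> \<in> fin_functionals UNIV L" "\<And>v. v \<in> Vc \<Longrightarrow> \<bar>\<psi> v - \<zeta> v\<bar> \<le> \<epsilon> / 2 * nrm v"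
    using ex_fin_functional_near_bounded_functional[OF \<psi>(1) e] by blast
  have "\<bar>\<phi> v - \<zeta> v\<bar> \<le> \<epsilon> * nrm v" if "v \<in> Vc" for v
    using \<psi>(2)[OF that] \<zeta>(2)[OF that] by linarith
  then show ?thesis using \<zeta>(1) by blast
qed

lemma fin_functional_in_dual:
  assumes "\<zeta> \<in> fin_functionals UNIV L"
  shows "restrict \<zeta> Vc \<in> carrier D"
proof -
  have "\<bar>\<zeta> v\<bar> \<le> L * nrm v" if v: "v \<in> Vc" for v
    using point_le_nrm[OF v] nrm_nonneg[OF v] by (intro fin_functionals_bound[OF assms])
  then show ?thesis
    by (auto simp: in_dual_iff add_Vc mult_Vc fin_functionals_add[OF assms]
        fin_functionals_mult[OF assms])
qed

text \<open>A bidual element \<open>\<Phi>\<close> is represented by the function \<open>v\<close>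
  of its values on point evaluations. The two agree on finitely supported functionals, which already
  suffices to bound the gauges of \<open>v\<close> and place it in \<open>Vc\<close>; density then
  gives agreement on the whole dual.\<close>

lemma reflexive_space_V: "reflexive_space V"
proof -
  have bidual: "\<Phi> \<in> carrier (dual_space D) \<longleftrightarrow> \<Phi> \<in> extensional (carrier D) \<and>
     (\<forall>\<phi>\<in>carrier D. \<forall>\<psi>\<in>carrier D. \<Phi> (\<lambda>x\<in>Vc. \<phi> x + \<psi> x) = \<Phi> \<phi> + \<Phi> \<psi>) \<and>
     (\<forall>r. \<forall>\<phi>\<in>carrier D. \<Phi> (\<lambda>x\<in>Vc. r * \<phi> x) = r * \<Phi> \<phi>) \<and>
     (\<exists>B. \<forall>\<phi>\<in>carrier D. \<bar>\<Phi> \<phi>\<bar> \<le> B * vnorm D \<phi>)" for \<Phi>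
    unfolding dual_space_def[of D] by simp
  have add_in: "(\<lambda>x\<in>Vc. \<phi> x + \<psi> x) \<in> carrier D" if \<phi>: "\<phi> \<in> carrier D" and \<psi>: "\<psi> \<in> carrier D" for \<phi> \<psi>
  proof -
    obtain A where A: "\<And>v. v \<in> Vc \<Longrightarrow> \<bar>\<phi> v\<bar> \<le> A * nrm v" using \<phi> by (rule dual_bound) blast
    obtain B where B: "\<And>v. v \<in> Vc \<Longrightarrow> \<bar>\<psi> v\<bar> \<le> B * nrm v" using \<psi> by (rule dual_bound) blast
    have "\<bar>\<phi> v + \<psi> v\<bar> \<le> (A + B) * nrm v" if "v \<in> Vc" for v
      using A[OF that] B[OF that] by (simp add: distrib_right abs_le_iff)
    then show ?thesis
      unfolding in_dual_iff
      by (auto simp: add_Vc mult_Vc dual_add[OF \<phi>] dual_add[OF \<psi>] dual_mult[OF \<phi>] dual_mult[OF \<psi>]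
          distrib_left)
  qed
  have mult_in: "(\<lambda>x\<in>Vc. r * \<phi> x) \<in> carrier D" if \<phi>: "\<phi> \<in> carrier D" for r \<phi>
  proof -
    obtain A where A: "\<And>v. v \<in> Vc \<Longrightarrow> \<bar>\<phi> v\<bar> \<le> A * nrm v" using \<phi> by (rule dual_bound) blast
    have "\<bar>r * \<phi> v\<bar> \<le> (\<bar>r\<bar> * A) * nrm v" if "v \<in> Vc" for v
      using mult_left_mono[OF A[OF that], of "\<bar>r\<bar>"] by (simp add: abs_mult mult.assoc)
    then show ?thesis
      unfolding in_dual_iff
      by (auto simp: add_Vc mult_Vc dual_add[OF \<phi>] dual_mult[OF \<phi>] distrib_left)
  qed
  have "canonical_embedding V v \<in> carrier (dual_space D)" if v: "v \<in> Vc" for v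
    unfolding bidual canonical_embedding_def
    using v add_in mult_in dual_le_vnorm[OF _ v] by (auto simp: mult.commute intro!: exI[of _ "nrm v"])
  moreover have "\<exists>v\<in>Vc. \<Phi> = canonical_embedding V v" if \<Phi>: "\<Phi> \<in> carrier (dual_space D)" for \<Phi>
  proof -
    have \<Phi>_ext: "\<Phi> \<in> extensional (carrier D)"
      and \<Phi>_add: "\<And>\<phi> \<psi>. \<phi> \<in> carrier D \<Longrightarrow> \<psi> \<in> carrier D \<Longrightarrow> \<Phi> (\<lambda>x\<in>Vc. \<phi> x + \<psi> x) = \<Phi> \<phi> + \<Phi> \<psi>"
      and \<Phi>_mult: "\<And>r \<phi>. \<phi> \<in> carrier D \<Longrightarrow> \<Phi> (\<lambda>x\<in>Vc. r * \<phi> x) = r * \<Phi> \<phi>"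
      using \<Phi> unfolding bidual by blast+
    obtain B0 where B0: "\<And>\<phi>. \<phi> \<in> carrier D \<Longrightarrow> \<bar>\<Phi> \<phi>\<bar> \<le> B0 * vnorm D \<phi>"
      using \<Phi> unfolding bidual by blast
    define B where "B = \<bar>B0\<bar>"
    have B: "0 \<le> B" by (simp add: B_def)
    have \<Phi>_le: "\<bar>\<Phi> \<phi>\<bar> \<le> B * r"
      if \<phi>: "\<phi> \<in> carrier D" and r: "0 \<le> r" "\<And>v. v \<in> Vc \<Longrightarrow> \<bar>\<phi> v\<bar> \<le> r * nrm v" for \<phi> r
    proof -
      have "\<bar>\<Phi> \<phi>\<bar> \<le> B0 * vnorm D \<phi>" by (rule B0[OF \<phi>])
      also have "\<dots> \<le> B * r"
      proof (cases "0 \<le> vnorm D \<phi>")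
        case True
        then have "B0 * vnorm D \<phi> \<le> B * vnorm D \<phi>" by (intro mult_right_mono) (auto simp: B_def)
        also have "\<dots> \<le> B * r" using vnorm_dual_le[OF r] B by (intro mult_left_mono)
        finally show ?thesis .
      next
        \<comment> \<open>This case cannot occur: a negative value would force \<open>\<phi>\<close>
          to vanish on \<open>Vc\<close>, and then the supremum is 0.\<close>
        case False
        have z: "vnorm D \<phi> * nrm v = 0" if "v \<in> Vc" for v
          using dual_le_vnorm[OF \<phi> that] nrm_nonneg[OF that] False
          by (smt (verit) mult_nonpos_nonneg)
        have "\<phi> v = 0" if "v \<in> Vc" for v
          using dual_le_vnorm[OF \<phi> that] unfolding z[OF that] by simp
        then have "{\<bar>\<phi> x\<bar> | x. x \<in> Vc \<and> nrm x \<le> 1} = {0}"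
          using zero_Vc by force
        then show ?thesis using False by (simp add: vnorm_dual)
      qed
      finally show ?thesis .
    qed
    define v where "v i = \<Phi> (\<lambda>x\<in>Vc. x i)" for i
    have \<Phi>_fin: "\<Phi> (restrict \<zeta> Vc) = \<zeta> v" if \<zeta>: "\<zeta> \<in> fin_functionals UNIV L" for \<zeta> L
    proof -
      obtain F z where "finite F" "F \<subseteq> UNIV" "(\<Sum>i\<in>F. \<bar>z i\<bar>) \<le> L" "\<zeta> = (\<lambda>f. \<Sum>i\<in>F. z i * f i)"
        using \<zeta> by (rule fin_functionalsE)
      note F = this(1,4)
      have in_D: "(\<lambda>x\<in>Vc. \<Sum>i\<in>G. z i * x i) \<in> carrier D" if "finite G" for G
        using fin_functional_in_dual[OF fin_functionalsI[OF that subset_UNIV order_refl]] .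
      have ev: "(\<lambda>x\<in>Vc. x i) \<in> carrier D" for i
        using fin_functional_in_dual[OF eval_in_fin_functionals[of i UNIV]] by simp
      have "\<Phi> (\<lambda>x\<in>Vc. \<Sum>i\<in>F. z i * x i) = (\<Sum>i\<in>F. z i * v i)"
        using F(1)
      proof (induction F)
        case empty
        then show ?case using \<Phi>_mult[OF ev, of 0] by (simp add: restrict_def)
      next
        case (insert j F)
        have split: "(\<lambda>x\<in>Vc. \<Sum>i\<in>insert j F. z i * x i)
            = (\<lambda>x\<in>Vc. (\<lambda>x\<in>Vc. z j * (\<lambda>x\<in>Vc. x j) x) x + (\<lambda>x\<in>Vc. \<Sum>i\<in>F. z i * x i) x)"
          using insert(1,2) by (auto simp: restrict_def)
        have sum_eq: "\<Phi> (\<lambda>x\<in>Vc. \<Sum>i\<in>insert j F. z i * x i)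
            = \<Phi> (\<lambda>x\<in>Vc. z j * (\<lambda>x\<in>Vc. x j) x) + \<Phi> (\<lambda>x\<in>Vc. \<Sum>i\<in>F. z i * x i)"
          unfolding split by (rule \<Phi>_add[OF mult_in[OF ev] in_D[OF insert(1)]])
        have mult_eq: "\<Phi> (\<lambda>x\<in>Vc. z j * (\<lambda>x\<in>Vc. x j) x) = z j * v j"
          unfolding v_def by (rule \<Phi>_mult[OF ev])
        show ?case unfolding sum_eq mult_eq insert(3) using insert(1,2) by simp
      qed
      then show ?thesis by (simp add: F(2))
    qed
    have vb: "v \<in> bounded_functions UNIV"
    proof (rule bounded_functionsI)
      fix i
      have "(\<lambda>x\<in>Vc. x i) \<in> carrier D"
        using fin_functional_in_dual[OF eval_in_fin_functionals[of i UNIV]] by simp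
      then have "\<bar>\<Phi> (\<lambda>x\<in>Vc. x i)\<bar> \<le> B * 1"
        using point_le_nrm by (intro \<Phi>_le) auto
      then show "\<bar>v i\<bar> \<le> B" by (simp add: v_def)
    qed
    have "L2_set (\<lambda>n. N n v) {..<k} \<le> B" for k
    proof -
      define l where "l = L2_set (\<lambda>n. N n v) {..<k}"
      have l0: "0 \<le> l" by (simp add: l_def)
      define s where "s = (\<Sum>n<k. N n v)"
      have s0: "0 \<le> s" unfolding s_def using N_nonneg[OF vb] by (intro sum_nonneg)
      have "l * l \<le> B * l"
      proof (rule field_le_epsilon)
        fix e :: real assume e: "0 < e"
        define e' where "e' = e / (s + 1)"
        have e': "0 < e'" "s * e' \<le> e" using e s0 by (auto simp: e'_def field_simps)
        have "\<exists>\<zeta>\<in>polar n. N n v - e' \<le> \<zeta> v" for n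
        proof (rule ccontr)
          assume none: "\<not> ?thesis"
          have "N n v \<le> N n v - e'"
          proof (rule N_least)
            fix \<zeta> assume \<zeta>: "\<zeta> \<in> polar n"
            show "\<bar>\<zeta> v\<bar> \<le> N n v - e'" using none \<zeta> polar_minus[OF \<zeta>] by (force simp: abs_le_iff)
          qed
          then show False using e'(1) by simp
        qed
        then obtain \<zeta> where \<zeta>: "\<And>n. \<zeta> n \<in> polar n" "\<And>n. N n v - e' \<le> \<zeta> n v" by metis
        have "\<exists>t. \<zeta> n \<in> fin_functionals UNIV t" for n
          using \<zeta>(1)[of n] unfolding polar_def by blast
        then obtain t where t: "\<And>n. \<zeta> n \<in> fin_functionals UNIV (t n)" by metis
        \<comment> \<open>Duality for the \<open>\<ell>\<^sub>2\<close>-sum: almost norming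
          functionals \<open>\<zeta> n\<close>, weighted by the gauges \<open>N n v\<close>. By
          Cauchy-Schwarz \<open>\<xi>\<close> has dual norm at most \<open>l\<close>, while
          \<open>\<xi> v\<close> is nearly \<open>l * l\<close>; boundedness of
          \<open>\<Phi>\<close> yields \<open>l * l \<le> B * l\<close>.\<close>
        define \<xi> where "\<xi> f = (\<Sum>n<k. N n v * \<zeta> n f)" for f
        have \<xi>: "\<xi> \<in> fin_functionals UNIV (\<Sum>n<k. \<bar>N n v\<bar> * t n)"
          unfolding \<xi>_def[abs_def]
          using fin_functionals_sum_in[of "{..<k}" "\<lambda>n f. N n v * \<zeta> n f" UNIV "\<lambda>n. \<bar>N n v\<bar> * t n"]
            fin_functionals_scale[OF t] by simp
        have "\<bar>\<xi> x\<bar> \<le> l * nrm x" if x: "x \<in> Vc" for x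
        proof -
          have "\<bar>\<xi> x\<bar> \<le> (\<Sum>n<k. N n v * N n x)"
            unfolding \<xi>_def using N_upper[OF Vc_bounded[OF x] \<zeta>(1)] N_nonneg[OF vb]
            by (intro order_trans[OF sum_abs] sum_mono) (simp add: abs_mult mult_left_mono)
          also have "\<dots> \<le> l * nrm x" unfolding l_def by (rule L2_set_mult_le[OF vb x])
          finally show ?thesis .
        qed
        then have "\<bar>\<Phi> (restrict \<xi> Vc)\<bar> \<le> B * l"
          using l0 by (intro \<Phi>_le fin_functional_in_dual[OF \<xi>]) auto
        then have up: "\<xi> v \<le> B * l" by (simp add: \<Phi>_fin[OF \<xi>])
        have "l * l = (\<Sum>n<k. N n v * N n v)"
          unfolding l_def L2_set_def by (simp add: sum_nonneg power2_eq_square)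
        also have "\<dots> \<le> (\<Sum>n<k. N n v * \<zeta> n v + N n v * e')"
        proof (rule sum_mono)
          fix n
          have "N n v * (N n v - e') \<le> N n v * \<zeta> n v"
            using \<zeta>(2) N_nonneg[OF vb] by (rule mult_left_mono)
          then show "N n v * N n v \<le> N n v * \<zeta> n v + N n v * e'" by (simp add: algebra_simps)
        qed
        also have "\<dots> = \<xi> v + s * e'" by (simp add: \<xi>_def s_def sum.distrib sum_distrib_right)
        finally show "l * l \<le> B * l + e" using up e'(2) by linarith
      qed
      then show ?thesis using l0 B unfolding l_def[symmetric] by (cases "l = 0") auto
    qed
    from VcI(1)[OF vb this] have vV: "v \<in> Vc" .
    have "\<Phi> \<phi> = \<phi> v" if \<phi>: "\<phi> \<in> carrier D" for \<phi>
    proof -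
      have "\<bar>\<Phi> \<phi> - \<phi> v\<bar> \<le> 0"
      proof (rule field_le_epsilon)
        fix e :: real assume e: "0 < e"
        \<comment> \<open>Replacing \<open>\<phi>\<close> by \<open>\<zeta>\<close> moves
          \<open>\<Phi> \<phi>\<close> by at most \<open>B * e'\<close> and \<open>\<phi> v\<close>
          by at most \<open>e' * nrm v\<close>.\<close>
        define e' where "e' = e / (B + nrm v + 1)"
        have pos: "0 < B + nrm v + 1" using B nrm_nonneg[OF vV] by linarith
        then have "0 < e'" and "e' * (B + nrm v + 1) = e"
          using e by (auto simp: e'_def)
        then have e': "0 < e'" "B * e' + e' * nrm v \<le> e" by (auto simp: algebra_simps)
        obtain L \<zeta> where \<zeta>: "\<zeta> \<in> fin_functionals UNIV L" "\<And>x. x \<in> Vc \<Longrightarrow> \<bar>\<phi> x - \<zeta> x\<bar> \<le> e' * nrm x"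
          using ex_fin_functional_near_dual[OF \<phi> e'(1)] by blast
        note \<zeta>D = fin_functional_in_dual[OF \<zeta>(1)]
        define \<psi> where "\<psi> = (\<lambda>x\<in>Vc. \<phi> x + (\<lambda>x\<in>Vc. - 1 * restrict \<zeta> Vc x) x)"
        have "\<psi> \<in> carrier D" unfolding \<psi>_def by (rule add_in[OF \<phi> mult_in[OF \<zeta>D]])
        then have "\<bar>\<Phi> \<psi>\<bar> \<le> B * e'"
          using \<zeta>(2) e'(1) by (intro \<Phi>_le) (auto simp: \<psi>_def)
        moreover have "\<Phi> \<psi> = \<Phi> \<phi> - \<zeta> v"
          unfolding \<psi>_def using \<Phi>_add[OF \<phi> mult_in[OF \<zeta>D, of "-1"]] \<Phi>_mult[OF \<zeta>D, of "-1"]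
            \<Phi>_fin[OF \<zeta>(1)] by simp
        ultimately show "\<bar>\<Phi> \<phi> - \<phi> v\<bar> \<le> 0 + e"
          using \<zeta>(2)[OF vV] e'(2) by linarith
      qed
      then show ?thesis by simp
    qed
    then have "\<Phi> = canonical_embedding V v"
      unfolding canonical_embedding_def using \<Phi>_ext by (auto simp: extensional_def restrict_def)
    then show ?thesis using vV by blast
  qed
  ultimately show ?thesis
    unfolding reflexive_space_def by auto
qed

end

section \<open>Double limits in a stable metric space\<close>

text \<open>In one order the bound \<open>\<alpha> m\<close> survives the inner limit and vanishes
  in the outer one; in the other order the inner limit is already 0.\<close>

lemma iterated_Lim_null:
  fixes X :: "'m \<Rightarrow> 'n \<Rightarrow> real"
  assumes U: "ultrafilter U" and V: "ultrafilter V"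
    and le: "\<And>m n. \<bar>X m n\<bar> \<le> \<alpha> m" and \<alpha>: "(\<alpha> \<longlongrightarrow> 0) U"
  shows "Lim U (\<lambda>m. Lim V (\<lambda>n. X m n)) = 0" "Lim V (\<lambda>n. Lim U (\<lambda>m. X m n)) = 0"
proof -
  note [simp] = ultrafilter_not_bot[OF U] ultrafilter_not_bot[OF V]
  have "((\<lambda>m. Lim V (\<lambda>n. X m n)) \<longlongrightarrow> 0) U"
    using le by (intro Lim_null_comparison[OF _ \<alpha>]) (simp add: abs_Lim_le[OF V])
  then show "Lim U (\<lambda>m. Lim V (\<lambda>n. X m n)) = 0" by (simp add: tendsto_Lim)
  have "((\<lambda>m. X m n) \<longlongrightarrow> 0) U" for n
    using le by (intro Lim_null_comparison[OF _ \<alpha>]) simp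
  then have "Lim U (\<lambda>m. X m n) = 0" for n by (simp add: tendsto_Lim)
  then show "Lim V (\<lambda>n. Lim U (\<lambda>m. X m n)) = 0" by (simp add: tendsto_Lim)
qed

text \<open>
  Truncating the metric removes the boundedness restriction from stability: along an unbounded
  sequence both iterated limits are equal to the truncation level.
\<close>

lemma stable_truncated_Lim:
  fixes M :: "'a metric" and x q :: "nat \<Rightarrow> 'a"
  assumes st: "stable_metric M" and x: "range x \<subseteq> mspace M" and q: "range q \<subseteq> mspace M"
    and U: "nonprincipal_ultrafilter U" and V: "nonprincipal_ultrafilter V"
  shows "Lim U (\<lambda>m. Lim V (\<lambda>n. min (mdist M (x m) (q n)) B)) =
         Lim V (\<lambda>n. Lim U (\<lambda>m. min (mdist M (x m) (q n)) B))"
proof -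
  define d where "d = mdist M"
  define z where "z = x 0"
  have uU: "ultrafilter U" and uV: "ultrafilter V"
    using U V by (auto simp: nonprincipal_ultrafilter_def)
  note [simp] = ultrafilter_not_bot[OF uU] ultrafilter_not_bot[OF uV]
  have xM: "x m \<in> mspace M" and qM: "q n \<in> mspace M" and zM: "z \<in> mspace M" for m n
    using x q by (auto simp: z_def)
  have tri: "d a c \<le> d a b + d b c" if "a \<in> mspace M" "b \<in> mspace M" "c \<in> mspace M" for a b c
    unfolding d_def using that by (rule mdist_triangle)
  have comm: "d a b = d b a" for a b unfolding d_def by (rule mdist_commute)
  have Lim_eq: "Lim W f = B" if "ultrafilter W" "eventually (\<lambda>i. f i = B) W"
    for W :: "nat filter" and f :: "nat \<Rightarrow> real"
    using that by (intro tendsto_Lim) (auto simp: ultrafilter_not_bot intro: tendsto_eventually)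
  \<comment> \<open>If one point is farther from the base point \<open>z\<close> than the other by
    at least \<open>B\<close>, the truncation is attained.\<close>
  have far_x: "B \<le> d (x m) (q n)" if "B + d z (q n) \<le> d z (x m)" for m n
    using tri[OF zM qM xM, of m n] comm[of "x m" "q n"] that by linarith
  have far_q: "B \<le> d (x m) (q n)" if "B + d z (x m) \<le> d z (q n)" for m n
    using tri[OF zM xM qM, of n m] that by linarith
  have big: "eventually (\<lambda>i. c \<le> f i) W" if "filterlim f at_top W" for f :: "nat \<Rightarrow> real" and c W
    using that by (auto simp: filterlim_at_top)
  have "Lim U (\<lambda>m. Lim V (\<lambda>n. min (d (x m) (q n)) B)) =
         Lim V (\<lambda>n. Lim U (\<lambda>m. min (d (x m) (q n)) B))"
  proof (rule ultrafilter_bounded_or_at_top[OF uU, of "\<lambda>m. d z (x m)"])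
    assume x_inf: "filterlim (\<lambda>m. d z (x m)) at_top U"
    have "Lim U (\<lambda>m. min (d (x m) (q n)) B) = B" for n
      using big[OF x_inf, of "B + d z (q n)"]
      by (intro Lim_eq[OF uU]) (auto elim!: eventually_mono dest: far_x)
    then have R: "Lim V (\<lambda>n. Lim U (\<lambda>m. min (d (x m) (q n)) B)) = B"
      by (intro Lim_eq[OF uV]) simp
    have "eventually (\<lambda>m. Lim V (\<lambda>n. min (d (x m) (q n)) B) = B) U"
    proof (rule ultrafilter_bounded_or_at_top[OF uV, of "\<lambda>n. d z (q n)"])
      fix A assume A: "eventually (\<lambda>n. d z (q n) \<le> A) V"
      show ?thesis
        using big[OF x_inf, of "B + A"]
      proof eventually_elim
        case (elim m)
        have "min (d (x m) (q n)) B = B" if "d z (q n) \<le> A" for n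
          using far_x[of n m] elim that by simp
        with A show ?case by (intro Lim_eq[OF uV]) (auto elim: eventually_mono)
      qed
    next
      assume "filterlim (\<lambda>n. d z (q n)) at_top V"
      then have "Lim V (\<lambda>n. min (d (x m) (q n)) B) = B" for m
        using big[of "\<lambda>n. d z (q n)" V "B + d z (x m)"]
        by (intro Lim_eq[OF uV]) (auto elim!: eventually_mono dest: far_q)
      then show ?thesis by simp
    qed
    then show ?thesis unfolding R by (rule Lim_eq[OF uU])
  next
    fix A assume A: "eventually (\<lambda>m. d z (x m) \<le> A) U"
    show ?thesis
    proof (rule ultrafilter_bounded_or_at_top[OF uV, of "\<lambda>n. d z (q n)"])
      assume q_inf: "filterlim (\<lambda>n. d z (q n)) at_top V"
      have "Lim V (\<lambda>n. min (d (x m) (q n)) B) = B" for m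
        using big[OF q_inf, of "B + d z (x m)"]
        by (intro Lim_eq[OF uV]) (auto elim!: eventually_mono dest: far_q)
      then have L: "Lim U (\<lambda>m. Lim V (\<lambda>n. min (d (x m) (q n)) B)) = B"
        by (intro Lim_eq[OF uU]) simp
      have "eventually (\<lambda>n. Lim U (\<lambda>m. min (d (x m) (q n)) B) = B) V"
        using big[OF q_inf, of "B + A"]
      proof eventually_elim
        case (elim n)
        have "min (d (x m) (q n)) B = B" if "d z (x m) \<le> A" for m
          using far_q[of m n] elim that by simp
        with A show ?case by (intro Lim_eq[OF uU]) (auto elim: eventually_mono)
      qed
      then show ?thesis unfolding L by (rule Lim_eq[OF uV, symmetric])
    next
      fix A' assume A': "eventually (\<lambda>n. d z (q n) \<le> A') V"
      have zz: "d z z = 0" using zM by (simp add: d_def)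
      \<comment> \<open>Stability asks for bounded ranges, while the sequences are only bounded
        along the ultrafilters. Sending the exceptional terms to \<open>z\<close> repairs this and
        changes no limit.\<close>
      define x' where "x' m = (if d z (x m) \<le> A then x m else z)" for m
      define q' where "q' n = (if d z (q n) \<le> A' then q n else z)" for n
      have x'M: "x' m \<in> mspace M" and q'M: "q' n \<in> mspace M" for m n
        using xM qM zM by (auto simp: x'_def q'_def)
      have x'A: "d z (x' m) \<le> \<bar>A\<bar>" and q'A: "d z (q' n) \<le> \<bar>A'\<bar>" for m n
        using zz by (auto simp: x'_def q'_def)
      have bdd: "Metric_space.mbounded (mspace M) (mdist M) (range y)"
        if "\<And>m. y m \<in> mspace M" "\<And>m. d z (y m) \<le> c" for y :: "nat \<Rightarrow> 'a" and c
      proof -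
        have "range y \<subseteq> Metric_space.mcball (mspace M) (mdist M) z c"
          using that zM unfolding d_def
          by (intro image_subsetI) (simp add: Metric_space.in_mcball[OF Metric_space_mspace_mdist])
        then show ?thesis
          unfolding Metric_space.mbounded_def[OF Metric_space_mspace_mdist] by (intro exI)
      qed
      define L where "L = Lim U (\<lambda>m. Lim V (\<lambda>n. d (x' m) (q' n)))"
      have L': "Lim V (\<lambda>n. Lim U (\<lambda>m. d (x' m) (q' n))) = L"
        unfolding L_def d_def
        by (rule st[unfolded stable_metric_def, rule_format, of x' q' U V, symmetric])
          (use x'M q'M bdd[OF x'M x'A] bdd[OF q'M q'A] U V in \<open>auto simp: image_subset_iff\<close>)
      have dle: "\<bar>d (x' m) (q' n)\<bar> \<le> \<bar>A\<bar> + \<bar>A'\<bar>" for m n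
      proof -
        have "d (x' m) (q' n) \<le> d z (x' m) + d z (q' n)"
          using tri[OF x'M zM q'M, of m n] comm[of "x' m" z] by simp
        moreover have "0 \<le> d (x' m) (q' n)" by (simp add: d_def)
        ultimately show ?thesis using x'A[of m] q'A[of n] by linarith
      qed
      have tV: "((\<lambda>n. d (x' m) (q' n)) \<longlongrightarrow> Lim V (\<lambda>n. d (x' m) (q' n))) V" for m
        using dle by (intro ultrafilter_tendsto_Lim[OF uV, where B = "\<bar>A\<bar> + \<bar>A'\<bar>"]) simp
      have tU: "((\<lambda>m. d (x' m) (q' n)) \<longlongrightarrow> Lim U (\<lambda>m. d (x' m) (q' n))) U" for n
        using dle by (intro ultrafilter_tendsto_Lim[OF uU, where B = "\<bar>A\<bar> + \<bar>A'\<bar>"]) simp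
      have tUV: "((\<lambda>m. Lim V (\<lambda>n. d (x' m) (q' n))) \<longlongrightarrow> L) U"
        unfolding L_def
        using dle by (intro ultrafilter_tendsto_Lim[OF uU, where B = "\<bar>A\<bar> + \<bar>A'\<bar>"])
          (simp add: abs_Lim_le[OF uV])
      have tVU: "((\<lambda>n. Lim U (\<lambda>m. d (x' m) (q' n))) \<longlongrightarrow> L) V"
        unfolding L'[symmetric]
        using dle by (intro ultrafilter_tendsto_Lim[OF uV, where B = "\<bar>A\<bar> + \<bar>A'\<bar>"])
          (simp add: abs_Lim_le[OF uU])
      have xU: "Lim U (\<lambda>m. g (x m)) = Lim U (\<lambda>m. g (x' m))" for g :: "'a \<Rightarrow> real"
        using A by (intro Lim_cong refl) (auto simp: x'_def elim: eventually_mono)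
      have qV: "Lim V (\<lambda>n. g (q n)) = Lim V (\<lambda>n. g (q' n))" for g :: "'a \<Rightarrow> real"
        using A' by (intro Lim_cong refl) (auto simp: q'_def elim: eventually_mono)
      have "Lim U (\<lambda>m. Lim V (\<lambda>n. min (d (x m) (q n)) B))
          = Lim U (\<lambda>m. Lim V (\<lambda>n. min (d (x' m) (q' n)) B))"
        using xU[of "\<lambda>x. Lim V (\<lambda>n. min (d x (q n)) B)"] qV[of "\<lambda>q. min (d x q) B" for x] by simp
      also have "\<dots> = Lim U (\<lambda>m. min (Lim V (\<lambda>n. d (x' m) (q' n))) B)"
        by (intro arg_cong[where f = "Lim U"] ext tendsto_Lim tendsto_min tV tendsto_const) simp
      also have "\<dots> = min L B"
        by (intro tendsto_Lim tendsto_min tUV tendsto_const) simp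
      also have "\<dots> = Lim V (\<lambda>n. min (Lim U (\<lambda>m. d (x' m) (q' n))) B)"
        by (intro tendsto_Lim[symmetric] tendsto_min tVU tendsto_const) simp
      also have "\<dots> = Lim V (\<lambda>n. Lim U (\<lambda>m. min (d (x' m) (q' n)) B))"
        by (intro arg_cong[where f = "Lim V"] ext tendsto_Lim[symmetric] tendsto_min tU tendsto_const) simp
      also have "\<dots> = Lim V (\<lambda>n. Lim U (\<lambda>m. min (d (x m) (q n)) B))"
        using qV[of "\<lambda>q. Lim U (\<lambda>m. min (d (x m) q) B)"] xU[of "\<lambda>x. min (d x q) B" for q] by simp
      finally show ?thesis .
    qed
  qed
  then show ?thesis by (simp add: d_def)
qed

text \<open>
  The factor \<open>r (d p q) / d p q\<close> makes the slope small when \<open>d p q\<close> is large. It is \<open>0\<close> if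
  \<open>p = q\<close>.
\<close>

definition tent :: "'a metric \<Rightarrow> (real \<Rightarrow> real) \<Rightarrow> 'a \<Rightarrow> 'a \<Rightarrow> 'a \<Rightarrow> real" where
  "tent M r p q x = r (mdist M p q) / mdist M p q * max (mdist M p q - mdist M x q) 0"

lemma tent_diff_le:
  assumes "x \<in> mspace M" "y \<in> mspace M" "q \<in> mspace M" "0 \<le> r (mdist M p q)"
  shows "\<bar>tent M r p q x - tent M r p q y\<bar> \<le> r (mdist M p q) / mdist M p q * mdist M x y"
proof -
  have "\<bar>mdist M x q - mdist M y q\<bar> \<le> mdist M x y"
    using mdist_triangle[OF assms(1,2,3)] mdist_triangle[OF assms(2,1,3)] mdist_commute[of M x y] by linarith
  then have le: "\<bar>max (mdist M p q - mdist M x q) 0 - max (mdist M p q - mdist M y q) 0\<bar> \<le> mdist M x y"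
    by (auto simp: max_def abs_if split: if_splits)
  have nonneg: "0 \<le> r (mdist M p q) / mdist M p q"
    using assms(4) by simp
  show ?thesis
    unfolding tent_def right_diff_distrib[symmetric] abs_mult abs_of_nonneg[OF nonneg]
    by (rule mult_left_mono[OF le nonneg])
qed

text \<open>With \<open>D = d p q\<close> and \<open>d = d x y\<close>, the quotient is bounded by
  the product of \<open>r D / D\<close> and \<open>d / w d\<close>, both at most 1. If
  \<open>D\<close> tends to infinity along \<open>V\<close>, the first factor kills both iterated
  limits; if \<open>w d\<close> tends to 0 along \<open>U\<close>, so does \<open>d\<close>, and the
  second factor does. In the remaining case \<open>D\<close> and \<open>1 / w d\<close> are bounded,
  and the truncated metric suffices.\<close>

lemma tent_Lim_commute:
  fixes M :: "'a metric" and x y p q :: "nat \<Rightarrow> 'a"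
  assumes st: "stable_metric M"
    and x: "range x \<subseteq> mspace M" and y: "range y \<subseteq> mspace M" and xy: "\<And>m. x m \<noteq> y m"
    and p: "range p \<subseteq> mspace M" and q: "range q \<subseteq> mspace M"
    and U: "nonprincipal_ultrafilter U" and V: "nonprincipal_ultrafilter V"
    and r: "\<And>t. 0 \<le> t \<Longrightarrow> 0 \<le> r t" "\<And>t. 0 \<le> t \<Longrightarrow> r t \<le> t"
    and r_inf: "((\<lambda>t. r t / t) \<longlongrightarrow> 0) at_top"
    and w: "\<And>t. 0 \<le> t \<Longrightarrow> t \<le> w t" and w_0: "filterlim (\<lambda>t. w t / t) at_top (at_right 0)"
  shows "Lim U (\<lambda>m. Lim V (\<lambda>n. (tent M r (p n) (q n) (x m) - tent M r (p n) (q n) (y m))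
             / w (mdist M (x m) (y m)))) =
         Lim V (\<lambda>n. Lim U (\<lambda>m. (tent M r (p n) (q n) (x m) - tent M r (p n) (q n) (y m))
             / w (mdist M (x m) (y m))))"
proof -
  have uU: "ultrafilter U" and uV: "ultrafilter V"
    using U V by (auto simp: nonprincipal_ultrafilter_def)
  note [simp] = ultrafilter_not_bot[OF uU] ultrafilter_not_bot[OF uV]
  have M: "x m \<in> mspace M" "y m \<in> mspace M" "p m \<in> mspace M" "q m \<in> mspace M" for m
    using x y p q by auto
  define D where "D n = mdist M (p n) (q n)" for n
  define d where "d m = mdist M (x m) (y m)" for m
  define \<beta> where "\<beta> n = r (D n) / D n" for n
  \<comment> \<open>The case distinction is on \<open>\<sigma>\<close>, not on \<open>d\<close>:
    unbounded distances \<open>d m\<close> are harmless as long as \<open>\<sigma>\<close>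
    converges, since only truncated distances to \<open>q n\<close> enter.\<close>
  define \<sigma> where "\<sigma> m = inverse (w (d m))" for m
  define X where "X m n = (tent M r (p n) (q n) (x m) - tent M r (p n) (q n) (y m)) / w (d m)" for m n
  have D0: "0 \<le> D n" for n by (simp add: D_def)
  have d0: "0 < d m" for m
  proof -
    have "d m \<noteq> 0" using xy M by (simp add: d_def)
    then show ?thesis using mdist_nonneg[of M "x m" "y m"] unfolding d_def by linarith
  qed
  have wd: "d m \<le> w (d m)" for m using w[of "d m"] d0[of m] by simp
  have w0: "0 < w (d m)" for m using wd[of m] d0[of m] by simp
  have \<beta>01: "0 \<le> \<beta> n" "\<beta> n \<le> 1" for n
    using r[OF D0[of n]] D0[of n] by (auto simp: \<beta>_def divide_le_eq_1)
  have \<alpha>01: "0 \<le> d m / w (d m)" "d m / w (d m) \<le> 1" for m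
    using wd[of m] d0[of m] w0[of m] by auto
  have X_le: "\<bar>X m n\<bar> \<le> \<beta> n * (d m / w (d m))" for m n
  proof -
    have "\<bar>tent M r (p n) (q n) (x m) - tent M r (p n) (q n) (y m)\<bar> \<le> \<beta> n * d m"
      unfolding \<beta>_def D_def d_def using M r(1) by (intro tent_diff_le) auto
    then show ?thesis using w0[of m] by (simp add: X_def divide_right_mono)
  qed
  have X_le\<beta>: "\<bar>X m n\<bar> \<le> \<beta> n" and X_le\<alpha>: "\<bar>X m n\<bar> \<le> d m / w (d m)" for m n
    using X_le[of m n] mult_left_mono[OF \<alpha>01(2) \<beta>01(1), of n m]
      mult_right_mono[OF \<beta>01(2) \<alpha>01(1), of n m] by linarith+
  have "Lim U (\<lambda>m. Lim V (\<lambda>n. X m n)) = Lim V (\<lambda>n. Lim U (\<lambda>m. X m n))"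
  proof (rule ultrafilter_bounded_or_at_top[OF uV, of D])
    assume "filterlim D at_top V"
    with r_inf have "(\<beta> \<longlongrightarrow> 0) V"
      unfolding \<beta>_def by (rule filterlim_compose)
    from iterated_Lim_null[OF uV uU _ this, of "\<lambda>n m. X m n"] X_le\<beta> show ?thesis by simp
  next
    fix B assume B: "eventually (\<lambda>n. D n \<le> B) V"
    show ?thesis
    proof (rule ultrafilter_bounded_or_at_top[OF uU, of \<sigma>])
      assume \<sigma>: "filterlim \<sigma> at_top U"
      have "(d \<longlongrightarrow> 0) U"
      proof (rule Lim_null_comparison)
        show "eventually (\<lambda>m. norm (d m) \<le> w (d m)) U" using wd d0 by (simp add: less_imp_le)
        have "((\<lambda>m. inverse (\<sigma> m)) \<longlongrightarrow> 0) U"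
          by (rule tendsto_inverse_0_at_top[OF \<sigma>])
        then show "((\<lambda>m. w (d m)) \<longlongrightarrow> 0) U" by (simp add: \<sigma>_def)
      qed
      then have "filterlim d (at_right 0) U"
        using d0 by (auto simp: filterlim_at less_imp_neq[symmetric])
      from filterlim_compose[OF w_0 this]
      have "((\<lambda>m. inverse (w (d m) / d m)) \<longlongrightarrow> 0) U" by (rule tendsto_inverse_0_at_top)
      then have "((\<lambda>m. d m / w (d m)) \<longlongrightarrow> 0) U" by simp
      from iterated_Lim_null[OF uU uV _ this, of X] X_le\<alpha> show ?thesis by simp
    next
      fix W assume W: "eventually (\<lambda>m. \<sigma> m \<le> W) U"
      have "0 \<le> \<sigma> m" for m using w0[of m] by (simp add: \<sigma>_def)
      then have \<sigma>: "(\<sigma> \<longlongrightarrow> Lim U \<sigma>) U"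
        using W by (intro ultrafilter_tendsto_Lim[OF uU, where B = W]) simp
      have \<beta>: "(\<beta> \<longlongrightarrow> Lim V \<beta>) V"
        using \<beta>01 by (intro ultrafilter_tendsto_Lim[OF uV, where B = 1]) simp
      have D: "(D \<longlongrightarrow> Lim V D) V"
        using B D0 by (intro ultrafilter_tendsto_Lim[OF uV, where B = B]) simp
      \<comment> \<open>Where \<open>D n \<le> B\<close>, cutting the distance at \<open>B\<close>
        does not alter the tent, which vanishes beyond distance \<open>D n\<close>.\<close>
      define \<kappa> where "\<kappa> u n = min (mdist M u (q n)) B" for u n
      have \<kappa>B: "\<bar>\<kappa> u n\<bar> \<le> \<bar>B\<bar>" for u n
        using mdist_nonneg[of M u "q n"] by (auto simp: \<kappa>_def min_def)
      have tV: "((\<lambda>n. \<kappa> u n) \<longlongrightarrow> Lim V (\<kappa> u)) V" for u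
        using \<kappa>B by (intro ultrafilter_tendsto_Lim[OF uV, where B = "\<bar>B\<bar>"]) simp
      have tU: "((\<lambda>m. \<kappa> (u m) n) \<longlongrightarrow> Lim U (\<lambda>m. \<kappa> (u m) n)) U" for u n
        using \<kappa>B by (intro ultrafilter_tendsto_Lim[OF uU, where B = "\<bar>B\<bar>"]) simp
      have tUV: "((\<lambda>m. Lim V (\<kappa> (u m))) \<longlongrightarrow> Lim U (\<lambda>m. Lim V (\<kappa> (u m)))) U" for u
        using \<kappa>B by (intro ultrafilter_tendsto_Lim[OF uU, where B = "\<bar>B\<bar>"])
          (simp add: abs_Lim_le[OF uV])
      have tVU: "((\<lambda>n. Lim U (\<lambda>m. \<kappa> (u m) n)) \<longlongrightarrow> Lim U (\<lambda>m. Lim V (\<kappa> (u m)))) V"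
        if u: "range u \<subseteq> mspace M" for u
      proof -
        have "Lim U (\<lambda>m. Lim V (\<kappa> (u m))) = Lim V (\<lambda>n. Lim U (\<lambda>m. \<kappa> (u m) n))"
          unfolding \<kappa>_def by (rule stable_truncated_Lim[OF st u q U V])
        then show ?thesis
          using \<kappa>B by (simp only:, intro ultrafilter_tendsto_Lim[OF uV, where B = "\<bar>B\<bar>"])
            (simp add: abs_Lim_le[OF uU])
      qed
      \<comment> \<open>The quotient as a continuous function of five quantities. Three depend on
        one index only and converge; the two truncated distances depend on both, and for them the
        limits commute by stability.\<close>
      define T where "T b c e f s = b * (max (c - e) 0 - max (c - f) 0) * s" for b c e f s :: real
      have T: "((\<lambda>i. T (b i) (c i) (e i) (f i) (s i)) \<longlongrightarrow> T b' c' e' f' s') F"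
        if "(b \<longlongrightarrow> b') F" "(c \<longlongrightarrow> c') F" "(e \<longlongrightarrow> e') F" "(f \<longlongrightarrow> f') F" "(s \<longlongrightarrow> s') F"
        for b c e f s :: "nat \<Rightarrow> real" and b' c' e' f' s' and F
        unfolding T_def by (intro tendsto_intros that)
      have X_eq: "X m n = T (\<beta> n) (D n) (\<kappa> (x m) n) (\<kappa> (y m) n) (\<sigma> m)" if "D n \<le> B" for m n
      proof -
        have "max (D n - mdist M u (q n)) 0 = max (D n - \<kappa> u n) 0" for u
          using that by (auto simp: \<kappa>_def min_def max_def)
        then show ?thesis
          by (simp add: X_def T_def tent_def \<beta>_def \<sigma>_def D_def[symmetric] divide_inverse algebra_simps)
      qed
      define R where "R = T (Lim V \<beta>) (Lim V D) (Lim U (\<lambda>m. Lim V (\<kappa> (x m))))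
        (Lim U (\<lambda>m. Lim V (\<kappa> (y m)))) (Lim U \<sigma>)"
      have "Lim V (\<lambda>n. X m n)
          = T (Lim V \<beta>) (Lim V D) (Lim V (\<kappa> (x m))) (Lim V (\<kappa> (y m))) (\<sigma> m)" for m
      proof -
        have "Lim V (\<lambda>n. X m n) = Lim V (\<lambda>n. T (\<beta> n) (D n) (\<kappa> (x m) n) (\<kappa> (y m) n) (\<sigma> m))"
          using B by (intro Lim_cong refl) (auto elim!: eventually_mono simp: X_eq)
        also have "\<dots> = T (Lim V \<beta>) (Lim V D) (Lim V (\<kappa> (x m))) (Lim V (\<kappa> (y m))) (\<sigma> m)"
          by (intro tendsto_Lim T \<beta> D tV tendsto_const) simp
        finally show ?thesis .
      qed
      then have "Lim U (\<lambda>m. Lim V (\<lambda>n. X m n)) = R"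
        unfolding R_def by (simp only:) (intro tendsto_Lim T tendsto_const tUV \<sigma>, simp)
      moreover have "Lim V (\<lambda>n. Lim U (\<lambda>m. X m n)) = R"
      proof -
        have "Lim U (\<lambda>m. X m n) = T (\<beta> n) (D n) (Lim U (\<lambda>m. \<kappa> (x m) n)) (Lim U (\<lambda>m. \<kappa> (y m) n)) (Lim U \<sigma>)"
          if "D n \<le> B" for n
          unfolding X_eq[OF that] by (intro tendsto_Lim T tendsto_const tU \<sigma>) simp
        then have "Lim V (\<lambda>n. Lim U (\<lambda>m. X m n)) = Lim V (\<lambda>n. T (\<beta> n) (D n)
            (Lim U (\<lambda>m. \<kappa> (x m) n)) (Lim U (\<lambda>m. \<kappa> (y m) n)) (Lim U \<sigma>))"
          using B by (intro Lim_cong refl) (auto elim!: eventually_mono)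
        also have "\<dots> = R"
          unfolding R_def by (intro tendsto_Lim T \<beta> D tVU x y tendsto_const) simp
        finally show ?thesis .
      qed
      ultimately show ?thesis by simp
    qed
  qed
  then show ?thesis by (simp add: X_def d_def)
qed

section \<open>The embedding\<close>

theorem stable_metric_embedding:
  fixes M :: "'a metric"
  assumes st: "stable_metric M"
    and r: "\<And>t. 0 \<le> t \<Longrightarrow> 0 \<le> r t" "\<And>t. 0 \<le> t \<Longrightarrow> r t \<le> t"
    and r_inf: "((\<lambda>t. r t / t) \<longlongrightarrow> 0) at_top"
    and w: "\<And>t. 0 \<le> t \<Longrightarrow> t \<le> w t" and w_0: "filterlim (\<lambda>t. w t / t) at_top (at_right 0)"
  shows "\<exists>(Y :: 'a target_point metric) f. Y \<in> reflexive_banach_spaces \<and> f \<in> mspace M \<rightarrow> mspace Y \<and>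
     (\<forall>x\<in>mspace M. \<forall>y\<in>mspace M. r (mdist M x y) \<le> mdist Y (f x) (f y) \<and>
        mdist Y (f x) (f y) \<le> w (mdist M x y))"
proof -
  define S where "S = mspace M"
  define d where "d = mdist M"
  \<comment> \<open>Pairs are coded as the first two list entries. For shorter lists
    \<open>!\<close> returns some value, and the guard still leaves either a tent with both
    parameters in \<open>S\<close> or 0.\<close>
  define k :: "nat \<times> 'a list \<Rightarrow> 'a \<Rightarrow> real" where
    "k i x = (if snd i ! 0 \<in> S \<and> snd i ! 1 \<in> S then tent M r (snd i ! 0) (snd i ! 1) x else 0)" for i x
  define c where "c x y = (\<lambda>i. (k i x - k i y) / w (d x y))" for x y
  define C where "C = {c x y | x y. x \<in> S \<and> y \<in> S \<and> x \<noteq> y}"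
  have pos: "0 < d x y" "0 < w (d x y)" if "x \<in> S" "y \<in> S" "x \<noteq> y" for x y
  proof -
    have "d x y \<noteq> 0" using that by (simp add: d_def S_def)
    then show "0 < d x y" using mdist_nonneg[of M x y] unfolding d_def by linarith
    then show "0 < w (d x y)" using w[of "d x y"] by linarith
  qed
  have k_diff: "\<bar>k i x - k i y\<bar> \<le> d x y" if xy: "x \<in> S" "y \<in> S" for i x y
  proof (cases "snd i ! 0 \<in> S \<and> snd i ! 1 \<in> S")
    case True
    define D where "D = mdist M (snd i ! 0) (snd i ! 1)"
    have D: "0 \<le> D" by (simp add: D_def)
    have "\<bar>k i x - k i y\<bar> \<le> r D / D * mdist M x y"
      using tent_diff_le[of x M y "snd i ! 1" r "snd i ! 0"] True xy r(1)[OF D]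
      by (simp add: k_def S_def D_def)
    also have "\<dots> \<le> 1 * mdist M x y"
      using r[OF D] D by (intro mult_right_mono) (auto simp: divide_le_eq_1)
    finally show ?thesis by (simp add: d_def)
  qed (auto simp: k_def d_def)
  have c_le: "\<bar>c x y i\<bar> \<le> 1" if "x \<in> S" "y \<in> S" "x \<noteq> y" for x y i
    using k_diff[OF that(1,2), of i] w[of "d x y"] pos[OF that] by (simp add: c_def divide_le_eq_1)
  have "double_limit C UNIV (\<lambda>c i. c i)"
    unfolding double_limit_def
  proof (intro allI impI)
    fix cc :: "nat \<Rightarrow> nat \<times> 'a list \<Rightarrow> real" and i :: "nat \<Rightarrow> nat \<times> 'a list" and U V :: "nat filter"
    assume cc: "range cc \<subseteq> C" and U: "nonprincipal_ultrafilter U" and V: "nonprincipal_ultrafilter V"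
    have "\<forall>m. \<exists>x y. cc m = c x y \<and> x \<in> S \<and> y \<in> S \<and> x \<noteq> y"
      using cc unfolding C_def by blast
    then obtain x y where xy: "\<And>m. cc m = c (x m) (y m)" "\<And>m. x m \<in> S" "\<And>m. y m \<in> S" "\<And>m. x m \<noteq> y m"
      by metis
    define ok where "ok n \<longleftrightarrow> snd (i n) ! 0 \<in> S \<and> snd (i n) ! 1 \<in> S" for n
    \<comment> \<open>Indices that fail the guard are given \<open>p = q\<close>, for which the tent
      is identically 0 because division by 0 yields 0.\<close>
    define p where "p n = (if ok n then snd (i n) ! 0 else x 0)" for n
    define q where "q n = (if ok n then snd (i n) ! 1 else x 0)" for n
    have pq: "range p \<subseteq> mspace M" "range q \<subseteq> mspace M" "range x \<subseteq> mspace M" "range y \<subseteq> mspace M"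
      using xy by (auto simp: p_def q_def ok_def S_def)
    have "k (i n) u = tent M r (p n) (q n) u" for n u
      using xy(2)[of 0] by (auto simp: k_def p_def q_def ok_def tent_def S_def)
    then have "cc m (i n) = (tent M r (p n) (q n) (x m) - tent M r (p n) (q n) (y m))
        / w (mdist M (x m) (y m))" for m n
      by (simp add: xy(1) c_def d_def)
    then show "Lim U (\<lambda>m. Lim V (\<lambda>n. cc m (i n))) = Lim V (\<lambda>n. Lim U (\<lambda>m. cc m (i n)))"
      using tent_Lim_commute[OF st pq(3,4) xy(4) pq(1,2) U V r r_inf w w_0] by simp
  qed
  then have dl: "double_limit (insert (\<lambda>i. 0) C) UNIV (\<lambda>c i. c i)"
    by (rule double_limit_insert[where K = 0]) simp
  \<comment> \<open>Any null sequence of positive numbers at most 1 would do, as it leaves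
    \<open>a n\<close> nonnegative; \<open>a\<close> is then fixed by the required sum,
    \<open>(a n + b n)\<^sup>2 = 2 ^ Suc n\<close>.\<close>
  define b :: "nat \<Rightarrow> real" where "b n = 1 / real (Suc n)" for n
  define a where "a n = sqrt (2 ^ Suc n) - b n" for n
  interpret interpolation "insert (\<lambda>i. 0) C" a b
  proof
    show "\<bar>c i\<bar> \<le> 1" if "c \<in> insert (\<lambda>i. 0) C" for c i
      using that by (elim insertE) (auto simp: C_def intro: c_le)
    show "0 \<le> a n" for n
    proof -
      have "b n \<le> 1" by (simp add: b_def)
      also have "1 \<le> sqrt (2 ^ Suc n)" using one_le_power[of "2::real" "Suc n"] by simp
      finally show ?thesis by (simp add: a_def)
    qed
    show "b \<longlonglongrightarrow> 0"
      using LIMSEQ_inverse_real_of_nat by (simp add: b_def[abs_def] inverse_eq_divide)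
    have weights: "(1 / (a n + b n))\<^sup>2 = (1 / 2) ^ Suc n" for n
      by (simp add: a_def power_divide)
    show "(\<lambda>n. (1 / (a n + b n))\<^sup>2) sums 1"
      unfolding weights by (rule power_half_series)
  qed (use dl in \<open>auto simp: b_def\<close>)
  \<comment> \<open>A base point exists only if \<open>M\<close> is nonempty, and it is used only
    once a point of \<open>M\<close> is given.\<close>
  define z where "z = (SOME z. z \<in> S)"
  define f where "f x = (\<lambda>i. k i x - k i z)" for x
  have kV: "(\<lambda>i. k i x - k i y) \<in> Vc" "nrm (\<lambda>i. k i x - k i y) \<le> w (d x y)"
    if xy: "x \<in> S" "y \<in> S" for x y
  proof -
    have "(\<lambda>i. k i x - k i y) \<in> Vc \<and> nrm (\<lambda>i. k i x - k i y) \<le> w (d x y)"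
    proof (cases "x = y")
      case True
      have "0 \<le> d x y" by (simp add: d_def)
      then have "0 \<le> w (d x y)" using w[of "d x y"] by linarith
      then show ?thesis using True zero_Vc by simp
    next
      case False
      note p = pos[OF xy False]
      have cC: "c x y \<in> insert (\<lambda>i. 0) C" using xy False by (auto simp: C_def)
      have "(\<lambda>i. k i x - k i y) = (\<lambda>i. w (d x y) * c x y i)" using p by (simp add: c_def)
      then show ?thesis
        using mult_Vc[OF C_Vc(1)[OF cC], of "w (d x y)"] mult_left_mono[OF C_Vc(2)[OF cC], of "w (d x y)"] p
        by simp
    qed
    then show "(\<lambda>i. k i x - k i y) \<in> Vc" "nrm (\<lambda>i. k i x - k i y) \<le> w (d x y)" by auto
  qed
  have zS: "z \<in> S" if "x \<in> S" for x using that unfolding z_def by (rule someI)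
  have fV: "f x \<in> Vc" if "x \<in> S" for x unfolding f_def by (rule kV(1)[OF that zS[OF that]])
  have "r (d x y) \<le> mdist (norm_metric V) (f x) (f y) \<and> mdist (norm_metric V) (f x) (f y) \<le> w (d x y)"
    if xy: "x \<in> S" "y \<in> S" for x y
  proof -
    have eq: "mdist (norm_metric V) (f x) (f y) = nrm (\<lambda>i. k i x - k i y)"
      using mdist_V[OF fV[OF xy(1)] fV[OF xy(2)]] by (simp add: f_def)
    have D: "0 \<le> d y x" by (simp add: d_def)
    \<comment> \<open>This coordinate is the tent centred at \<open>x\<close> that vanishes at
      \<open>y\<close>; its height is the required lower bound.\<close>
    have "r (d x y) \<le> \<bar>k (0, [y, x]) x - k (0, [y, x]) y\<bar>"
    proof (cases "x = y")
      case True
      then have "d x y = 0" using xy by (simp add: d_def S_def)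
      then have "r (d x y) \<le> 0" using r(2)[of 0] by simp
      then show ?thesis by linarith
    next
      case False
      have "d x x = 0" "d x y = d y x" using xy by (simp_all add: d_def S_def mdist_commute)
      then show ?thesis
        using xy pos(1)[OF xy False] r(1)[OF D] D by (simp add: k_def tent_def d_def[symmetric])
    qed
    also have "\<dots> \<le> nrm (\<lambda>i. k i x - k i y)"
      using point_le_nrm[OF kV(1)[OF xy], of "(0, [y, x])"] by simp
    finally show ?thesis using kV(2)[OF xy] eq by simp
  qed
  moreover have "norm_metric V \<in> reflexive_banach_spaces"
    unfolding reflexive_banach_spaces_def using banach_space_V reflexive_space_V by blast
  moreover have "f \<in> mspace M \<rightarrow> mspace (norm_metric V)"
    using fV by (auto simp: mspace_V S_def)
  ultimately show ?thesis
    unfolding S_def d_def by blast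
qed

section \<open>Monotone versions of the control functions, and the conclusion\<close>

lemma lower_controls_le:
  assumes "\<rho> \<in> lower_controls" "0 \<le> t"
  shows "0 \<le> \<rho> t" "\<rho> t \<le> t"
proof -
  show "0 \<le> \<rho> t" using assms by (auto simp: lower_controls_def Pi_iff)
  show "\<rho> t \<le> t" using assms by (cases "t \<le> 1") (auto simp: lower_controls_def)
qed

lemma upper_controls_ge:
  assumes "\<omega> \<in> upper_controls" "0 \<le> t"
  shows "t \<le> \<omega> t"
  using assms by (cases "t \<le> 1") (auto simp: upper_controls_def)

text \<open>\<open>r\<close> is the least nondecreasing majorant of \<open>\<rho>\<close>. Sublinear
  growth survives: arguments up to \<open>T1\<close> contribute at most \<open>T1\<close>, which is
  negligible against large \<open>t\<close>, and for larger \<open>s\<close> the quotient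
  \<open>\<rho> s / s\<close> is already small.\<close>

lemma lower_controls_Sup:
  assumes \<rho>: "\<rho> \<in> lower_controls"
  defines "r \<equiv> \<lambda>t. SUP s\<in>{0..t}. \<rho> s"
  shows "\<And>s t. 0 \<le> s \<Longrightarrow> s \<le> t \<Longrightarrow> \<rho> s \<le> r t" "\<And>t. 0 \<le> t \<Longrightarrow> 0 \<le> r t" "\<And>t. 0 \<le> t \<Longrightarrow> r t \<le> t"
    "((\<lambda>t. r t / t) \<longlongrightarrow> 0) at_top"
proof -
  note le = lower_controls_le[OF \<rho>]
  show up: "\<rho> s \<le> r t" if "0 \<le> s" "s \<le> t" for s t
    unfolding r_def using that by (intro cSUP_upper bdd_aboveI[of _ t]) (auto intro: order_trans[OF le(2)])
  show r0: "0 \<le> r t" if "0 \<le> t" for t using up[of t t] le(1)[OF that] that by linarith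
  have least: "r t \<le> b" if "0 \<le> t" "\<And>s. 0 \<le> s \<Longrightarrow> s \<le> t \<Longrightarrow> \<rho> s \<le> b" for t b
    unfolding r_def using that by (intro cSUP_least) auto
  show "r t \<le> t" if "0 \<le> t" for t
    using that le(2) by (intro least) (auto intro: order_trans)
  show "((\<lambda>t. r t / t) \<longlongrightarrow> 0) at_top"
  proof (rule tendstoI)
    fix e :: real assume e: "0 < e"
    have "((\<lambda>t. \<rho> t / t) \<longlongrightarrow> 0) at_top" using \<rho> by (simp add: lower_controls_def)
    then have "eventually (\<lambda>t. dist (\<rho> t / t) 0 < e / 2) at_top"
      by (rule tendstoD) (use e in simp)
    then obtain T where T: "\<And>t. T \<le> t \<Longrightarrow> \<bar>\<rho> t / t\<bar> < e / 2"
      by (auto simp: eventually_at_top_linorder)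
    define T1 where "T1 = max T 1"
    have "\<bar>r t / t\<bar> < e" if t: "max 1 (2 * T1 / e) \<le> t" for t
    proof -
      have t0: "0 < t" and tT: "T1 \<le> e / 2 * t" using t e by (auto simp: field_simps)
      have "r t \<le> e / 2 * t"
      proof (rule least)
        fix s assume s: "0 \<le> s" "s \<le> t"
        show "\<rho> s \<le> e / 2 * t"
        proof (cases "s \<le> T1")
          case True
          then show ?thesis using le(2)[OF s(1)] tT by linarith
        next
          case False
          then have "\<bar>\<rho> s / s\<bar> < e / 2" "0 < s" using T[of s] by (auto simp: T1_def)
          then have "\<rho> s \<le> e / 2 * s" by (simp add: field_simps abs_less_iff)
          also have "\<dots> \<le> e / 2 * t" using s(2) e by (intro mult_left_mono) auto
          finally show ?thesis .
        qed
      qed (use t0 in simp)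
      moreover have "e / 2 * t < e * t" using e t0 by simp
      ultimately have "r t < e * t" by linarith
      then show ?thesis using t0 r0[of t] by (simp add: field_simps)
    qed
    then show "eventually (\<lambda>t. dist (r t / t) 0 < e) at_top"
      unfolding eventually_at_top_linorder by (intro exI[of _ "max 1 (2 * T1 / e)"]) simp
  qed
qed

text \<open>\<open>w\<close> is the largest nondecreasing minorant of \<open>\<omega>\<close>. The
  steepness at 0 survives: for \<open>s\<close> below \<open>\<delta>\<close> one has
  \<open>K * t \<le> K * s \<le> \<omega> s\<close>, and for larger \<open>s\<close> already
  \<open>\<omega> s \<ge> s \<ge> \<delta>\<close>, which exceeds \<open>K * t\<close> for small
  \<open>t\<close>.\<close>

lemma upper_controls_Inf:
  assumes \<omega>: "\<omega> \<in> upper_controls"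
  defines "w \<equiv> \<lambda>t. INF s\<in>{t..}. \<omega> s"
  shows "\<And>s t. 0 \<le> t \<Longrightarrow> t \<le> s \<Longrightarrow> w t \<le> \<omega> s" "\<And>t. 0 \<le> t \<Longrightarrow> t \<le> w t"
    "filterlim (\<lambda>t. w t / t) at_top (at_right 0)"
proof -
  note ge = upper_controls_ge[OF \<omega>]
  show "w t \<le> \<omega> s" if "0 \<le> t" "t \<le> s" for s t
    unfolding w_def using that by (intro cINF_lower bdd_belowI[of _ t]) (auto intro: order_trans[OF _ ge])
  have gr: "b \<le> w t" if "\<And>s. t \<le> s \<Longrightarrow> b \<le> \<omega> s" for t b
    unfolding w_def using that by (intro cINF_greatest) auto
  show "t \<le> w t" if "0 \<le> t" for t
    using that ge by (intro gr) (auto intro: order_trans)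
  show "filterlim (\<lambda>t. w t / t) at_top (at_right 0)"
    unfolding filterlim_at_top_gt[of _ _ 0]
  proof (intro allI impI)
    fix K :: real assume K: "0 < K"
    have "filterlim (\<lambda>t. \<omega> t / t) at_top (at_right 0)" using \<omega> by (simp add: upper_controls_def)
    then have "eventually (\<lambda>t. K \<le> \<omega> t / t) (at_right 0)" by (simp add: filterlim_at_top)
    then obtain \<delta> where \<delta>: "0 < \<delta>" "\<And>t. 0 < t \<Longrightarrow> t < \<delta> \<Longrightarrow> K \<le> \<omega> t / t"
      unfolding eventually_at_right_field by auto
    have "K \<le> w t / t" if t: "0 < t" "t < \<delta> / K" for t
    proof -
      have Kt: "K * t < \<delta>" using t K by (simp add: field_simps)
      have "K * t \<le> w t"
      proof (rule gr)
        fix s assume s: "t \<le> s"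
        show "K * t \<le> \<omega> s"
        proof (cases "s < \<delta>")
          case True
          then have "K * s \<le> \<omega> s" using \<delta>(2)[of s] s t(1) by (simp add: field_simps)
          moreover have "K * t \<le> K * s" using s K by simp
          ultimately show ?thesis by linarith
        next
          case False
          then show ?thesis using ge[of s] Kt s t(1) by linarith
        qed
      qed
      then show ?thesis using t(1) by (simp add: field_simps)
    qed
    moreover have "0 < \<delta> / K" using \<delta>(1) K by simp
    ultimately show "eventually (\<lambda>t. K \<le> w t / t) (at_right 0)"
      unfolding eventually_at_right_field by auto
  qed
qed

theorem corollary5:
  fixes M :: "'a metric"
  assumes "stable_metric M"
  shows "nearly_isometrically_embeds M
           (reflexive_banach_spaces :: 'a target_point metric set)"
proof -
  define good where "good \<rho> \<omega> Y f \<longleftrightarrow> Y \<in> reflexive_banach_spaces \<and> f \<in> mspace M \<rightarrow> mspace Y \<and>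
      (\<forall>t\<ge>0. ereal (\<rho> t) \<le> compression_modulus M Y f t \<and> expansion_modulus M Y f t \<le> ereal (\<omega> t))"
    for \<rho> \<omega> and Y :: "'a target_point metric" and f
  have ex: "\<exists>Y f. good \<rho> \<omega> Y f" if \<rho>: "\<rho> \<in> lower_controls" and \<omega>: "\<omega> \<in> upper_controls" for \<rho> \<omega>
  proof -
    note r = lower_controls_Sup[OF \<rho>] and w = upper_controls_Inf[OF \<omega>]
    obtain Y :: "'a target_point metric" and f
      where Y: "Y \<in> reflexive_banach_spaces" "f \<in> mspace M \<rightarrow> mspace Y"
        and lo: "\<And>x y. x \<in> mspace M \<Longrightarrow> y \<in> mspace M \<Longrightarrow>
          (SUP s\<in>{0..mdist M x y}. \<rho> s) \<le> mdist Y (f x) (f y)"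
        and up: "\<And>x y. x \<in> mspace M \<Longrightarrow> y \<in> mspace M \<Longrightarrow>
          mdist Y (f x) (f y) \<le> (INF s\<in>{mdist M x y..}. \<omega> s)"
      using stable_metric_embedding[OF assms r(2,3,4) w(2,3)] by blast
    have "ereal (\<rho> t) \<le> compression_modulus M Y f t" if t: "0 \<le> t" for t
      unfolding compression_modulus_def
    proof (rule Inf_greatest, clarify)
      fix x y assume "x \<in> mspace M" "y \<in> mspace M" "t \<le> mdist M x y"
      then show "ereal (\<rho> t) \<le> ereal (mdist Y (f x) (f y))"
        using r(1)[OF t, of "mdist M x y"] lo[of x y] by simp
    qed
    moreover have "expansion_modulus M Y f t \<le> ereal (\<omega> t)" for t
      unfolding expansion_modulus_def
    proof (rule Sup_least, clarify)
      fix x y assume "x \<in> mspace M" "y \<in> mspace M" "mdist M x y \<le> t"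
      then show "ereal (mdist Y (f x) (f y)) \<le> ereal (\<omega> t)"
        using w(1)[of "mdist M x y" t] up[of x y] by simp
    qed
    ultimately show ?thesis using Y unfolding good_def by blast
  qed
  \<comment> \<open>Space and map depend on each other, so they are chosen together, as a pair, for
    all controls at once.\<close>
  have "\<forall>\<rho> \<omega>. \<exists>Yf. \<rho> \<in> lower_controls \<longrightarrow> \<omega> \<in> upper_controls \<longrightarrow> good \<rho> \<omega> (fst Yf) (snd Yf)"
    using ex by (metis fst_conv snd_conv)
  then obtain F where F: "\<And>\<rho> \<omega>. \<rho> \<in> lower_controls \<Longrightarrow> \<omega> \<in> upper_controls \<Longrightarrow>
      good \<rho> \<omega> (fst (F \<rho> \<omega>)) (snd (F \<rho> \<omega>))"
    by metis
  show ?thesis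
    unfolding nearly_isometrically_embeds_def
    by (rule exI[of _ "\<lambda>\<rho> \<omega>. fst (F \<rho> \<omega>)"], rule exI[of _ "\<lambda>\<rho> \<omega>. snd (F \<rho> \<omega>)"])
      (use F in \<open>simp add: good_def\<close>)
qed

end
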